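(* Let $a,b,c,d$ be strictly positive integers with $\gcd(a,b,c,d)=1$, let $V\subset\mathbf{P}^3_{\mathbf{Q}}$ be the diagonal cubic surface given by $aX^3+bY^3+cZ^3+dT^3=0$, and let $E$ be the étale $\mathbf{Q}$-algebra attached to $(a,b,c,d)$ defined in the context. Then for every prime $p$ not dividing $3abcd$, one has $$\frac{\sharp V(\mathbf{F}_p)}{p^2}=1+\frac{\nu_E(p)-2}{p}+\frac{1}{p^2}.$$
   Context: $V(\mathbf{F}_p)$ denotes the set of points of $\mathbf{P}^3(\mathbf{F}_p)$ satisfying $aX^3+bY^3+cZ^3+dT^3=0$ in $\mathbf{F}_p$, and $\sharp$ denotes cardinality. Let $\theta\in\overline{\mathbf{Q}}$ be a primitive third root of unity. Let $\gamma,\gamma',\gamma''\in\overline{\mathbf{Q}}$ be cube roots of $\frac{ad}{bc}$, $\frac{ab}{cd}$, $\frac{ac}{bd}$ respectively. Define $E_1=\mathbf{Q}(\gamma)$ if $ad/bc$ is not a cube in $\mathbf{Q}$, and $E_1=\mathbf{Q}(\theta)\times\mathbf{Q}$ otherwise. Similarly define $E_2$ from $\gamma'$ and $ab/cd$, and $E_3$ from $\gamma''$ and $ac/bd$. Put $E=E_1\times E_2\times E_3$. For an étale algebra $F$ over $\mathbf{Q}$ and a prime $p$, $\nu_F(p)$ denotes the number of components (field factors) of $F\otimes_{\mathbf{Q}}\mathbf{Q}_p$ of degree one over $\mathbf{Q}_p$. *)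

theory Defs
  imports
    "HOL-Number_Theory.Residues"
    "HOL-Algebra.Algebraic_Closure_Type"
    "HOL-Algebra.Chinese_Remainder"
    "HOL-Algebra.Embedded_Algebras"
    "HOL-Algebra.Generated_Fields"
    "HOL-Algebra.Module"
    "HOL-Algebra.QuotRing"
begin

section \<open>Points of a diagonal cubic surface over a field\<close>

definition nonzero_quads :: "('a, 'm) ring_scheme \<Rightarrow> ('a \<times> 'a \<times> 'a \<times> 'a) set" where
  "nonzero_quads K =
     carrier K \<times> carrier K \<times> carrier K \<times> carrier K - {(\<zero>\<^bsub>K\<^esub>, \<zero>\<^bsub>K\<^esub>, \<zero>\<^bsub>K\<^esub>, \<zero>\<^bsub>K\<^esub>)}"

definition proportional :: "('a, 'm) ring_scheme \<Rightarrow> ('a \<times> 'a \<times> 'a \<times> 'a) rel" where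
  "proportional K =
     {((x, y, z, t), (x', y', z', t')).
        (x, y, z, t) \<in> nonzero_quads K \<and> (x', y', z', t') \<in> nonzero_quads K \<and>
        (\<exists>l \<in> carrier K - {\<zero>\<^bsub>K\<^esub>}.
           x' = l \<otimes>\<^bsub>K\<^esub> x \<and> y' = l \<otimes>\<^bsub>K\<^esub> y \<and> z' = l \<otimes>\<^bsub>K\<^esub> z \<and> t' = l \<otimes>\<^bsub>K\<^esub> t)}"

definition proj3 :: "('a, 'm) ring_scheme \<Rightarrow> ('a \<times> 'a \<times> 'a \<times> 'a) set set" where
  "proj3 K = nonzero_quads K // proportional K"

definition diag_cubic_points ::
    "int \<Rightarrow> int \<Rightarrow> int \<Rightarrow> int \<Rightarrow> ('a, 'm) ring_scheme \<Rightarrow> ('a \<times> 'a \<times> 'a \<times> 'a) set set" where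
  "diag_cubic_points a b c d K =
     {P \<in> proj3 K. \<forall>(x, y, z, t) \<in> P.
        add_pow K a (x [^]\<^bsub>K\<^esub> (3::nat)) \<oplus>\<^bsub>K\<^esub> add_pow K b (y [^]\<^bsub>K\<^esub> (3::nat)) \<oplus>\<^bsub>K\<^esub>
        add_pow K c (z [^]\<^bsub>K\<^esub> (3::nat)) \<oplus>\<^bsub>K\<^esub> add_pow K d (t [^]\<^bsub>K\<^esub> (3::nat)) = \<zero>\<^bsub>K\<^esub>}"


section \<open>Algebras\<close>

text \<open>A commutative algebra over a ring \<open>R\<close> is a record of type \<^typ>\<open>('r, 'a) module\<close>,
  as in the locale \<^locale>\<open>algebra\<close>.\<close>

definition alg_prod :: "('r, 'a) module list \<Rightarrow> ('r, 'a list) module" where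
  "alg_prod As = ring.extend (RDirProd_list As) \<lparr>module.smult = (\<lambda>r xs. map2 (\<lambda>A x. r \<odot>\<^bsub>A\<^esub> x) As xs)\<rparr>"

text \<open>The monoid ring \<open>\<int>[M]\<close>: finitely supported functions with convolution.\<close>

definition int_monoid_ring :: "('a, 'm) monoid_scheme \<Rightarrow> ('a \<Rightarrow> int) ring" where
  "int_monoid_ring M =
     \<lparr>carrier = {f. finite {x. f x \<noteq> 0} \<and> {x. f x \<noteq> 0} \<subseteq> carrier M},
      monoid.mult = (\<lambda>f g z. \<Sum>(x, y) \<in> {(x, y). f x \<noteq> 0 \<and> g y \<noteq> 0 \<and> x \<otimes>\<^bsub>M\<^esub> y = z}. f x * g y),
      one = (\<lambda>z. if z = \<one>\<^bsub>M\<^esub> then 1 else 0),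
      zero = (\<lambda>z. 0),
      add = (\<lambda>f g z. f z + g z)\<rparr>"

definition basis_elem :: "'a \<Rightarrow> 'a \<Rightarrow> int" where
  "basis_elem x = (\<lambda>z. if z = x then 1 else 0)"

text \<open>As an additive group, \<open>\<int>[A \<times> B]\<close> is the free abelian group on \<open>A \<times> B\<close>. The tensor product
  \<open>A \<otimes>\<^sub>R B\<close> is its quotient by the additive subgroup generated by the relations below, which is
  already an ideal, since multiplying a relation by a pair gives a relation of the same kind.\<close>

definition tensor_relations ::
    "('r, 'k) ring_scheme \<Rightarrow> ('r, 'a) module \<Rightarrow> ('r, 'b) module \<Rightarrow> ('a \<times> 'b \<Rightarrow> int) set" where
  "tensor_relations R A B =
     {basis_elem (x \<oplus>\<^bsub>A\<^esub> x', y) - basis_elem (x, y) - basis_elem (x', y) | x x' y.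
        x \<in> carrier A \<and> x' \<in> carrier A \<and> y \<in> carrier B} \<union>
     {basis_elem (x, y \<oplus>\<^bsub>B\<^esub> y') - basis_elem (x, y) - basis_elem (x, y') | x y y'.
        x \<in> carrier A \<and> y \<in> carrier B \<and> y' \<in> carrier B} \<union>
     {basis_elem (r \<odot>\<^bsub>A\<^esub> x, y) - basis_elem (x, r \<odot>\<^bsub>B\<^esub> y) | r x y.
        r \<in> carrier R \<and> x \<in> carrier A \<and> y \<in> carrier B}"

definition tensor_ideal ::
    "('r, 'k) ring_scheme \<Rightarrow> ('r, 'a) module \<Rightarrow> ('r, 'b) module \<Rightarrow> ('a \<times> 'b \<Rightarrow> int) set" where
  "tensor_ideal R A B = Idl\<^bsub>int_monoid_ring (A \<times>\<times> B)\<^esub> (tensor_relations R A B)"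

definition tensor_ring ::
    "('r, 'k) ring_scheme \<Rightarrow> ('r, 'a) module \<Rightarrow> ('r, 'b) module \<Rightarrow> ('a \<times> 'b \<Rightarrow> int) set ring" where
  "tensor_ring R A B = int_monoid_ring (A \<times>\<times> B) Quot tensor_ideal R A B"

definition pure_tensor ::
    "('r, 'k) ring_scheme \<Rightarrow> ('r, 'a) module \<Rightarrow> ('r, 'b) module \<Rightarrow> 'a \<Rightarrow> 'b \<Rightarrow> ('a \<times> 'b \<Rightarrow> int) set" where
  "pure_tensor R A B x y =
     tensor_ideal R A B +>\<^bsub>int_monoid_ring (A \<times>\<times> B)\<^esub> basis_elem (x, y)"

text \<open>\<open>A \<otimes>\<^sub>R B\<close> as an algebra over the second factor \<open>B\<close>.\<close>

definition base_change ::
    "('r, 'k) ring_scheme \<Rightarrow> ('r, 'a) module \<Rightarrow> ('r, 'b) module \<Rightarrow>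
     ('b, ('a \<times> 'b \<Rightarrow> int) set) module" where
  "base_change R A B = ring.extend (tensor_ring R A B)
     \<lparr>module.smult = (\<lambda>y t. pure_tensor R A B \<one>\<^bsub>A\<^esub> y \<otimes>\<^bsub>tensor_ring R A B\<^esub> t)\<rparr>"

text \<open>The field factors of a commutative ring \<open>A\<close> are the direct factors \<open>eA\<close>, with \<open>e\<close> idempotent,
  which are fields with identity \<open>e\<close>; \<open>e\<close> and \<open>eA\<close> determine each other.\<close>

definition field_factors :: "('a, 'm) ring_scheme \<Rightarrow> 'a set set" where
  "field_factors A =
     {PIdl\<^bsub>A\<^esub> e | e. e \<in> carrier A \<and> e \<otimes>\<^bsub>A\<^esub> e = e \<and> field (A \<lparr>carrier := PIdl\<^bsub>A\<^esub> e, one := e\<rparr>)}"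

definition field_factors_of_degree ::
    "nat \<Rightarrow> ('k, 'm) ring_scheme \<Rightarrow> ('k, 'a) module \<Rightarrow> 'a set set" where
  "field_factors_of_degree n K A =
     {L \<in> field_factors A. ring.dimension A n ((\<lambda>k. k \<odot>\<^bsub>A\<^esub> \<one>\<^bsub>A\<^esub>) ` carrier K) L}"


section \<open>The field of p-adic numbers\<close>

definition padic_abs :: "nat \<Rightarrow> rat \<Rightarrow> real" where
  "padic_abs p q =
     (if q = 0 then 0
      else real p powi (int (multiplicity (int p) (snd (quotient_of q)))
                      - int (multiplicity (int p) (fst (quotient_of q)))))"

definition padic_Cauchy_ring :: "nat \<Rightarrow> (nat \<Rightarrow> rat) ring" where
  "padic_Cauchy_ring p =
     \<lparr>carrier = {x. \<forall>\<epsilon>>0. \<exists>N. \<forall>m\<ge>N. \<forall>n\<ge>N. padic_abs p (x m - x n) < \<epsilon>},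
      monoid.mult = (\<lambda>x y n. x n * y n),
      one = (\<lambda>n. 1),
      zero = (\<lambda>n. 0),
      add = (\<lambda>x y n. x n + y n)\<rparr>"

definition padic_null :: "nat \<Rightarrow> (nat \<Rightarrow> rat) set" where
  "padic_null p = {x. (\<lambda>n. padic_abs p (x n)) \<longlonglongrightarrow> 0}"

definition padic_ring :: "nat \<Rightarrow> (nat \<Rightarrow> rat) set ring" where
  "padic_ring p = padic_Cauchy_ring p Quot padic_null p"

text \<open>\<open>\<rat>\<^sub>p\<close> as a \<open>\<rat>\<close>-algebra.\<close>

definition padic_field :: "nat \<Rightarrow> (rat, (nat \<Rightarrow> rat) set) module" where
  "padic_field p = ring.extend (padic_ring p)
     \<lparr>module.smult = (\<lambda>q x. (padic_null p +>\<^bsub>padic_Cauchy_ring p\<^esub> (\<lambda>n. q)) \<otimes>\<^bsub>padic_ring p\<^esub> x)\<rparr>"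


section \<open>The etale algebra of a diagonal cubic surface\<close>

text \<open>\<open>\<rat>(S)\<close> inside the complex numbers, as a \<open>\<rat>\<close>-algebra; \<open>\<rat>\<close> itself is \<open>rat_adjoin {}\<close>.\<close>

definition rat_adjoin :: "complex set \<Rightarrow> (rat, complex) module" where
  "rat_adjoin S =
     ring.extend (ring_of_type_algebra \<lparr>carrier := generate_field ring_of_type_algebra (\<rat> \<union> S)\<rparr>)
       \<lparr>module.smult = (\<lambda>q x. of_rat q * x)\<rparr>"

text \<open>For a cube root \<open>\<gamma>\<close> of \<open>n\<close> and a primitive third root of unity \<open>\<theta>\<close>.\<close>

definition cube_root_algebra :: "complex \<Rightarrow> rat \<Rightarrow> complex \<Rightarrow> (rat, complex list) module" where
  "cube_root_algebra \<theta> n \<gamma> =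
     (if \<exists>r. r ^ 3 = n then alg_prod [rat_adjoin {\<theta>}, rat_adjoin {}] else alg_prod [rat_adjoin {\<gamma>}])"

definition deg_one_count :: "(rat, 'a) module \<Rightarrow> nat \<Rightarrow> nat" where
  "deg_one_count F p =
     card (field_factors_of_degree 1 (padic_field p)
       (base_change ring_of_type_algebra F (padic_field p)))"

end

theory Submission
  imports Defs
begin

text \<open>
  Both sides are computed from the numbers \<open>\<nu>\<^sub>i\<close> of cube roots of \<open>ad/bc\<close>, \<open>ab/cd\<close> and \<open>ac/bd\<close> in the
  field with \<open>p\<close> elements: the surface has \<open>p\<^sup>2 + p + 1 + p (\<nu>\<^sub>1 + \<nu>\<^sub>2 + \<nu>\<^sub>3 - 3)\<close> points, and \<open>E\<close> has
  \<open>\<nu>\<^sub>1 + \<nu>\<^sub>2 + \<nu>\<^sub>3\<close> factors of degree one over the p-adic numbers.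

  \<^bold>\<open>Factors of degree one.\<close> For a field \<open>K\<close> and an algebra \<open>A\<close>, a direct factor of \<open>A \<otimes> K\<close> that is a line
  \<open>Ke\<close>, with \<open>e\<close> idempotent, gives a homomorphism \<open>\<phi> : A \<rightarrow> K\<close> by \<open>(x \<otimes> 1) e = (1 \<otimes> \<phi>(x)) e\<close>, and \<open>e\<close> is
  determined by \<open>\<phi>\<close>. Conversely \<open>e\<close> is found by Lagrange interpolation when \<open>\<phi>\<close> is nonzero on a factor of
  \<open>A\<close> generated by an element \<open>\<alpha>\<close> whose cube is a nonzero scalar: \<open>e = (\<alpha>\<^sup>2 + r\<alpha> + r\<^sup>2) / (3r\<^sup>2)\<close> with
  \<open>r = \<phi>(\<alpha>)\<close>; that \<open>e\<close> is not zero follows from the universal property of the tensor product. All factors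
  of \<open>E\<close> are of this kind, since \<open>\<theta>\<^sup>3 = 1\<close> and the rationals are generated by \<open>1\<close>. Thus
  (\<open>card_factors_of_degree_one\<close>) degree-one factors are counted by homomorphisms. A homomorphism from a
  product of algebras to a field factors through exactly one of them (\<open>cubic_split_alg_prod\<close>), and
  homomorphisms from the algebra of a cube root of \<open>n\<close> correspond to the cube roots of \<open>n\<close> in \<open>K\<close>, whether
  or not \<open>n\<close> is a rational cube (\<open>card_alg_homs_cube_root_algebra\<close>). Hensel lifting identifies the cube
  roots of a unit in the p-adic numbers with its cube roots modulo \<open>p\<close> (\<open>cube_roots_bij\<close>), because \<open>p \<noteq> 3\<close>.

  \<^bold>\<open>Points.\<close> If the finite field with \<open>q\<close> elements has no primitive cube root of unity, then cubing is
  bijective, all \<open>\<nu>\<^sub>i\<close> are \<open>1\<close>, and there are \<open>q\<^sup>3\<close> affine solutions. Otherwise let \<open>\<chi>\<close> be a cubic character;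
  the number of \<open>x\<close> with \<open>x\<^sup>3 = u\<close> is \<open>1 + \<chi>(u) + \<chi>(u)\<^sup>2\<close>. Expanding, the number of affine solutions is \<open>q\<^sup>3\<close>
  plus the sums of \<open>\<chi>\<^sub>1(v\<^sub>1)\<chi>\<^sub>2(v\<^sub>2)\<chi>\<^sub>3(v\<^sub>3)\<chi>\<^sub>4(v\<^sub>4)\<close> over \<open>v\<^sub>1 + v\<^sub>2 + v\<^sub>3 + v\<^sub>4 = 0\<close>, weighted by values at the
  coefficients, with all \<open>\<chi>\<^sub>i\<close> in \<open>{\<chi>, \<chi>\<^sup>2}\<close>. Scaling the variables shows that only the six sums with
  \<open>\<chi>\<^sub>1\<chi>\<^sub>2\<chi>\<^sub>3\<chi>\<^sub>4 = 1\<close> survive. Each of them equals \<open>q (q - 1)\<close> (\<open>quad_sum_mixed\<close>): after pairing \<open>\<chi>\<close> with \<open>\<chi>\<^sup>2\<close>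
  one convolves \<open>\<chi> * \<chi>\<^sup>2\<close>, which is \<open>q - 1\<close> at zero and \<open>-1\<close> elsewhere, with itself. The weights add up to
  \<open>\<nu>\<^sub>1 + \<nu>\<^sub>2 + \<nu>\<^sub>3 - 3\<close> (\<open>card_diag4_formula\<close>).
\<close>

section \<open>Monoid rings and tensor products of algebras\<close>

lemma int_monoid_ring_carrier:
  "f \<in> carrier (int_monoid_ring M) \<longleftrightarrow> finite {x. f x \<noteq> 0} \<and> {x. f x \<noteq> 0} \<subseteq> carrier M"
  by (simp add: int_monoid_ring_def)

lemma int_monoid_ring_simps [simp]:
  "\<zero>\<^bsub>int_monoid_ring M\<^esub> = (\<lambda>z. 0)"
  "\<one>\<^bsub>int_monoid_ring M\<^esub> = basis_elem \<one>\<^bsub>M\<^esub>"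
  "f \<oplus>\<^bsub>int_monoid_ring M\<^esub> g = (\<lambda>z. f z + g z)"
  by (simp_all add: int_monoid_ring_def basis_elem_def)

text \<open>Convolution as a sum over fixed finite sets: it may range over any sets that contain the supports.\<close>

lemma int_monoid_ring_mult:
  assumes "finite S" "{x. f x \<noteq> 0} \<subseteq> S" "finite S'" "{x. g x \<noteq> 0} \<subseteq> S'"
  shows "(f \<otimes>\<^bsub>int_monoid_ring M\<^esub> g) z = (\<Sum>x\<in>S. \<Sum>y\<in>S'. if x \<otimes>\<^bsub>M\<^esub> y = z then f x * g y else 0)"
proof -
  have "(f \<otimes>\<^bsub>int_monoid_ring M\<^esub> g) z =
      (\<Sum>(x, y) \<in> {(x, y). f x \<noteq> 0 \<and> g y \<noteq> 0 \<and> x \<otimes>\<^bsub>M\<^esub> y = z}. f x * g y)"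
    by (simp add: int_monoid_ring_def)
  also have "\<dots> = (\<Sum>(x, y) \<in> S \<times> S'. if x \<otimes>\<^bsub>M\<^esub> y = z then f x * g y else 0)"
    using assms by (intro sum.mono_neutral_cong_left) (auto split: if_splits)
  finally show ?thesis
    by (simp add: sum.cartesian_product)
qed

context comm_monoid
begin

abbreviation (input) ZG where "ZG \<equiv> int_monoid_ring G"

lemma int_monoid_ring_mult_closed:
  assumes f: "f \<in> carrier ZG" and g: "g \<in> carrier ZG"
  shows "f \<otimes>\<^bsub>ZG\<^esub> g \<in> carrier ZG"
proof -
  let ?S = "{x. f x \<noteq> 0}" and ?S' = "{x. g x \<noteq> 0}"
  have fin: "finite ?S" "finite ?S'" "?S \<subseteq> carrier G" "?S' \<subseteq> carrier G"
    using f g by (auto simp: int_monoid_ring_carrier)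
  have "{z. (f \<otimes>\<^bsub>ZG\<^esub> g) z \<noteq> 0} \<subseteq> (\<lambda>(x, y). x \<otimes> y) ` (?S \<times> ?S')"
  proof
    fix z assume "z \<in> {z. (f \<otimes>\<^bsub>ZG\<^esub> g) z \<noteq> 0}"
    then have "(\<Sum>x\<in>?S. \<Sum>y\<in>?S'. if x \<otimes> y = z then f x * g y else 0) \<noteq> 0"
      using int_monoid_ring_mult[OF fin(1) order_refl fin(2) order_refl, of G z] by simp
    then obtain x where x: "x \<in> ?S" "(\<Sum>y\<in>?S'. if x \<otimes> y = z then f x * g y else 0) \<noteq> 0"
      by (rule sum.not_neutral_contains_not_neutral)
    obtain y where "y \<in> ?S'" "(if x \<otimes> y = z then f x * g y else 0) \<noteq> 0"
      by (rule sum.not_neutral_contains_not_neutral[OF x(2)])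
    with x(1) show "z \<in> (\<lambda>(x, y). x \<otimes> y) ` (?S \<times> ?S')"
      by (auto split: if_splits)
  qed
  moreover have "finite ((\<lambda>(x, y). x \<otimes> y) ` (?S \<times> ?S'))"
    using fin by auto
  moreover have "(\<lambda>(x, y). x \<otimes> y) ` (?S \<times> ?S') \<subseteq> carrier G"
    using fin by auto
  ultimately show ?thesis
    unfolding int_monoid_ring_carrier by (meson finite_subset subset_trans)
qed

lemma int_monoid_ring_assoc:
  assumes f: "f \<in> carrier ZG" and g: "g \<in> carrier ZG" and h: "h \<in> carrier ZG"
  shows "(f \<otimes>\<^bsub>ZG\<^esub> g) \<otimes>\<^bsub>ZG\<^esub> h = f \<otimes>\<^bsub>ZG\<^esub> (g \<otimes>\<^bsub>ZG\<^esub> h)"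
proof
  fix z
  let ?S = "{x. f x \<noteq> 0}" and ?T = "{x. g x \<noteq> 0}" and ?U = "{x. h x \<noteq> 0}"
  let ?V = "{x. (f \<otimes>\<^bsub>ZG\<^esub> g) x \<noteq> 0} \<union> (\<lambda>(x, y). x \<otimes> y) ` (?S \<times> ?T)"
  let ?W = "{x. (g \<otimes>\<^bsub>ZG\<^esub> h) x \<noteq> 0} \<union> (\<lambda>(x, y). x \<otimes> y) ` (?T \<times> ?U)"
  have fin: "finite ?S" "finite ?T" "finite ?U" "?S \<subseteq> carrier G" "?T \<subseteq> carrier G" "?U \<subseteq> carrier G"
    using f g h by (auto simp: int_monoid_ring_carrier)
  have finV: "finite ?V" "finite ?W"
    using int_monoid_ring_mult_closed[OF f g] int_monoid_ring_mult_closed[OF g h] fin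
    by (auto simp: int_monoid_ring_carrier)
  have "((f \<otimes>\<^bsub>ZG\<^esub> g) \<otimes>\<^bsub>ZG\<^esub> h) z = (\<Sum>v\<in>?V. \<Sum>u\<in>?U. if v \<otimes> u = z then (f \<otimes>\<^bsub>ZG\<^esub> g) v * h u else 0)"
    by (intro int_monoid_ring_mult finV fin) auto
  also have "\<dots> = (\<Sum>v\<in>?V. \<Sum>u\<in>?U. \<Sum>x\<in>?S. \<Sum>y\<in>?T.
      if x \<otimes> y = v then if v \<otimes> u = z then f x * g y * h u else 0 else 0)"
  proof (intro sum.cong refl)
    fix v u
    show "(if v \<otimes> u = z then (f \<otimes>\<^bsub>ZG\<^esub> g) v * h u else 0) = (\<Sum>x\<in>?S. \<Sum>y\<in>?T.
      if x \<otimes> y = v then if v \<otimes> u = z then f x * g y * h u else 0 else 0)"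
      unfolding int_monoid_ring_mult[OF fin(1) order_refl fin(2) order_refl]
      by (cases "v \<otimes> u = z") (auto simp: sum_distrib_right intro!: sum.cong sum.neutral)
  qed
  also have "\<dots> = (\<Sum>u\<in>?U. \<Sum>v\<in>?V. \<Sum>x\<in>?S. \<Sum>y\<in>?T.
      if x \<otimes> y = v then if v \<otimes> u = z then f x * g y * h u else 0 else 0)"
    by (rule sum.swap)
  also have "\<dots> = (\<Sum>u\<in>?U. \<Sum>x\<in>?S. \<Sum>v\<in>?V. \<Sum>y\<in>?T.
      if x \<otimes> y = v then if v \<otimes> u = z then f x * g y * h u else 0 else 0)"
    by (rule sum.cong[OF refl], rule sum.swap)
  also have "\<dots> = (\<Sum>u\<in>?U. \<Sum>x\<in>?S. \<Sum>y\<in>?T. \<Sum>v\<in>?V.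
      if x \<otimes> y = v then if v \<otimes> u = z then f x * g y * h u else 0 else 0)"
    by (rule sum.cong[OF refl], rule sum.cong[OF refl], rule sum.swap)
  also have "\<dots> = (\<Sum>u\<in>?U. \<Sum>x\<in>?S. \<Sum>y\<in>?T. if x \<otimes> y \<otimes> u = z then f x * g y * h u else 0)"
  proof (intro sum.cong refl)
    fix u x y assume "x \<in> ?S" "y \<in> ?T"
    then have "x \<otimes> y \<in> ?V"
      by auto
    then show "(\<Sum>v\<in>?V. if x \<otimes> y = v then if v \<otimes> u = z then f x * g y * h u else 0 else 0)
        = (if x \<otimes> y \<otimes> u = z then f x * g y * h u else 0)"
      by (subst sum.delta'[OF finV(1)]) auto
  qed
  also have "\<dots> = (\<Sum>x\<in>?S. \<Sum>u\<in>?U. \<Sum>y\<in>?T. if x \<otimes> y \<otimes> u = z then f x * g y * h u else 0)"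
    by (rule sum.swap)
  also have "\<dots> = (\<Sum>x\<in>?S. \<Sum>y\<in>?T. \<Sum>u\<in>?U. if x \<otimes> (y \<otimes> u) = z then f x * (g y * h u) else 0)"
  proof (rule sum.cong[OF refl])
    fix x assume x: "x \<in> ?S"
    have "(\<Sum>u\<in>?U. \<Sum>y\<in>?T. if x \<otimes> y \<otimes> u = z then f x * g y * h u else 0) =
        (\<Sum>y\<in>?T. \<Sum>u\<in>?U. if x \<otimes> y \<otimes> u = z then f x * g y * h u else 0)"
      by (rule sum.swap)
    also have "\<dots> = (\<Sum>y\<in>?T. \<Sum>u\<in>?U. if x \<otimes> (y \<otimes> u) = z then f x * (g y * h u) else 0)"
      using x fin by (intro sum.cong refl) (auto simp: subset_iff m_assoc)
    finally show "(\<Sum>u\<in>?U. \<Sum>y\<in>?T. if x \<otimes> y \<otimes> u = z then f x * g y * h u else 0) =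
      (\<Sum>y\<in>?T. \<Sum>u\<in>?U. if x \<otimes> (y \<otimes> u) = z then f x * (g y * h u) else 0)" .
  qed
  also have "\<dots> = (\<Sum>x\<in>?S. \<Sum>y\<in>?T. \<Sum>u\<in>?U. \<Sum>w\<in>?W.
      if y \<otimes> u = w then if x \<otimes> w = z then f x * (g y * h u) else 0 else 0)"
  proof (intro sum.cong refl)
    fix x y u assume "y \<in> ?T" "u \<in> ?U"
    then have "y \<otimes> u \<in> ?W"
      by auto
    then show "(if x \<otimes> (y \<otimes> u) = z then f x * (g y * h u) else 0) =
        (\<Sum>w\<in>?W. if y \<otimes> u = w then if x \<otimes> w = z then f x * (g y * h u) else 0 else 0)"
      by (subst sum.delta'[OF finV(2)]) auto
  qed
  also have "\<dots> = (\<Sum>x\<in>?S. \<Sum>y\<in>?T. \<Sum>w\<in>?W. \<Sum>u\<in>?U.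
      if y \<otimes> u = w then if x \<otimes> w = z then f x * (g y * h u) else 0 else 0)"
    by (rule sum.cong[OF refl], rule sum.cong[OF refl], rule sum.swap)
  also have "\<dots> = (\<Sum>x\<in>?S. \<Sum>w\<in>?W. \<Sum>y\<in>?T. \<Sum>u\<in>?U.
      if y \<otimes> u = w then if x \<otimes> w = z then f x * (g y * h u) else 0 else 0)"
    by (rule sum.cong[OF refl], rule sum.swap)
  also have "\<dots> = (\<Sum>x\<in>?S. \<Sum>w\<in>?W. if x \<otimes> w = z then f x * (g \<otimes>\<^bsub>ZG\<^esub> h) w else 0)"
  proof (intro sum.cong refl)
    fix x w
    show "(\<Sum>y\<in>?T. \<Sum>u\<in>?U. if y \<otimes> u = w then if x \<otimes> w = z then f x * (g y * h u) else 0 else 0) =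
      (if x \<otimes> w = z then f x * (g \<otimes>\<^bsub>ZG\<^esub> h) w else 0)"
      unfolding int_monoid_ring_mult[OF fin(2) order_refl fin(3) order_refl]
      by (cases "x \<otimes> w = z") (auto simp: sum_distrib_left intro!: sum.cong sum.neutral)
  qed
  also have "\<dots> = (f \<otimes>\<^bsub>ZG\<^esub> (g \<otimes>\<^bsub>ZG\<^esub> h)) z"
    by (intro int_monoid_ring_mult[symmetric] finV fin) auto
  finally show "((f \<otimes>\<^bsub>ZG\<^esub> g) \<otimes>\<^bsub>ZG\<^esub> h) z = (f \<otimes>\<^bsub>ZG\<^esub> (g \<otimes>\<^bsub>ZG\<^esub> h)) z" .
qed

lemma int_monoid_ring_comm:
  assumes f: "f \<in> carrier ZG" and g: "g \<in> carrier ZG"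
  shows "f \<otimes>\<^bsub>ZG\<^esub> g = g \<otimes>\<^bsub>ZG\<^esub> f"
proof
  fix z
  let ?S = "{x. f x \<noteq> 0}" and ?T = "{x. g x \<noteq> 0}"
  have fin: "finite ?S" "finite ?T" "?S \<subseteq> carrier G" "?T \<subseteq> carrier G"
    using f g by (auto simp: int_monoid_ring_carrier)
  have "(f \<otimes>\<^bsub>ZG\<^esub> g) z = (\<Sum>x\<in>?S. \<Sum>y\<in>?T. if x \<otimes> y = z then f x * g y else 0)"
    by (intro int_monoid_ring_mult fin) auto
  also have "\<dots> = (\<Sum>y\<in>?T. \<Sum>x\<in>?S. if x \<otimes> y = z then f x * g y else 0)"
    by (rule sum.swap)
  also have "\<dots> = (\<Sum>y\<in>?T. \<Sum>x\<in>?S. if y \<otimes> x = z then g y * f x else 0)"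
    using fin by (intro sum.cong refl) (auto simp: subset_iff m_comm)
  also have "\<dots> = (g \<otimes>\<^bsub>ZG\<^esub> f) z"
    by (intro int_monoid_ring_mult[symmetric] fin) auto
  finally show "(f \<otimes>\<^bsub>ZG\<^esub> g) z = (g \<otimes>\<^bsub>ZG\<^esub> f) z" .
qed

lemma basis_elem_closed: "x \<in> carrier G \<Longrightarrow> basis_elem x \<in> carrier ZG"
  by (auto simp: int_monoid_ring_carrier basis_elem_def)

lemma int_monoid_ring_add_closed:
  assumes f: "f \<in> carrier ZG" and g: "g \<in> carrier ZG"
  shows "(\<lambda>z. f z + g z) \<in> carrier ZG"
proof -
  have "{x. f x + g x \<noteq> 0} \<subseteq> {x. f x \<noteq> 0} \<union> {x. g x \<noteq> 0}"
    by auto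
  then show ?thesis
    using f g unfolding int_monoid_ring_carrier by (meson finite_UnI finite_subset le_sup_iff order_trans)
qed

lemma int_monoid_ring_distrib:
  assumes f: "f \<in> carrier ZG" and g: "g \<in> carrier ZG" and h: "h \<in> carrier ZG"
  shows "(\<lambda>z. f z + g z) \<otimes>\<^bsub>ZG\<^esub> h = (\<lambda>z. (f \<otimes>\<^bsub>ZG\<^esub> h) z + (g \<otimes>\<^bsub>ZG\<^esub> h) z)"
proof
  fix z
  let ?S = "{x. f x \<noteq> 0} \<union> {x. g x \<noteq> 0}" and ?T = "{x. h x \<noteq> 0}"
  have fin: "finite ?S" "finite ?T"
    using f g h by (auto simp: int_monoid_ring_carrier)
  have "((\<lambda>z. f z + g z) \<otimes>\<^bsub>ZG\<^esub> h) z = (\<Sum>x\<in>?S. \<Sum>y\<in>?T. if x \<otimes> y = z then (f x + g x) * h y else 0)"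
    by (intro int_monoid_ring_mult fin) auto
  also have "\<dots> = (\<Sum>x\<in>?S. \<Sum>y\<in>?T. (if x \<otimes> y = z then f x * h y else 0) + (if x \<otimes> y = z then g x * h y else 0))"
    by (intro sum.cong refl) (auto simp: algebra_simps)
  also have "\<dots> = (\<Sum>x\<in>?S. \<Sum>y\<in>?T. if x \<otimes> y = z then f x * h y else 0) +
      (\<Sum>x\<in>?S. \<Sum>y\<in>?T. if x \<otimes> y = z then g x * h y else 0)"
    by (simp only: sum.distrib)
  also have "(\<Sum>x\<in>?S. \<Sum>y\<in>?T. if x \<otimes> y = z then f x * h y else 0) = (f \<otimes>\<^bsub>ZG\<^esub> h) z"
    by (intro int_monoid_ring_mult[symmetric] fin) auto
  also have "(\<Sum>x\<in>?S. \<Sum>y\<in>?T. if x \<otimes> y = z then g x * h y else 0) = (g \<otimes>\<^bsub>ZG\<^esub> h) z"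
    by (intro int_monoid_ring_mult[symmetric] fin) auto
  finally show "((\<lambda>z. f z + g z) \<otimes>\<^bsub>ZG\<^esub> h) z = (f \<otimes>\<^bsub>ZG\<^esub> h) z + (g \<otimes>\<^bsub>ZG\<^esub> h) z" .
qed

lemma int_monoid_ring_one_mult:
  assumes f: "f \<in> carrier ZG"
  shows "basis_elem \<one> \<otimes>\<^bsub>ZG\<^esub> f = f"
proof
  fix z
  let ?T = "{x. f x \<noteq> 0}"
  have fin: "finite ?T" "?T \<subseteq> carrier G"
    using f by (auto simp: int_monoid_ring_carrier)
  have "(basis_elem \<one> \<otimes>\<^bsub>ZG\<^esub> f) z = (\<Sum>x\<in>{\<one>}. \<Sum>y\<in>?T. if x \<otimes> y = z then basis_elem \<one> x * f y else 0)"
    by (intro int_monoid_ring_mult fin) (auto simp: basis_elem_def)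
  also have "\<dots> = (\<Sum>y\<in>?T. if y = z then f y else 0)"
    using fin by (auto simp: basis_elem_def subset_iff intro!: sum.cong)
  also have "\<dots> = f z"
    using fin by (subst sum.delta) auto
  finally show "(basis_elem \<one> \<otimes>\<^bsub>ZG\<^esub> f) z = f z" .
qed

lemma int_monoid_ring_uminus_closed:
  "f \<in> carrier ZG \<Longrightarrow> (\<lambda>z. - f z) \<in> carrier ZG"
  by (simp add: int_monoid_ring_carrier)

lemma int_monoid_ring_cring: "cring ZG"
proof (intro cringI abelian_groupI comm_monoidI)
  show "\<zero>\<^bsub>ZG\<^esub> \<in> carrier ZG"
    by (simp add: int_monoid_ring_carrier)
  show "\<exists>y\<in>carrier ZG. y \<oplus>\<^bsub>ZG\<^esub> x = \<zero>\<^bsub>ZG\<^esub>" if "x \<in> carrier ZG" for x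
    using int_monoid_ring_uminus_closed[OF that] by (intro bexI[of _ "\<lambda>z. - x z"]) auto
  show "x \<otimes>\<^bsub>ZG\<^esub> y = y \<otimes>\<^bsub>ZG\<^esub> x" if "x \<in> carrier ZG" "y \<in> carrier ZG" for x y
    using that by (rule int_monoid_ring_comm)
qed (simp_all add: int_monoid_ring_mult_closed int_monoid_ring_assoc
    basis_elem_closed int_monoid_ring_add_closed int_monoid_ring_distrib int_monoid_ring_one_mult
    add.assoc fun_eq_iff)

lemma int_monoid_ring_minus:
  assumes f: "f \<in> carrier ZG"
  shows "\<ominus>\<^bsub>ZG\<^esub> f = (\<lambda>z. - f z)"
proof -
  interpret Z: cring ZG
    by (rule int_monoid_ring_cring)
  show ?thesis
    using f int_monoid_ring_uminus_closed[OF f] by (intro Z.minus_equality) auto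
qed

lemma basis_elem_mult:
  assumes "x \<in> carrier G" "y \<in> carrier G"
  shows "basis_elem x \<otimes>\<^bsub>ZG\<^esub> basis_elem y = basis_elem (x \<otimes> y)"
proof
  fix z
  have "(basis_elem x \<otimes>\<^bsub>ZG\<^esub> basis_elem y) z =
      (\<Sum>u\<in>{x}. \<Sum>v\<in>{y}. if u \<otimes> v = z then basis_elem x u * basis_elem y v else 0)"
    by (intro int_monoid_ring_mult) (auto simp: basis_elem_def)
  then show "(basis_elem x \<otimes>\<^bsub>ZG\<^esub> basis_elem y) z = basis_elem (x \<otimes> y) z"
    by (auto simp: basis_elem_def)
qed

text \<open>The monoid ring is generated, as an additive group, by the elements of the monoid.\<close>

lemma int_monoid_ring_induct [consumes 1, case_names basis add minus]:
  assumes f: "f \<in> carrier ZG"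
    and basis: "\<And>x. x \<in> carrier G \<Longrightarrow> P (basis_elem x)"
    and add: "\<And>f g. f \<in> carrier ZG \<Longrightarrow> g \<in> carrier ZG \<Longrightarrow> P f \<Longrightarrow> P g \<Longrightarrow> P (\<lambda>z. f z + g z)"
    and minus: "\<And>f. f \<in> carrier ZG \<Longrightarrow> P f \<Longrightarrow> P (\<lambda>z. - f z)"
  shows "P f"
proof -
  \<comment> \<open>zero is the sum of a basis element and its negative\<close>
  have zero: "P (\<lambda>z. 0)"
    using add[OF basis_elem_closed int_monoid_ring_uminus_closed basis minus, of \<one> "basis_elem \<one>"]
    by (simp add: basis basis_elem_closed)
  have nat_mult: "P (\<lambda>z. int n * basis_elem x z) \<and> (\<lambda>z. int n * basis_elem x z) \<in> carrier ZG"
    if x: "x \<in> carrier G" for n x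
  proof (induction n)
    case 0
    then show ?case
      using zero by (simp add: int_monoid_ring_carrier)
  next
    case (Suc n)
    have "(\<lambda>z. int (Suc n) * basis_elem x z) = (\<lambda>z. basis_elem x z + int n * basis_elem x z)"
      by (auto simp: algebra_simps)
    then show ?case
      using Suc x add basis basis_elem_closed int_monoid_ring_add_closed by simp
  qed
  have int_mult: "P (\<lambda>z. k * basis_elem x z) \<and> (\<lambda>z. k * basis_elem x z) \<in> carrier ZG"
    if x: "x \<in> carrier G" for k x
  proof (cases "k \<ge> 0")
    case True
    then show ?thesis
      using nat_mult[OF x, of "nat k"] by simp
  next
    case False
    then have "(\<lambda>z. k * basis_elem x z) = (\<lambda>z. - (int (nat (- k)) * basis_elem x z))"
      by simp
    then show ?thesis
      using nat_mult[OF x, of "nat (- k)"] minus int_monoid_ring_uminus_closed by simp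
  qed
  have "finite S \<Longrightarrow> S \<subseteq> carrier G \<Longrightarrow> P (\<lambda>z. if z \<in> S then f z else 0)" for S
  proof (induction S rule: finite_induct)
    case empty
    then show ?case
      using zero by simp
  next
    case (insert x S)
    have eq: "(\<lambda>z. if z \<in> insert x S then f z else 0) =
        (\<lambda>z. f x * basis_elem x z + (if z \<in> S then f z else 0))"
      using insert.hyps by (auto simp: basis_elem_def)
    have "(\<lambda>z. if z \<in> S then f z else 0) \<in> carrier ZG"
      using insert f by (auto simp: int_monoid_ring_carrier)
    then show ?case
      unfolding eq using insert int_mult[of x "f x"] by (intro add) auto
  qed
  from this[of "{x. f x \<noteq> 0}"] have "P (\<lambda>z. if z \<in> {x. f x \<noteq> 0} then f z else 0)"
    using f by (simp add: int_monoid_ring_carrier)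
  moreover have "(\<lambda>z. if z \<in> {x. f x \<noteq> 0} then f z else 0) = f"
    by auto
  ultimately show ?thesis
    by simp
qed

end

subsection \<open>The ring homomorphism induced by a monoid homomorphism\<close>

text \<open>The extension of \<open>\<phi>\<close> to the monoid ring by additivity. The locale below assumes that \<open>\<phi>\<close> is
  multiplicative; the extension is then a ring homomorphism.\<close>

definition monoid_ring_lift :: "('b, 'n) ring_scheme \<Rightarrow> ('a \<Rightarrow> 'b) \<Rightarrow> ('a \<Rightarrow> int) \<Rightarrow> 'b" where
  "monoid_ring_lift K \<phi> f = (\<Oplus>\<^bsub>K\<^esub>x\<in>{x. f x \<noteq> 0}. add_pow K (f x) (\<phi> x))"

locale monoid_ring_hom = G: comm_monoid G + K: cring K for G (structure) and K (structure) +
  fixes \<phi>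
  assumes hom: "\<phi> \<in> hom G K" and hom_one: "\<phi> \<one>\<^bsub>G\<^esub> = \<one>\<^bsub>K\<^esub>"
begin

lemma hom_closed: "x \<in> carrier G \<Longrightarrow> \<phi> x \<in> carrier K"
  using hom by (auto simp: hom_def)

lemma zero_pow: "add_pow K (0 :: int) x = \<zero>\<^bsub>K\<^esub>"
  by (simp add: add_pow_def)

lemma lift_eq:
  assumes "finite S" "{x. f x \<noteq> 0} \<subseteq> S" "S \<subseteq> carrier G"
  shows "monoid_ring_lift K \<phi> f = (\<Oplus>\<^bsub>K\<^esub>x\<in>S. add_pow K (f x) (\<phi> x))"
  unfolding monoid_ring_lift_def
  using assms hom_closed K.add.int_pow_closed
  by (intro K.add.finprod_mono_neutral_cong_left) (auto simp: subset_iff zero_pow)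

lemma lift_closed: "f \<in> carrier (int_monoid_ring G) \<Longrightarrow> monoid_ring_lift K \<phi> f \<in> carrier K"
  unfolding monoid_ring_lift_def
  by (intro K.finsum_closed) (auto simp: int_monoid_ring_carrier intro!: hom_closed K.add.int_pow_closed)

lemma lift_add:
  assumes f: "f \<in> carrier (int_monoid_ring G)" and g: "g \<in> carrier (int_monoid_ring G)"
  shows "monoid_ring_lift K \<phi> (\<lambda>z. f z + g z) = monoid_ring_lift K \<phi> f \<oplus>\<^bsub>K\<^esub> monoid_ring_lift K \<phi> g"
proof -
  let ?S = "{x. f x \<noteq> 0} \<union> {x. g x \<noteq> 0}"
  have fin: "finite ?S" "?S \<subseteq> carrier G"
    using f g by (auto simp: int_monoid_ring_carrier)
  have "monoid_ring_lift K \<phi> (\<lambda>z. f z + g z) = (\<Oplus>\<^bsub>K\<^esub>x\<in>?S. add_pow K (f x + g x) (\<phi> x))"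
    using fin by (intro lift_eq) auto
  also have "\<dots> = (\<Oplus>\<^bsub>K\<^esub>x\<in>?S. add_pow K (f x) (\<phi> x) \<oplus>\<^bsub>K\<^esub> add_pow K (g x) (\<phi> x))"
    using fin hom_closed by (intro K.finsum_cong' refl) (auto simp: K.add.int_pow_mult)
  also have "\<dots> = (\<Oplus>\<^bsub>K\<^esub>x\<in>?S. add_pow K (f x) (\<phi> x)) \<oplus>\<^bsub>K\<^esub> (\<Oplus>\<^bsub>K\<^esub>x\<in>?S. add_pow K (g x) (\<phi> x))"
    using fin hom_closed by (intro K.finsum_addf) auto
  also have "(\<Oplus>\<^bsub>K\<^esub>x\<in>?S. add_pow K (f x) (\<phi> x)) = monoid_ring_lift K \<phi> f"
    using fin by (intro lift_eq[symmetric]) auto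
  also have "(\<Oplus>\<^bsub>K\<^esub>x\<in>?S. add_pow K (g x) (\<phi> x)) = monoid_ring_lift K \<phi> g"
    using fin by (intro lift_eq[symmetric]) auto
  finally show ?thesis .
qed

lemma lift_basis: "x \<in> carrier G \<Longrightarrow> monoid_ring_lift K \<phi> (basis_elem x) = \<phi> x"
  by (subst lift_eq[of "{x}"]) (auto simp: basis_elem_def hom_closed)

lemma lift_minus:
  assumes f: "f \<in> carrier (int_monoid_ring G)"
  shows "monoid_ring_lift K \<phi> (\<lambda>z. - f z) = \<ominus>\<^bsub>K\<^esub> monoid_ring_lift K \<phi> f"
proof -
  note f' = G.int_monoid_ring_uminus_closed[OF f]
  have "monoid_ring_lift K \<phi> (\<lambda>z. - f z) \<oplus>\<^bsub>K\<^esub> monoid_ring_lift K \<phi> f = \<zero>\<^bsub>K\<^esub>"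
    using lift_add[OF f' f] by (simp add: monoid_ring_lift_def)
  then show ?thesis
    using K.minus_equality lift_closed[OF f] lift_closed[OF f'] by metis
qed

lemma lift_mult:
  assumes f: "f \<in> carrier (int_monoid_ring G)" and g: "g \<in> carrier (int_monoid_ring G)"
  shows "monoid_ring_lift K \<phi> (f \<otimes>\<^bsub>int_monoid_ring G\<^esub> g) =
    monoid_ring_lift K \<phi> f \<otimes>\<^bsub>K\<^esub> monoid_ring_lift K \<phi> g"
proof -
  interpret Z: cring "int_monoid_ring G"
    by (rule G.int_monoid_ring_cring)
  note mc = G.int_monoid_ring_mult_closed
  have minus_mult: "(\<lambda>z. - f z) \<otimes>\<^bsub>int_monoid_ring G\<^esub> g = (\<lambda>z. - (f \<otimes>\<^bsub>int_monoid_ring G\<^esub> g) z)"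
    if "f \<in> carrier (int_monoid_ring G)" "g \<in> carrier (int_monoid_ring G)" for f g
    using Z.l_minus[OF that] that mc[OF that] by (simp add: G.int_monoid_ring_minus)
  have basis_mult: "monoid_ring_lift K \<phi> (basis_elem x \<otimes>\<^bsub>int_monoid_ring G\<^esub> g) =
    monoid_ring_lift K \<phi> (basis_elem x) \<otimes>\<^bsub>K\<^esub> monoid_ring_lift K \<phi> g" if x: "x \<in> carrier G" for x
    using g
  proof (induction g rule: G.int_monoid_ring_induct)
    case (basis y)
    then show ?case
      using x hom by (simp add: G.basis_elem_mult lift_basis hom_def)
  next
    case (add g h)
    then have "basis_elem x \<otimes>\<^bsub>int_monoid_ring G\<^esub> (\<lambda>z. g z + h z) =
        (\<lambda>z. (basis_elem x \<otimes>\<^bsub>int_monoid_ring G\<^esub> g) z + (basis_elem x \<otimes>\<^bsub>int_monoid_ring G\<^esub> h) z)"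
      using Z.r_distr[of g h "basis_elem x"] x by (simp add: G.basis_elem_closed)
    then show ?case
      using add x by (simp add: lift_add lift_closed mc G.basis_elem_closed K.r_distr)
  next
    case (minus g)
    then have "basis_elem x \<otimes>\<^bsub>int_monoid_ring G\<^esub> (\<lambda>z. - g z) =
        (\<lambda>z. - (basis_elem x \<otimes>\<^bsub>int_monoid_ring G\<^esub> g) z)"
      using Z.r_minus[of "basis_elem x" g] x mc[of "basis_elem x" g]
      by (simp add: G.basis_elem_closed G.int_monoid_ring_minus)
    then show ?case
      using minus x by (simp add: lift_minus lift_closed mc G.basis_elem_closed K.r_minus)
  qed
  show ?thesis
    using f
  proof (induction f rule: G.int_monoid_ring_induct)
    case (basis x)
    then show ?case
      by (rule basis_mult)
  next
    case (add f h)
    then show ?case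
      using g by (simp add: G.int_monoid_ring_distrib lift_add lift_closed mc K.l_distr)
  next
    case (minus f)
    then show ?case
      using g by (simp add: minus_mult lift_minus lift_closed mc K.l_minus)
  qed
qed

lemma lift_ring_hom: "monoid_ring_lift K \<phi> \<in> ring_hom (int_monoid_ring G) K"
  by (rule ring_hom_memI) (simp_all add: lift_closed lift_add lift_mult lift_basis hom_one)

end

subsection \<open>The tensor product and its universal property\<close>

lemma cring_extend:
  fixes R (structure)
  assumes "cring R" shows "cring (ring.extend R m)"
proof -
  interpret cring R by fact
  show ?thesis
    using add.l_inv_ex
    by (intro cringI abelian_groupI comm_monoidI)
      (auto simp: ring.defs a_ac m_ac l_distr r_distr)
qed

text \<open>Homomorphisms of \<open>R\<close>-algebras. They are extensional, so that two of them are equal as soon as they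
  agree on the carrier, and the set of homomorphisms has the right cardinality.\<close>

definition alg_homs ::
    "('r, 'k) ring_scheme \<Rightarrow> ('r, 'a) module \<Rightarrow> ('r, 'b) module \<Rightarrow> ('a \<Rightarrow> 'b) set" where
  "alg_homs R A B = {\<phi> \<in> extensional (carrier A). \<phi> \<in> ring_hom A B \<and>
     (\<forall>r\<in>carrier R. \<forall>x\<in>carrier A. \<phi> (r \<odot>\<^bsub>A\<^esub> x) = r \<odot>\<^bsub>B\<^esub> \<phi> x)}"

text \<open>The tensor product of \<open>A\<close> and \<open>K\<close>, named \<open>B\<close>, with pure tensors \<open>pt x y\<close>. Nothing is assumed on \<open>K\<close> here
  beyond being an algebra; later it is a field over which \<open>B\<close> is considered.\<close>

locale algebra_pair = A: algebra R A + K: algebra R K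
  for R :: "('r, 'k) ring_scheme" (structure) and A :: "('r, 'a) module" and K :: "('r, 'b) module"
begin

abbreviation "Z \<equiv> int_monoid_ring (A \<times>\<times> K)"
abbreviation "B \<equiv> base_change R A K"
abbreviation "pt \<equiv> pure_tensor R A K"

lemma base_change_simps [simp]:
  "carrier B = carrier (tensor_ring R A K)"
  "x \<otimes>\<^bsub>B\<^esub> y = x \<otimes>\<^bsub>tensor_ring R A K\<^esub> y"
  "x \<oplus>\<^bsub>B\<^esub> y = x \<oplus>\<^bsub>tensor_ring R A K\<^esub> y"
  "\<one>\<^bsub>B\<^esub> = \<one>\<^bsub>tensor_ring R A K\<^esub>"
  "\<zero>\<^bsub>B\<^esub> = \<zero>\<^bsub>tensor_ring R A K\<^esub>"
  "k \<odot>\<^bsub>B\<^esub> x = pt \<one>\<^bsub>A\<^esub> k \<otimes>\<^bsub>tensor_ring R A K\<^esub> x"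
  by (simp_all add: base_change_def ring.defs)

lemma AK_comm_monoid: "comm_monoid (A \<times>\<times> K)"
  by (rule comm_monoidI) (auto simp: A.m_ac K.m_ac)

sublocale AK: comm_monoid "A \<times>\<times> K"
  by (rule AK_comm_monoid)

sublocale Z: cring Z
  by (rule AK.int_monoid_ring_cring)

lemma basis_pair_closed: "x \<in> carrier A \<Longrightarrow> y \<in> carrier K \<Longrightarrow> basis_elem (x, y) \<in> carrier Z"
  by (rule AK.basis_elem_closed) simp

lemma minus_closed:
  assumes "f \<in> carrier Z" "g \<in> carrier Z"
  shows "f - g \<in> carrier Z" "f \<ominus>\<^bsub>Z\<^esub> g = f - g"
proof -
  have "f - g = f \<oplus>\<^bsub>Z\<^esub> (\<ominus>\<^bsub>Z\<^esub> g)"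
    using assms by (auto simp: AK.int_monoid_ring_minus)
  then show "f - g \<in> carrier Z" "f \<ominus>\<^bsub>Z\<^esub> g = f - g"
    using assms Z.a_closed Z.a_inv_closed by (metis, simp add: a_minus_def)
qed

lemma tensor_relations_closed: "tensor_relations R A K \<subseteq> carrier Z"
  by (auto simp: tensor_relations_def intro!: minus_closed(1) basis_pair_closed)

sublocale I: ideal "tensor_ideal R A K" Z
  unfolding tensor_ideal_def by (rule Z.genideal_ideal[OF tensor_relations_closed])

lemma tensor_ring_cring: "cring (tensor_ring R A K)"
  unfolding tensor_ring_def by (rule I.quotient_is_cring[OF Z.is_cring])

lemma base_change_cring: "cring B"
  unfolding base_change_def by (rule cring_extend[OF tensor_ring_cring])

sublocale B: cring B
  by (rule base_change_cring)

abbreviation (input) \<pi> where "\<pi> f \<equiv> tensor_ideal R A K +>\<^bsub>Z\<^esub> f"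

lemma coset_hom:
  shows coset_closed: "f \<in> carrier Z \<Longrightarrow> \<pi> f \<in> carrier B"
    and coset_mult: "f \<in> carrier Z \<Longrightarrow> g \<in> carrier Z \<Longrightarrow> \<pi> (f \<otimes>\<^bsub>Z\<^esub> g) = \<pi> f \<otimes>\<^bsub>B\<^esub> \<pi> g"
    and coset_add: "f \<in> carrier Z \<Longrightarrow> g \<in> carrier Z \<Longrightarrow> \<pi> (\<lambda>z. f z + g z) = \<pi> f \<oplus>\<^bsub>B\<^esub> \<pi> g"
    and coset_one: "\<pi> (basis_elem (\<one>\<^bsub>A\<^esub>, \<one>\<^bsub>K\<^esub>)) = \<one>\<^bsub>B\<^esub>"
  using ring_hom_closed[OF I.rcos_ring_hom] ring_hom_mult[OF I.rcos_ring_hom]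
    ring_hom_add[OF I.rcos_ring_hom] ring_hom_one[OF I.rcos_ring_hom]
  by (simp_all add: tensor_ring_def)

lemma coset_minus:
  assumes f: "f \<in> carrier Z"
  shows "\<pi> (\<lambda>z. - f z) = \<ominus>\<^bsub>B\<^esub> \<pi> f"
proof -
  note f' = AK.int_monoid_ring_uminus_closed[OF f]
  have "\<pi> (\<lambda>z. 0) = \<zero>\<^bsub>B\<^esub>"
    using Z.a_rcos_zero[OF I.is_ideal] I.zero_closed by (simp add: tensor_ring_def FactRing_def)
  then have "\<pi> (\<lambda>z. - f z) \<oplus>\<^bsub>B\<^esub> \<pi> f = \<zero>\<^bsub>B\<^esub>"
    using coset_add[OF f' f] by simp
  then show ?thesis
    using B.minus_equality coset_closed f f' by metis
qed

lemma coset_eqI: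
  assumes "f \<in> carrier Z" "g \<in> carrier Z" "f - g \<in> tensor_relations R A K"
  shows "\<pi> f = \<pi> g"
  using assms Z.genideal_self[OF tensor_relations_closed]
  by (subst Z.quotient_eq_iff_same_a_r_cos[OF I.is_ideal, symmetric])
    (auto simp: minus_closed tensor_ideal_def)

lemma pt_closed: "x \<in> carrier A \<Longrightarrow> y \<in> carrier K \<Longrightarrow> pt x y \<in> carrier B"
  unfolding pure_tensor_def by (rule coset_closed[OF basis_pair_closed])

lemma pt_mult:
  assumes "x \<in> carrier A" "y \<in> carrier K" "x' \<in> carrier A" "y' \<in> carrier K"
  shows "pt x y \<otimes>\<^bsub>B\<^esub> pt x' y' = pt (x \<otimes>\<^bsub>A\<^esub> x') (y \<otimes>\<^bsub>K\<^esub> y')"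
  unfolding pure_tensor_def using assms
  by (subst coset_mult[symmetric]) (auto simp: basis_pair_closed AK.basis_elem_mult)

lemma pt_one: "pt \<one>\<^bsub>A\<^esub> \<one>\<^bsub>K\<^esub> = \<one>\<^bsub>B\<^esub>"
  unfolding pure_tensor_def by (rule coset_one)

lemma pt_add_left:
  assumes "x \<in> carrier A" "x' \<in> carrier A" "y \<in> carrier K"
  shows "pt (x \<oplus>\<^bsub>A\<^esub> x') y = pt x y \<oplus>\<^bsub>B\<^esub> pt x' y"
proof -
  have "pt (x \<oplus>\<^bsub>A\<^esub> x') y = \<pi> (\<lambda>z. basis_elem (x, y) z + basis_elem (x', y) z)"
    unfolding pure_tensor_def
  proof (rule coset_eqI)
    have "basis_elem (x \<oplus>\<^bsub>A\<^esub> x', y) - (\<lambda>z. basis_elem (x, y) z + basis_elem (x', y) z) =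
        basis_elem (x \<oplus>\<^bsub>A\<^esub> x', y) - basis_elem (x, y) - basis_elem (x', y)"
      by auto
    then show "basis_elem (x \<oplus>\<^bsub>A\<^esub> x', y) - (\<lambda>z. basis_elem (x, y) z + basis_elem (x', y) z)
        \<in> tensor_relations R A K"
      using assms unfolding tensor_relations_def by auto
  qed (use assms in \<open>auto intro!: basis_pair_closed AK.int_monoid_ring_add_closed\<close>)
  then show ?thesis
    using assms by (simp only: coset_add basis_pair_closed pure_tensor_def)
qed

lemma pt_add_right:
  assumes "x \<in> carrier A" "y \<in> carrier K" "y' \<in> carrier K"
  shows "pt x (y \<oplus>\<^bsub>K\<^esub> y') = pt x y \<oplus>\<^bsub>B\<^esub> pt x y'"
proof -
  have "pt x (y \<oplus>\<^bsub>K\<^esub> y') = \<pi> (\<lambda>z. basis_elem (x, y) z + basis_elem (x, y') z)"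
    unfolding pure_tensor_def
  proof (rule coset_eqI)
    have "basis_elem (x, y \<oplus>\<^bsub>K\<^esub> y') - (\<lambda>z. basis_elem (x, y) z + basis_elem (x, y') z) =
        basis_elem (x, y \<oplus>\<^bsub>K\<^esub> y') - basis_elem (x, y) - basis_elem (x, y')"
      by auto
    then show "basis_elem (x, y \<oplus>\<^bsub>K\<^esub> y') - (\<lambda>z. basis_elem (x, y) z + basis_elem (x, y') z)
        \<in> tensor_relations R A K"
      using assms unfolding tensor_relations_def by auto
  qed (use assms in \<open>auto intro!: basis_pair_closed AK.int_monoid_ring_add_closed\<close>)
  then show ?thesis
    using assms by (simp only: coset_add basis_pair_closed pure_tensor_def)
qed

lemma pt_smult:
  assumes "r \<in> carrier R" "x \<in> carrier A" "y \<in> carrier K"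
  shows "pt (r \<odot>\<^bsub>A\<^esub> x) y = pt x (r \<odot>\<^bsub>K\<^esub> y)"
  unfolding pure_tensor_def
proof (rule coset_eqI)
  show "basis_elem (r \<odot>\<^bsub>A\<^esub> x, y) - basis_elem (x, r \<odot>\<^bsub>K\<^esub> y) \<in> tensor_relations R A K"
    using assms unfolding tensor_relations_def by blast
qed (use assms in \<open>auto intro!: basis_pair_closed\<close>)

text \<open>Pure tensors generate the tensor product as an additive group.\<close>

lemma base_change_induct [consumes 1, case_names pure add minus]:
  assumes t: "t \<in> carrier B"
    and pure: "\<And>x y. x \<in> carrier A \<Longrightarrow> y \<in> carrier K \<Longrightarrow> P (pt x y)"
    and add: "\<And>s t. s \<in> carrier B \<Longrightarrow> t \<in> carrier B \<Longrightarrow> P s \<Longrightarrow> P t \<Longrightarrow> P (s \<oplus>\<^bsub>B\<^esub> t)"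
    and minus: "\<And>t. t \<in> carrier B \<Longrightarrow> P t \<Longrightarrow> P (\<ominus>\<^bsub>B\<^esub> t)"
  shows "P t"
proof -
  obtain f where f: "f \<in> carrier Z" "t = \<pi> f"
    using t by (auto simp: tensor_ring_def FactRing_def A_RCOSETS_def')
  from f(1) have "P (\<pi> f)"
  proof (induction f rule: AK.int_monoid_ring_induct)
    case (basis x)
    then show ?case
      using pure by (cases x) (simp add: pure_tensor_def)
  next
    case (add f g)
    then show ?case
      using assms(3) by (simp only: coset_add coset_closed)
  next
    case (minus f)
    then show ?case
      using assms(4) by (simp only: coset_minus coset_closed)
  qed
  then show ?thesis
    by (simp add: f)
qed

text \<open>The universal property, for a homomorphism \<open>A \<rightarrow> K\<close> and the identity of \<open>K\<close>.\<close>

lemma base_change_lift: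
  assumes \<phi>: "\<phi> \<in> alg_homs R A K"
  obtains \<psi> where "\<psi> \<in> ring_hom B K"
    and "\<And>x y. x \<in> carrier A \<Longrightarrow> y \<in> carrier K \<Longrightarrow> \<psi> (pt x y) = \<phi> x \<otimes>\<^bsub>K\<^esub> y"
proof -
  have \<phi>h: "\<phi> \<in> ring_hom A K" and \<phi>l: "\<And>r x. r \<in> carrier R \<Longrightarrow> x \<in> carrier A \<Longrightarrow> \<phi> (r \<odot>\<^bsub>A\<^esub> x) = r \<odot>\<^bsub>K\<^esub> \<phi> x"
    using \<phi> by (auto simp: alg_homs_def)
  note \<phi>s = ring_hom_closed[OF \<phi>h] ring_hom_mult[OF \<phi>h] ring_hom_add[OF \<phi>h] ring_hom_one[OF \<phi>h]
  define h where "h = (\<lambda>(x, y). \<phi> x \<otimes>\<^bsub>K\<^esub> y)"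
  interpret L: monoid_ring_hom "A \<times>\<times> K" K h
  proof
    show "h \<in> hom (A \<times>\<times> K) K"
      by (auto simp: hom_def h_def \<phi>s K.m_ac)
    show "h \<one>\<^bsub>A \<times>\<times> K\<^esub> = \<one>\<^bsub>K\<^esub>"
      by (auto simp: h_def \<phi>s)
  qed
  define \<Psi> where "\<Psi> = monoid_ring_lift K h"
  have \<Psi>: "\<Psi> \<in> ring_hom Z K"
    unfolding \<Psi>_def by (rule L.lift_ring_hom)
  then interpret \<Psi>: ring_hom_ring Z K \<Psi>
    by (intro ring_hom_ringI2) (auto simp: Z.ring_axioms K.ring_axioms)
  have \<Psi>b: "\<Psi> (basis_elem (x, y)) = \<phi> x \<otimes>\<^bsub>K\<^esub> y" if "x \<in> carrier A" "y \<in> carrier K" for x y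
    unfolding \<Psi>_def using that by (subst L.lift_basis) (auto simp: h_def)
  have \<Psi>m: "\<Psi> (f - g) = \<Psi> f \<ominus>\<^bsub>K\<^esub> \<Psi> g" if "f \<in> carrier Z" "g \<in> carrier Z" for f g
    using that by (simp add: minus_closed(2)[symmetric] a_minus_def del: int_monoid_ring_simps)
  have "tensor_relations R A K \<subseteq> a_kernel Z K \<Psi>"
  proof
    fix f assume f: "f \<in> tensor_relations R A K"
    then have "f \<in> carrier Z"
      using tensor_relations_closed by blast
    moreover have "\<Psi> f = \<zero>\<^bsub>K\<^esub>"
      using f unfolding tensor_relations_def
    proof (elim UnE CollectE exE conjE)
      fix x x' y assume *: "f = basis_elem (x \<oplus>\<^bsub>A\<^esub> x', y) - basis_elem (x, y) - basis_elem (x', y)"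
        "x \<in> carrier A" "x' \<in> carrier A" "y \<in> carrier K"
      then have "\<Psi> f = (\<phi> x \<oplus>\<^bsub>K\<^esub> \<phi> x') \<otimes>\<^bsub>K\<^esub> y \<ominus>\<^bsub>K\<^esub> \<phi> x \<otimes>\<^bsub>K\<^esub> y \<ominus>\<^bsub>K\<^esub> \<phi> x' \<otimes>\<^bsub>K\<^esub> y"
        by (simp add: \<Psi>m minus_closed(1) basis_pair_closed \<Psi>b \<phi>s)
      also have "\<dots> = \<zero>\<^bsub>K\<^esub>"
        using * by (simp add: \<phi>s K.l_distr K.minus_eq K.a_ac K.r_neg K.r_neg2 K.r_neg1)
      finally show "\<Psi> f = \<zero>\<^bsub>K\<^esub>" .
    next
      fix x y y' assume *: "f = basis_elem (x, y \<oplus>\<^bsub>K\<^esub> y') - basis_elem (x, y) - basis_elem (x, y')"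
        "x \<in> carrier A" "y' \<in> carrier K" "y \<in> carrier K"
      then have "\<Psi> f = \<phi> x \<otimes>\<^bsub>K\<^esub> (y \<oplus>\<^bsub>K\<^esub> y') \<ominus>\<^bsub>K\<^esub> \<phi> x \<otimes>\<^bsub>K\<^esub> y \<ominus>\<^bsub>K\<^esub> \<phi> x \<otimes>\<^bsub>K\<^esub> y'"
        by (simp add: \<Psi>m minus_closed(1) basis_pair_closed \<Psi>b \<phi>s)
      also have "\<dots> = \<zero>\<^bsub>K\<^esub>"
        using * by (simp add: \<phi>s K.r_distr K.minus_eq K.a_ac K.r_neg K.r_neg2 K.r_neg1)
      finally show "\<Psi> f = \<zero>\<^bsub>K\<^esub>" .
    next
      fix r x y assume *: "f = basis_elem (r \<odot>\<^bsub>A\<^esub> x, y) - basis_elem (x, r \<odot>\<^bsub>K\<^esub> y)"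
        "r \<in> carrier R" "x \<in> carrier A" "y \<in> carrier K"
      then have "\<Psi> f = (r \<odot>\<^bsub>K\<^esub> \<phi> x) \<otimes>\<^bsub>K\<^esub> y \<ominus>\<^bsub>K\<^esub> \<phi> x \<otimes>\<^bsub>K\<^esub> (r \<odot>\<^bsub>K\<^esub> y)"
        by (simp add: \<Psi>m basis_pair_closed \<Psi>b \<phi>l)
      also have "\<phi> x \<otimes>\<^bsub>K\<^esub> (r \<odot>\<^bsub>K\<^esub> y) = (r \<odot>\<^bsub>K\<^esub> \<phi> x) \<otimes>\<^bsub>K\<^esub> y"
        using * K.smult_assoc2[of r y "\<phi> x"] K.smult_assoc2[of r "\<phi> x" y]
        by (simp add: \<phi>s K.m_comm)
      also have "(r \<odot>\<^bsub>K\<^esub> \<phi> x) \<otimes>\<^bsub>K\<^esub> y \<ominus>\<^bsub>K\<^esub> (r \<odot>\<^bsub>K\<^esub> \<phi> x) \<otimes>\<^bsub>K\<^esub> y = \<zero>\<^bsub>K\<^esub>"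
        unfolding K.minus_eq by (intro K.r_neg K.m_closed K.smult_closed \<phi>s *)
      finally show "\<Psi> f = \<zero>\<^bsub>K\<^esub>" .
    qed
    ultimately show "f \<in> a_kernel Z K \<Psi>"
      unfolding a_kernel_def' by blast
  qed
  then have ker: "tensor_ideal R A K \<subseteq> a_kernel Z K \<Psi>"
    unfolding tensor_ideal_def by (rule Z.genideal_minimal[OF \<Psi>.kernel_is_ideal])
  \<comment> \<open>\<open>\<Psi>\<close> is constant on cosets, so it descends to the quotient\<close>
  have const: "\<Psi> ` \<pi> f = {\<Psi> f}" if f: "f \<in> carrier Z" for f
  proof -
    have "\<Psi> g = \<Psi> f" if g: "g \<in> \<pi> f" for g
    proof -
      obtain k where k: "k \<in> tensor_ideal R A K" "g = k \<oplus>\<^bsub>Z\<^esub> f"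
        using g unfolding a_r_coset_def' by auto
      then have "\<Psi> k = \<zero>\<^bsub>K\<^esub>" "k \<in> carrier Z"
        using ker unfolding a_kernel_def' by blast+
      then show ?thesis
        unfolding k(2) using \<Psi>.hom_add[OF \<open>k \<in> carrier Z\<close> f] K.l_zero[OF \<Psi>.hom_closed[OF f]]
        by (simp only:)
    qed
    moreover have "f \<in> \<pi> f"
      unfolding a_r_coset_def' using I.zero_closed Z.l_zero[OF f] by force
    ultimately show ?thesis
      by blast
  qed
  define \<psi> where "\<psi> t = the_elem (\<Psi> ` t)" for t
  have \<psi>: "\<psi> (\<pi> f) = \<Psi> f" if "f \<in> carrier Z" for f
    using const[OF that] by (simp add: \<psi>_def)
  have rep: "\<exists>f\<in>carrier Z. t = \<pi> f" if "t \<in> carrier B" for t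
    using that by (auto simp: tensor_ring_def FactRing_def A_RCOSETS_def')
  have "\<psi> \<in> ring_hom B K"
  proof (rule ring_hom_memI)
    fix s t assume "s \<in> carrier B" "t \<in> carrier B"
    then obtain f g where fg: "f \<in> carrier Z" "s = \<pi> f" "g \<in> carrier Z" "t = \<pi> g"
      using rep by metis
    show "\<psi> (s \<otimes>\<^bsub>B\<^esub> t) = \<psi> s \<otimes>\<^bsub>K\<^esub> \<psi> t"
      using fg by (simp only: coset_mult[symmetric] \<psi> Z.m_closed \<Psi>.hom_mult)
    show "\<psi> (s \<oplus>\<^bsub>B\<^esub> t) = \<psi> s \<oplus>\<^bsub>K\<^esub> \<psi> t"
      using fg \<Psi>.hom_add[of f g] AK.int_monoid_ring_add_closed[of f g]
      by (simp only: coset_add[symmetric] \<psi> int_monoid_ring_simps)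
  next
    fix t assume "t \<in> carrier B"
    then show "\<psi> t \<in> carrier K"
      using rep \<psi> \<Psi>.hom_closed by metis
  next
    show "\<psi> \<one>\<^bsub>B\<^esub> = \<one>\<^bsub>K\<^esub>"
      unfolding coset_one[symmetric] using \<psi>[OF Z.one_closed] \<Psi>.hom_one by simp
  qed
  moreover have "\<psi> (pt x y) = \<phi> x \<otimes>\<^bsub>K\<^esub> y" if "x \<in> carrier A" "y \<in> carrier K" for x y
    unfolding pure_tensor_def using that by (simp add: \<psi> basis_pair_closed \<Psi>b)
  ultimately show thesis
    by (rule that)
qed

end

subsection \<open>Direct factors of degree one and homomorphisms\<close>

context algebra_pair
begin

text \<open>The canonical maps from \<open>A\<close> and \<open>K\<close> to the tensor product.\<close>

abbreviation "inA x \<equiv> pt x \<one>\<^bsub>K\<^esub>"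
abbreviation "inK y \<equiv> pt \<one>\<^bsub>A\<^esub> y"

lemma inA_closed: "x \<in> carrier A \<Longrightarrow> inA x \<in> carrier B"
  and inK_closed: "y \<in> carrier K \<Longrightarrow> inK y \<in> carrier B"
  by (simp_all add: pt_closed del: base_change_simps)

lemma inA_hom: "inA \<in> ring_hom A B"
  by (rule ring_hom_memI) (simp_all add: pt_closed pt_mult pt_one pt_add_left del: base_change_simps)

lemma inK_hom: "inK \<in> ring_hom K B"
  by (rule ring_hom_memI) (simp_all add: pt_closed pt_mult pt_one pt_add_right del: base_change_simps)

lemma pt_eq: "x \<in> carrier A \<Longrightarrow> y \<in> carrier K \<Longrightarrow> pt x y = inA x \<otimes>\<^bsub>B\<^esub> inK y"
  by (simp add: pt_mult del: base_change_simps)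

lemma inA_smult:
  assumes "r \<in> carrier R" "x \<in> carrier A"
  shows "inA (r \<odot>\<^bsub>A\<^esub> x) = inK (r \<odot>\<^bsub>K\<^esub> \<one>\<^bsub>K\<^esub>) \<otimes>\<^bsub>B\<^esub> inA x"
  using assms by (simp add: pt_smult pt_mult del: base_change_simps)

lemma scalars_eq: "(\<lambda>k. k \<odot>\<^bsub>B\<^esub> \<one>\<^bsub>B\<^esub>) ` carrier K = inK ` carrier K"
proof (rule image_cong[OF refl])
  fix k assume "k \<in> carrier K"
  then show "k \<odot>\<^bsub>B\<^esub> \<one>\<^bsub>B\<^esub> = inK k"
    using B.r_one[OF inK_closed] by simp
qed

text \<open>\<open>e\<close> is a nonzero idempotent on whose ideal \<open>A\<close> acts through \<open>\<phi>\<close>.\<close>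

definition isolates :: "('a \<Rightarrow> 'b) \<Rightarrow> ('a \<times> 'b \<Rightarrow> int) set \<Rightarrow> bool" where
  "isolates \<phi> e \<longleftrightarrow> e \<in> carrier B \<and> e \<noteq> \<zero>\<^bsub>B\<^esub> \<and> e \<otimes>\<^bsub>B\<^esub> e = e \<and>
     (\<forall>x\<in>carrier A. inA x \<otimes>\<^bsub>B\<^esub> e = inK (\<phi> x) \<otimes>\<^bsub>B\<^esub> e)"

text \<open>If \<open>A\<close> acts through \<open>\<phi>\<close> on \<open>e\<close> and on \<open>e'\<close>, then each \<open>t\<close> acts on both by the same scalar. For \<open>e = e'\<close>
  this says that the ideal of \<open>e\<close> is a line; for two idempotents it implies that they are equal.\<close>

lemma isolates_scalar2:
  assumes \<phi>: "\<phi> \<in> carrier A \<rightarrow> carrier K" and t: "t \<in> carrier B"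
    and e: "e \<in> carrier B" "\<And>x. x \<in> carrier A \<Longrightarrow> inA x \<otimes>\<^bsub>B\<^esub> e = inK (\<phi> x) \<otimes>\<^bsub>B\<^esub> e"
    and e': "e' \<in> carrier B" "\<And>x. x \<in> carrier A \<Longrightarrow> inA x \<otimes>\<^bsub>B\<^esub> e' = inK (\<phi> x) \<otimes>\<^bsub>B\<^esub> e'"
  shows "\<exists>k\<in>carrier K. t \<otimes>\<^bsub>B\<^esub> e = inK k \<otimes>\<^bsub>B\<^esub> e \<and> t \<otimes>\<^bsub>B\<^esub> e' = inK k \<otimes>\<^bsub>B\<^esub> e'"
  using t
proof (induction t rule: base_change_induct)
  case (pure x y)
  have "pt x y \<otimes>\<^bsub>B\<^esub> f = inK (\<phi> x \<otimes>\<^bsub>K\<^esub> y) \<otimes>\<^bsub>B\<^esub> f"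
    if f: "f \<in> carrier B" "inA x \<otimes>\<^bsub>B\<^esub> f = inK (\<phi> x) \<otimes>\<^bsub>B\<^esub> f" for f
  proof -
    have \<phi>x: "\<phi> x \<in> carrier K"
      using \<phi> pure by auto
    have "pt x y \<otimes>\<^bsub>B\<^esub> f = inK y \<otimes>\<^bsub>B\<^esub> (inA x \<otimes>\<^bsub>B\<^esub> f)"
      unfolding pt_eq[OF pure] using pure f(1) inA_closed inK_closed
      by (simp add: B.m_ac del: base_change_simps)
    also have "\<dots> = inK (\<phi> x) \<otimes>\<^bsub>B\<^esub> inK y \<otimes>\<^bsub>B\<^esub> f"
      unfolding f(2) using pure f(1) \<phi>x inK_closed by (simp add: B.m_ac del: base_change_simps)
    also have "\<dots> = inK (\<phi> x \<otimes>\<^bsub>K\<^esub> y) \<otimes>\<^bsub>B\<^esub> f"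
      using ring_hom_mult[OF inK_hom \<phi>x pure(2)] by simp
    finally show ?thesis .
  qed
  then show ?case
    using e e' pure \<phi> by (intro bexI[of _ "\<phi> x \<otimes>\<^bsub>K\<^esub> y"]) auto
next
  case (add s t)
  then obtain k l where kl: "k \<in> carrier K" "s \<otimes>\<^bsub>B\<^esub> e = inK k \<otimes>\<^bsub>B\<^esub> e" "s \<otimes>\<^bsub>B\<^esub> e' = inK k \<otimes>\<^bsub>B\<^esub> e'"
    "l \<in> carrier K" "t \<otimes>\<^bsub>B\<^esub> e = inK l \<otimes>\<^bsub>B\<^esub> e" "t \<otimes>\<^bsub>B\<^esub> e' = inK l \<otimes>\<^bsub>B\<^esub> e'"
    by metis
  have "(s \<oplus>\<^bsub>B\<^esub> t) \<otimes>\<^bsub>B\<^esub> f = inK (k \<oplus>\<^bsub>K\<^esub> l) \<otimes>\<^bsub>B\<^esub> f"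
    if f: "f \<in> carrier B" "s \<otimes>\<^bsub>B\<^esub> f = inK k \<otimes>\<^bsub>B\<^esub> f" "t \<otimes>\<^bsub>B\<^esub> f = inK l \<otimes>\<^bsub>B\<^esub> f" for f
    using f add kl(1,4) ring_hom_add[OF inK_hom kl(1,4)] B.l_distr[of s t f]
      B.l_distr[OF inK_closed inK_closed f(1), of k l]
    by (simp del: base_change_simps)
  then show ?case
    using e e' kl by (intro bexI[of _ "k \<oplus>\<^bsub>K\<^esub> l"]) auto
next
  case (minus t)
  then obtain l where kl:
    "l \<in> carrier K" "t \<otimes>\<^bsub>B\<^esub> e = inK l \<otimes>\<^bsub>B\<^esub> e" "t \<otimes>\<^bsub>B\<^esub> e' = inK l \<otimes>\<^bsub>B\<^esub> e'"
    by metis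
  interpret h: ring_hom_ring K B inK
    by (intro ring_hom_ringI2 inK_hom) (auto intro: K.ring_axioms B.ring_axioms)
  have "(\<ominus>\<^bsub>B\<^esub> t) \<otimes>\<^bsub>B\<^esub> f = inK (\<ominus>\<^bsub>K\<^esub> l) \<otimes>\<^bsub>B\<^esub> f"
    if f: "f \<in> carrier B" "t \<otimes>\<^bsub>B\<^esub> f = inK l \<otimes>\<^bsub>B\<^esub> f" for f
    using f minus kl(1) B.l_minus[OF minus(1) f(1)] B.l_minus[OF inK_closed f(1), of l] h.hom_a_inv[of l]
    by (simp del: base_change_simps)
  then show ?case
    using e e' kl by (intro bexI[of _ "\<ominus>\<^bsub>K\<^esub> l"]) auto
qed

lemma isolates_scalar:
  assumes "\<phi> \<in> carrier A \<rightarrow> carrier K" "isolates \<phi> e" "t \<in> carrier B"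
  obtains k where "k \<in> carrier K" "t \<otimes>\<^bsub>B\<^esub> e = inK k \<otimes>\<^bsub>B\<^esub> e"
  using isolates_scalar2[OF assms(1,3), of e e] assms(2) unfolding isolates_def by metis

end

locale algebra_field_pair = algebra_pair + K_field: field K
begin

lemma inK_cancel:
  assumes e: "e \<in> carrier B" "e \<noteq> \<zero>\<^bsub>B\<^esub>" and kl: "k \<in> carrier K" "l \<in> carrier K"
    and eq: "inK k \<otimes>\<^bsub>B\<^esub> e = inK l \<otimes>\<^bsub>B\<^esub> e"
  shows "k = l"
proof (rule ccontr)
  assume "k \<noteq> l"
  interpret h: ring_hom_ring K B inK
    by (intro ring_hom_ringI2 inK_hom) (auto intro: K.ring_axioms B.ring_axioms)
  let ?m = "k \<ominus>\<^bsub>K\<^esub> l"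
  have m: "?m \<in> carrier K" "?m \<noteq> \<zero>\<^bsub>K\<^esub>"
    using kl \<open>k \<noteq> l\<close> by auto
  then have u: "?m \<in> Units K"
    using K_field.field_Units by blast
  have "inK ?m \<otimes>\<^bsub>B\<^esub> e = \<zero>\<^bsub>B\<^esub>"
    using e kl eq h.hom_add[of k "\<ominus>\<^bsub>K\<^esub> l"] h.hom_a_inv[of l]
    by (simp add: a_minus_def B.l_distr inK_closed B.l_minus B.r_neg del: base_change_simps)
  then have "inK (inv\<^bsub>K\<^esub> ?m) \<otimes>\<^bsub>B\<^esub> (inK ?m \<otimes>\<^bsub>B\<^esub> e) = \<zero>\<^bsub>B\<^esub>"
    using B.r_null[OF inK_closed[OF K.Units_inv_closed[OF u]]] by metis
  moreover have "inK (inv\<^bsub>K\<^esub> ?m) \<otimes>\<^bsub>B\<^esub> (inK ?m \<otimes>\<^bsub>B\<^esub> e) = (inK (inv\<^bsub>K\<^esub> ?m) \<otimes>\<^bsub>B\<^esub> inK ?m) \<otimes>\<^bsub>B\<^esub> e"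
    using B.m_assoc[OF inK_closed[OF K.Units_inv_closed[OF u]] inK_closed[OF m(1)] e(1)] by simp
  moreover have "inK (inv\<^bsub>K\<^esub> ?m) \<otimes>\<^bsub>B\<^esub> inK ?m = \<one>\<^bsub>B\<^esub>"
    using ring_hom_mult[OF inK_hom K.Units_inv_closed[OF u] m(1)] ring_hom_one[OF inK_hom] K.Units_l_inv[OF u]
    by metis
  ultimately show False
    using e B.l_one by metis
qed

lemma isolates_unique:
  assumes \<phi>: "\<phi> \<in> carrier A \<rightarrow> carrier K" and e: "isolates \<phi> e" and e': "isolates \<phi> e'"
  shows "e = e'"
proof -
  have 1: "f \<otimes>\<^bsub>B\<^esub> f' = f'" if f: "isolates \<phi> f" and f': "isolates \<phi> f'" for f f'
  proof -
    have fc: "f \<in> carrier B" "f' \<in> carrier B" "f \<noteq> \<zero>\<^bsub>B\<^esub>" "f \<otimes>\<^bsub>B\<^esub> f = f"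
      using f f' by (auto simp: isolates_def)
    obtain k where k: "k \<in> carrier K" "f \<otimes>\<^bsub>B\<^esub> f = inK k \<otimes>\<^bsub>B\<^esub> f" "f \<otimes>\<^bsub>B\<^esub> f' = inK k \<otimes>\<^bsub>B\<^esub> f'"
      using isolates_scalar2[OF \<phi> fc(1), of f f'] f f' unfolding isolates_def by metis
    \<comment> \<open>\<open>f\<close> acts on itself by \<open>1\<close>, hence on \<open>f'\<close> by \<open>1\<close>\<close>
    have "inK k \<otimes>\<^bsub>B\<^esub> f = inK \<one>\<^bsub>K\<^esub> \<otimes>\<^bsub>B\<^esub> f"
      using k(2) fc B.l_one[OF fc(1)] by (simp add: pt_one del: base_change_simps)
    then have "k = \<one>\<^bsub>K\<^esub>"
      using inK_cancel[OF fc(1,3)] k(1) by blast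
    then show ?thesis
      using k(3) B.l_one[OF fc(2)] by (simp add: pt_one del: base_change_simps)
  qed
  have "e \<in> carrier B" "e' \<in> carrier B"
    using e e' by (auto simp: isolates_def)
  then show ?thesis
    using 1[OF e e'] 1[OF e' e] B.m_comm by metis
qed

lemma isolates_inj:
  assumes "\<phi> \<in> alg_homs R A K" "\<phi>' \<in> alg_homs R A K" "isolates \<phi> e" "isolates \<phi>' e"
  shows "\<phi> = \<phi>'"
proof (rule extensionalityI)
  fix x assume x: "x \<in> carrier A"
  have "\<phi> x \<in> carrier K" "\<phi>' x \<in> carrier K"
    using assms x by (auto simp: alg_homs_def ring_hom_def)
  moreover have "inK (\<phi> x) \<otimes>\<^bsub>B\<^esub> e = inK (\<phi>' x) \<otimes>\<^bsub>B\<^esub> e"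
    using assms x unfolding isolates_def by metis
  ultimately show "\<phi> x = \<phi>' x"
    using assms inK_cancel unfolding isolates_def by metis
qed (use assms in \<open>auto simp: alg_homs_def\<close>)

lemma principal_idempotent_unique:
  assumes "e \<in> carrier B" "e \<otimes>\<^bsub>B\<^esub> e = e" "e' \<in> carrier B" "e' \<otimes>\<^bsub>B\<^esub> e' = e'"
    and eq: "PIdl\<^bsub>B\<^esub> e = PIdl\<^bsub>B\<^esub> e'"
  shows "e = e'"
proof -
  have 1: "f = f \<otimes>\<^bsub>B\<^esub> f'" if f: "f \<in> carrier B" "f' \<in> carrier B" "f' \<otimes>\<^bsub>B\<^esub> f' = f'" "f \<in> PIdl\<^bsub>B\<^esub> f'" for f f'
  proof -
    obtain x where x: "x \<in> carrier B" "f = x \<otimes>\<^bsub>B\<^esub> f'"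
      using f(4) by (auto simp: cgenideal_def)
    show ?thesis
      unfolding x(2) using x(1) f by (simp only: B.m_assoc)
  qed
  have "e \<in> PIdl\<^bsub>B\<^esub> e'" "e' \<in> PIdl\<^bsub>B\<^esub> e"
    using B.cgenideal_self[OF assms(1)] B.cgenideal_self[OF assms(3)] eq by auto
  then have "e = e \<otimes>\<^bsub>B\<^esub> e'" "e' = e' \<otimes>\<^bsub>B\<^esub> e"
    using 1 assms by metis+
  then show ?thesis
    using B.m_comm[OF assms(1,3)] by metis
qed

text \<open>An isolating idempotent spans a factor of degree one, with unit \<open>e\<close> and \<open>k \<mapsto> ke\<close> an isomorphism from \<open>K\<close>.\<close>

lemma isolates_factor:
  assumes \<phi>: "\<phi> \<in> carrier A \<rightarrow> carrier K" and e: "isolates \<phi> e"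
  shows "PIdl\<^bsub>B\<^esub> e \<in> field_factors_of_degree 1 K B"
proof -
  have ec: "e \<in> carrier B" "e \<noteq> \<zero>\<^bsub>B\<^esub>" "e \<otimes>\<^bsub>B\<^esub> e = e"
    using e by (auto simp: isolates_def)
  let ?L = "PIdl\<^bsub>B\<^esub> e"
  have Lc: "?L \<subseteq> carrier B"
    using ec(1) by (auto simp: cgenideal_def simp del: base_change_simps)
  have L: "?L = {inK k \<otimes>\<^bsub>B\<^esub> e | k. k \<in> carrier K}"
  proof
    show "?L \<subseteq> {inK k \<otimes>\<^bsub>B\<^esub> e | k. k \<in> carrier K}"
      using isolates_scalar[OF \<phi> e] unfolding cgenideal_def by blast
    show "{inK k \<otimes>\<^bsub>B\<^esub> e | k. k \<in> carrier K} \<subseteq> ?L"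
      using inK_closed unfolding cgenideal_def by blast
  qed
  have el: "t \<otimes>\<^bsub>B\<^esub> e = t" if t: "t \<in> ?L" for t
    using t ec inK_closed by (auto simp: cgenideal_def B.m_assoc simp del: base_change_simps)
  let ?F = "B\<lparr>carrier := ?L, one := e\<rparr>"
  interpret L: ideal ?L B
    by (rule B.cgenideal_ideal[OF ec(1)])
  have "cring ?F"
  proof (intro cringI abelian_groupI comm_monoidI)
    show "\<exists>y\<in>carrier ?F. y \<oplus>\<^bsub>?F\<^esub> x = \<zero>\<^bsub>?F\<^esub>" if "x \<in> carrier ?F" for x
      using that Lc L.a_inv_closed B.l_neg by (intro bexI[of _ "\<ominus>\<^bsub>B\<^esub> x"]) (auto simp del: base_change_simps)
    show "\<one>\<^bsub>?F\<^esub> \<otimes>\<^bsub>?F\<^esub> x = x" if "x \<in> carrier ?F" for x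
      using that el[of x] Lc ec B.m_comm[of e x] by (auto simp del: base_change_simps)
  qed (use Lc in \<open>auto simp: subset_iff B.a_ac B.m_ac B.l_distr B.r_distr L.a_closed L.I_l_closed L.I_r_closed
          B.cgenideal_self[OF ec(1)] L.zero_closed simp del: base_change_simps\<close>)
  then interpret F: cring ?F .
  have "field ?F"
  proof (rule F.cring_fieldI2)
    show "\<zero>\<^bsub>?F\<^esub> \<noteq> \<one>\<^bsub>?F\<^esub>"
      using ec by (simp del: base_change_simps)
    fix a assume a: "a \<in> carrier ?F" "a \<noteq> \<zero>\<^bsub>?F\<^esub>"
    then obtain k where k: "k \<in> carrier K" "a = inK k \<otimes>\<^bsub>B\<^esub> e"
      using L by auto
    have "inK \<zero>\<^bsub>K\<^esub> = \<zero>\<^bsub>B\<^esub>"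
      using ring_hom_zero[OF inK_hom K.ring_axioms B.ring_axioms] .
    then have "k \<noteq> \<zero>\<^bsub>K\<^esub>"
      using a(2) k(2) B.l_null[OF ec(1)] by auto
    then have u: "k \<in> Units K"
      using K_field.field_Units k(1) by blast
    have "(inK k \<otimes>\<^bsub>B\<^esub> e) \<otimes>\<^bsub>B\<^esub> (inK (inv\<^bsub>K\<^esub> k) \<otimes>\<^bsub>B\<^esub> e) = (inK k \<otimes>\<^bsub>B\<^esub> inK (inv\<^bsub>K\<^esub> k)) \<otimes>\<^bsub>B\<^esub> (e \<otimes>\<^bsub>B\<^esub> e)"
      using inK_closed k(1) K.Units_inv_closed[OF u] ec(1) by (simp only: B.m_ac B.m_closed)
    also have "inK k \<otimes>\<^bsub>B\<^esub> inK (inv\<^bsub>K\<^esub> k) = \<one>\<^bsub>B\<^esub>"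
      using ring_hom_mult[OF inK_hom k(1) K.Units_inv_closed[OF u]] ring_hom_one[OF inK_hom] K.Units_r_inv[OF u]
      by metis
    finally have "(inK k \<otimes>\<^bsub>B\<^esub> e) \<otimes>\<^bsub>B\<^esub> (inK (inv\<^bsub>K\<^esub> k) \<otimes>\<^bsub>B\<^esub> e) = e"
      using ec B.l_one by metis
    then show "\<exists>b\<in>carrier ?F. a \<otimes>\<^bsub>?F\<^esub> b = \<one>\<^bsub>?F\<^esub>"
      using k K.Units_inv_closed[OF u] L
      by (intro bexI[of _ "inK (inv\<^bsub>K\<^esub> k) \<otimes>\<^bsub>B\<^esub> e"]) (auto simp del: base_change_simps)
  qed
  then have "?L \<in> field_factors B"
    unfolding field_factors_def using ec by (intro CollectI exI[of _ e] conjI refl)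
  moreover have "B.dimension 1 ((\<lambda>k. k \<odot>\<^bsub>B\<^esub> \<one>\<^bsub>B\<^esub>) ` carrier K) ?L"
  proof -
    have "B.dimension (Suc 0) (inK ` carrier K) (B.line_extension (inK ` carrier K) e {\<zero>\<^bsub>B\<^esub>})"
      by (rule B.Suc_dim[OF ec(1) _ B.zero_dim]) (use ec(2) in blast)
    moreover have "B.line_extension (inK ` carrier K) e {\<zero>\<^bsub>B\<^esub>} = ?L"
    proof (rule Set.set_eqI)
      fix u
      have "u \<in> B.line_extension (inK ` carrier K) e {\<zero>\<^bsub>B\<^esub>} \<longleftrightarrow>
          (\<exists>k\<in>carrier K. u = inK k \<otimes>\<^bsub>B\<^esub> e \<oplus>\<^bsub>B\<^esub> \<zero>\<^bsub>B\<^esub>)"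
        unfolding B.line_extension_mem_iff by blast
      also have "\<dots> \<longleftrightarrow> (\<exists>k\<in>carrier K. u = inK k \<otimes>\<^bsub>B\<^esub> e)"
        using B.r_zero[OF B.m_closed[OF inK_closed ec(1)]] by (metis (no_types))
      finally show "u \<in> B.line_extension (inK ` carrier K) e {\<zero>\<^bsub>B\<^esub>} \<longleftrightarrow> u \<in> ?L"
        unfolding L by blast
    qed
    ultimately show ?thesis
      unfolding scalars_eq One_nat_def by simp
  qed
  ultimately show ?thesis
    by (simp add: field_factors_of_degree_def)
qed

text \<open>A factor of degree one is the ideal of an isolating idempotent, where \<open>\<phi>\<close> sends \<open>x\<close> to the scalar by which
  \<open>x \<otimes> 1\<close> acts on the factor.\<close>

lemma factor_isolates:
  assumes L: "L \<in> field_factors_of_degree 1 K B"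
  obtains \<phi> e where "\<phi> \<in> alg_homs R A K" "isolates \<phi> e" "L = PIdl\<^bsub>B\<^esub> e"
proof -
  have "L \<in> field_factors B" and dim: "B.dimension 1 (inK ` carrier K) L"
    using L unfolding scalars_eq[symmetric] field_factors_of_degree_def by auto
  then obtain e where e: "e \<in> carrier B" "e \<otimes>\<^bsub>B\<^esub> e = e" "L = PIdl\<^bsub>B\<^esub> e" "field (B\<lparr>carrier := L, one := e\<rparr>)"
    unfolding field_factors_def by blast
  interpret F: field "B\<lparr>carrier := L, one := e\<rparr>"
    by (rule e(4))
  have e0: "e \<noteq> \<zero>\<^bsub>B\<^esub>"
    using F.one_not_zero by (simp del: base_change_simps)
  from dim obtain v where v: "v \<in> carrier B" "L = B.line_extension (inK ` carrier K) v {\<zero>\<^bsub>B\<^esub>}"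
    by (auto elim!: B.dimension.cases simp del: base_change_simps)
  have "u \<in> L \<longleftrightarrow> (\<exists>k\<in>carrier K. u = inK k \<otimes>\<^bsub>B\<^esub> v \<oplus>\<^bsub>B\<^esub> \<zero>\<^bsub>B\<^esub>)" for u
    unfolding v(2) B.line_extension_mem_iff by blast
  then have Lv: "u \<in> L \<longleftrightarrow> (\<exists>k\<in>carrier K. u = inK k \<otimes>\<^bsub>B\<^esub> v)" for u
    using B.r_zero[OF B.m_closed[OF inK_closed v(1)]] by (metis (no_types))
  have eL: "e \<in> L"
    unfolding e(3) by (rule B.cgenideal_self[OF e(1)])
  then obtain k0 where k0: "k0 \<in> carrier K" "e = inK k0 \<otimes>\<^bsub>B\<^esub> v"
    using Lv by blast
  have "inK \<zero>\<^bsub>K\<^esub> = \<zero>\<^bsub>B\<^esub>"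
    using ring_hom_zero[OF inK_hom K.ring_axioms B.ring_axioms] .
  then have "k0 \<noteq> \<zero>\<^bsub>K\<^esub>"
    using e0 k0(2) B.l_null[OF v(1)] by auto
  then have u: "k0 \<in> Units K"
    using K_field.field_Units k0(1) by blast
  note ui = K.Units_inv_closed[OF u]
  have inv0: "inK (inv\<^bsub>K\<^esub> k0) \<otimes>\<^bsub>B\<^esub> e = v"
  proof -
    have "inK (inv\<^bsub>K\<^esub> k0) \<otimes>\<^bsub>B\<^esub> e = (inK (inv\<^bsub>K\<^esub> k0) \<otimes>\<^bsub>B\<^esub> inK k0) \<otimes>\<^bsub>B\<^esub> v"
      unfolding k0(2) using inK_closed k0(1) ui v(1) by (simp only: B.m_assoc)
    also have "inK (inv\<^bsub>K\<^esub> k0) \<otimes>\<^bsub>B\<^esub> inK k0 = \<one>\<^bsub>B\<^esub>"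
      using ring_hom_mult[OF inK_hom ui k0(1)] ring_hom_one[OF inK_hom] K.Units_l_inv[OF u]
      by metis
    finally show ?thesis
      using B.l_one v(1) by metis
  qed
  have scal: "\<exists>k\<in>carrier K. t \<otimes>\<^bsub>B\<^esub> e = inK k \<otimes>\<^bsub>B\<^esub> e" if t: "t \<in> carrier B" for t
  proof -
    have "t \<otimes>\<^bsub>B\<^esub> e \<in> L"
      unfolding e(3) using t by (auto simp: cgenideal_def)
    then obtain k where k: "k \<in> carrier K" "t \<otimes>\<^bsub>B\<^esub> e = inK k \<otimes>\<^bsub>B\<^esub> v"
      using Lv by blast
    then have "t \<otimes>\<^bsub>B\<^esub> e = (inK k \<otimes>\<^bsub>B\<^esub> inK (inv\<^bsub>K\<^esub> k0)) \<otimes>\<^bsub>B\<^esub> e"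
      using inv0 inK_closed k(1) ui e(1) by (simp only: B.m_assoc)
    also have "inK k \<otimes>\<^bsub>B\<^esub> inK (inv\<^bsub>K\<^esub> k0) = inK (k \<otimes>\<^bsub>K\<^esub> inv\<^bsub>K\<^esub> k0)"
      using ring_hom_mult[OF inK_hom k(1) ui] by simp
    finally show ?thesis
      using k ui by blast
  qed
  define \<phi> where "\<phi> = restrict (\<lambda>x. SOME k. k \<in> carrier K \<and> inA x \<otimes>\<^bsub>B\<^esub> e = inK k \<otimes>\<^bsub>B\<^esub> e) (carrier A)"
  have \<phi>: "\<phi> x \<in> carrier K" "inA x \<otimes>\<^bsub>B\<^esub> e = inK (\<phi> x) \<otimes>\<^bsub>B\<^esub> e" if x: "x \<in> carrier A" for x
  proof -
    have "\<exists>k. k \<in> carrier K \<and> inA x \<otimes>\<^bsub>B\<^esub> e = inK k \<otimes>\<^bsub>B\<^esub> e"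
      using scal[OF inA_closed[OF x]] by blast
    from someI_ex[OF this] show "\<phi> x \<in> carrier K" "inA x \<otimes>\<^bsub>B\<^esub> e = inK (\<phi> x) \<otimes>\<^bsub>B\<^esub> e"
      using x by (auto simp: \<phi>_def)
  qed
  have \<phi>_eqI: "\<phi> x = k" if "x \<in> carrier A" "k \<in> carrier K" "inA x \<otimes>\<^bsub>B\<^esub> e = inK k \<otimes>\<^bsub>B\<^esub> e" for x k
    using inK_cancel[OF e(1) e0] \<phi>[OF that(1)] that by metis
  have "\<phi> \<in> alg_homs R A K"
    unfolding alg_homs_def
  proof (intro CollectI conjI ballI ring_hom_memI)
    show "\<phi> \<in> extensional (carrier A)"
      by (simp add: \<phi>_def)
    show "\<phi> \<one>\<^bsub>A\<^esub> = \<one>\<^bsub>K\<^esub>"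
      by (rule \<phi>_eqI) auto
    fix x assume x: "x \<in> carrier A"
    then show "\<phi> x \<in> carrier K"
      by (rule \<phi>)
    show "\<phi> (r \<odot>\<^bsub>A\<^esub> x) = r \<odot>\<^bsub>K\<^esub> \<phi> x" if r: "r \<in> carrier R" for r
    proof (rule \<phi>_eqI)
      have r1: "r \<odot>\<^bsub>K\<^esub> \<one>\<^bsub>K\<^esub> \<in> carrier K"
        using r by simp
      have "inA (r \<odot>\<^bsub>A\<^esub> x) \<otimes>\<^bsub>B\<^esub> e = inK (r \<odot>\<^bsub>K\<^esub> \<one>\<^bsub>K\<^esub>) \<otimes>\<^bsub>B\<^esub> (inA x \<otimes>\<^bsub>B\<^esub> e)"
        unfolding inA_smult[OF r x] using inK_closed[OF r1] inA_closed[OF x] e(1) by (simp only: B.m_assoc)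
      also have "\<dots> = inK (r \<odot>\<^bsub>K\<^esub> \<one>\<^bsub>K\<^esub>) \<otimes>\<^bsub>B\<^esub> inK (\<phi> x) \<otimes>\<^bsub>B\<^esub> e"
        unfolding \<phi>(2)[OF x] using inK_closed[OF r1] inK_closed[OF \<phi>(1)[OF x]] e(1) by (simp only: B.m_assoc)
      also have "inK (r \<odot>\<^bsub>K\<^esub> \<one>\<^bsub>K\<^esub>) \<otimes>\<^bsub>B\<^esub> inK (\<phi> x) = inK (r \<odot>\<^bsub>K\<^esub> \<phi> x)"
        using ring_hom_mult[OF inK_hom r1 \<phi>(1)[OF x]] r \<phi>(1)[OF x] K.smult_assoc2[of r "\<one>\<^bsub>K\<^esub>" "\<phi> x"] by simp
      finally show "inA (r \<odot>\<^bsub>A\<^esub> x) \<otimes>\<^bsub>B\<^esub> e = inK (r \<odot>\<^bsub>K\<^esub> \<phi> x) \<otimes>\<^bsub>B\<^esub> e" .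
    qed (use x r \<phi> in auto)
    fix y assume y: "y \<in> carrier A"
    note c = inA_closed[OF x] inA_closed[OF y] inK_closed[OF \<phi>(1)[OF x]] inK_closed[OF \<phi>(1)[OF y]] e(1)
    show "\<phi> (x \<otimes>\<^bsub>A\<^esub> y) = \<phi> x \<otimes>\<^bsub>K\<^esub> \<phi> y"
    proof (rule \<phi>_eqI)
      have "inA (x \<otimes>\<^bsub>A\<^esub> y) \<otimes>\<^bsub>B\<^esub> e = inA x \<otimes>\<^bsub>B\<^esub> (inA y \<otimes>\<^bsub>B\<^esub> e)"
        using ring_hom_mult[OF inA_hom x y] c by (simp only: B.m_assoc)
      also have "\<dots> = inK (\<phi> y) \<otimes>\<^bsub>B\<^esub> (inA x \<otimes>\<^bsub>B\<^esub> e)"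
        unfolding \<phi>(2)[OF y] using c by (simp only: B.m_lcomm)
      also have "\<dots> = inK (\<phi> x) \<otimes>\<^bsub>B\<^esub> inK (\<phi> y) \<otimes>\<^bsub>B\<^esub> e"
        unfolding \<phi>(2)[OF x] using c by (simp only: B.m_lcomm B.m_assoc)
      finally show "inA (x \<otimes>\<^bsub>A\<^esub> y) \<otimes>\<^bsub>B\<^esub> e = inK (\<phi> x \<otimes>\<^bsub>K\<^esub> \<phi> y) \<otimes>\<^bsub>B\<^esub> e"
        using ring_hom_mult[OF inK_hom \<phi>(1)[OF x] \<phi>(1)[OF y]] by simp
    qed (use x y \<phi> in auto)
    show "\<phi> (x \<oplus>\<^bsub>A\<^esub> y) = \<phi> x \<oplus>\<^bsub>K\<^esub> \<phi> y"
    proof (rule \<phi>_eqI)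
      have "inA (x \<oplus>\<^bsub>A\<^esub> y) \<otimes>\<^bsub>B\<^esub> e = inA x \<otimes>\<^bsub>B\<^esub> e \<oplus>\<^bsub>B\<^esub> inA y \<otimes>\<^bsub>B\<^esub> e"
        using ring_hom_add[OF inA_hom x y] c by (simp only: B.l_distr)
      also have "\<dots> = (inK (\<phi> x) \<oplus>\<^bsub>B\<^esub> inK (\<phi> y)) \<otimes>\<^bsub>B\<^esub> e"
        unfolding \<phi>(2)[OF x] \<phi>(2)[OF y] using c by (simp only: B.l_distr)
      finally show "inA (x \<oplus>\<^bsub>A\<^esub> y) \<otimes>\<^bsub>B\<^esub> e = inK (\<phi> x \<oplus>\<^bsub>K\<^esub> \<phi> y) \<otimes>\<^bsub>B\<^esub> e"
        using ring_hom_add[OF inK_hom \<phi>(1)[OF x] \<phi>(1)[OF y]] by simp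
    qed (use x y \<phi> in auto)
  qed
  moreover have "isolates \<phi> e"
    unfolding isolates_def using e e0 \<phi> by blast
  ultimately show thesis
    using e(3) by (rule that)
qed

theorem card_factors_of_degree_one:
  assumes ex: "\<And>\<phi>. \<phi> \<in> alg_homs R A K \<Longrightarrow> \<exists>e. isolates \<phi> e"
  shows "card (field_factors_of_degree 1 K B) = card (alg_homs R A K)"
proof -
  obtain e where e: "isolates \<phi> (e \<phi>)" if "\<phi> \<in> alg_homs R A K" for \<phi>
    using ex by metis
  have fn: "\<phi> \<in> carrier A \<rightarrow> carrier K" if "\<phi> \<in> alg_homs R A K" for \<phi>
    using that by (auto simp: alg_homs_def ring_hom_def)
  have "bij_betw (\<lambda>\<phi>. PIdl\<^bsub>B\<^esub> (e \<phi>)) (alg_homs R A K) (field_factors_of_degree 1 K B)"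
  proof (rule bij_betw_imageI)
    show "inj_on (\<lambda>\<phi>. PIdl\<^bsub>B\<^esub> (e \<phi>)) (alg_homs R A K)"
    proof (rule inj_onI)
      fix \<phi> \<phi>' assume *: "\<phi> \<in> alg_homs R A K" "\<phi>' \<in> alg_homs R A K" "PIdl\<^bsub>B\<^esub> (e \<phi>) = PIdl\<^bsub>B\<^esub> (e \<phi>')"
      have "e \<phi> = e \<phi>'"
        using e[OF *(1)] e[OF *(2)] *(3) principal_idempotent_unique unfolding isolates_def by metis
      then show "\<phi> = \<phi>'"
        using isolates_inj[OF *(1,2)] e[OF *(1)] e[OF *(2)] by simp
    qed
    show "(\<lambda>\<phi>. PIdl\<^bsub>B\<^esub> (e \<phi>)) ` alg_homs R A K = field_factors_of_degree 1 K B"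
    proof (intro equalityI subsetI)
      fix L assume "L \<in> field_factors_of_degree 1 K B"
      then obtain \<phi> f where f: "\<phi> \<in> alg_homs R A K" "isolates \<phi> f" "L = PIdl\<^bsub>B\<^esub> f"
        by (rule factor_isolates)
      then have "f = e \<phi>"
        using isolates_unique[OF fn] e by blast
      then show "L \<in> (\<lambda>\<phi>. PIdl\<^bsub>B\<^esub> (e \<phi>)) ` alg_homs R A K"
        using f by blast
    qed (use isolates_factor[OF fn] e in blast)
  qed
  then show ?thesis
    by (rule bij_betw_same_card[symmetric])
qed

end

text \<open>A homomorphism \<open>\<phi>\<close> has a cubic block if some direct factor of \<open>A\<close>, with identity \<open>\<epsilon>\<close>, is spanned by \<open>\<epsilon>\<close>, \<open>\<alpha>\<close>
  and \<open>\<alpha>\<^sup>2\<close>, where \<open>\<alpha>\<^sup>3\<close> is a scalar, and if \<open>\<phi>\<close> does not vanish at \<open>\<alpha>\<close>. These three elements need not be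
  independent.\<close>

definition has_cubic_block ::
    "('r, 'k) ring_scheme \<Rightarrow> ('r, 'a) module \<Rightarrow> ('r, 'b) module \<Rightarrow> ('a \<Rightarrow> 'b) \<Rightarrow> bool" where
  "has_cubic_block R A K \<phi> \<longleftrightarrow>
     (\<exists>\<epsilon>\<in>carrier A. \<exists>\<alpha>\<in>carrier A. \<exists>n\<in>carrier R.
        \<epsilon> \<otimes>\<^bsub>A\<^esub> \<alpha> = \<alpha> \<and> \<alpha> \<otimes>\<^bsub>A\<^esub> (\<alpha> \<otimes>\<^bsub>A\<^esub> \<alpha>) = n \<odot>\<^bsub>A\<^esub> \<epsilon> \<and> \<epsilon> \<otimes>\<^bsub>A\<^esub> \<epsilon> = \<epsilon> \<and>
        (\<forall>x\<in>carrier A. \<exists>u\<in>carrier R. \<exists>v\<in>carrier R. \<exists>w\<in>carrier R.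
           x \<otimes>\<^bsub>A\<^esub> \<epsilon> = u \<odot>\<^bsub>A\<^esub> \<epsilon> \<oplus>\<^bsub>A\<^esub> (v \<odot>\<^bsub>A\<^esub> \<alpha> \<oplus>\<^bsub>A\<^esub> w \<odot>\<^bsub>A\<^esub> (\<alpha> \<otimes>\<^bsub>A\<^esub> \<alpha>))) \<and>
        \<phi> \<epsilon> = \<one>\<^bsub>K\<^esub> \<and> \<phi> \<alpha> \<noteq> \<zero>\<^bsub>K\<^esub>)"

context algebra_field_pair
begin

text \<open>The isolating idempotent is the Lagrange interpolation polynomial
  \<open>(X\<^sup>3 - r\<^sup>3) / (3r\<^sup>2 (X - r)) = (X\<^sup>2 + rX + r\<^sup>2) / (3r\<^sup>2)\<close> with \<open>r = \<phi>(\<alpha>)\<close>, evaluated at \<open>\<alpha>\<close>.\<close>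

lemma cubic_block_isolates:
  assumes \<phi>: "\<phi> \<in> alg_homs R A K" and blk: "has_cubic_block R A K \<phi>"
    and three: "\<one>\<^bsub>K\<^esub> \<oplus>\<^bsub>K\<^esub> \<one>\<^bsub>K\<^esub> \<oplus>\<^bsub>K\<^esub> \<one>\<^bsub>K\<^esub> \<noteq> \<zero>\<^bsub>K\<^esub>"
  shows "\<exists>e. isolates \<phi> e"
proof -
  have \<phi>h: "\<phi> \<in> ring_hom A K" and \<phi>l: "\<And>r x. r \<in> carrier R \<Longrightarrow> x \<in> carrier A \<Longrightarrow> \<phi> (r \<odot>\<^bsub>A\<^esub> x) = r \<odot>\<^bsub>K\<^esub> \<phi> x"
    using \<phi> by (auto simp: alg_homs_def)
  note \<phi>s = ring_hom_closed[OF \<phi>h] ring_hom_mult[OF \<phi>h] ring_hom_add[OF \<phi>h] ring_hom_one[OF \<phi>h]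
  obtain \<epsilon> \<alpha> n where blk: "\<epsilon> \<in> carrier A" "\<alpha> \<in> carrier A" "n \<in> carrier R"
    "\<epsilon> \<otimes>\<^bsub>A\<^esub> \<alpha> = \<alpha>" "\<alpha> \<otimes>\<^bsub>A\<^esub> (\<alpha> \<otimes>\<^bsub>A\<^esub> \<alpha>) = n \<odot>\<^bsub>A\<^esub> \<epsilon>" "\<epsilon> \<otimes>\<^bsub>A\<^esub> \<epsilon> = \<epsilon>"
    "\<phi> \<epsilon> = \<one>\<^bsub>K\<^esub>" "\<phi> \<alpha> \<noteq> \<zero>\<^bsub>K\<^esub>"
    and span: "\<And>x. x \<in> carrier A \<Longrightarrow> \<exists>u\<in>carrier R. \<exists>v\<in>carrier R. \<exists>w\<in>carrier R.
           x \<otimes>\<^bsub>A\<^esub> \<epsilon> = u \<odot>\<^bsub>A\<^esub> \<epsilon> \<oplus>\<^bsub>A\<^esub> (v \<odot>\<^bsub>A\<^esub> \<alpha> \<oplus>\<^bsub>A\<^esub> w \<odot>\<^bsub>A\<^esub> (\<alpha> \<otimes>\<^bsub>A\<^esub> \<alpha>))"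
    using blk unfolding has_cubic_block_def by blast
  define r where "r = \<phi> \<alpha>"
  define d where "d = (\<one>\<^bsub>K\<^esub> \<oplus>\<^bsub>K\<^esub> \<one>\<^bsub>K\<^esub> \<oplus>\<^bsub>K\<^esub> \<one>\<^bsub>K\<^esub>) \<otimes>\<^bsub>K\<^esub> (r \<otimes>\<^bsub>K\<^esub> r)"
  have r: "r \<in> carrier K" "r \<noteq> \<zero>\<^bsub>K\<^esub>"
    using blk by (auto simp: r_def \<phi>s)
  have "d \<in> carrier K" "d \<noteq> \<zero>\<^bsub>K\<^esub>"
    using r three by (auto simp: d_def K_field.integral_iff)
  then have du: "d \<in> Units K"
    using K_field.field_Units by blast
  note dc = K.Units_closed[OF du] K.Units_inv_closed[OF du]
  \<comment> \<open>the scalar \<open>n\<close> is the cube of \<open>r\<close> in \<open>K\<close>\<close>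
  have r3: "n \<odot>\<^bsub>K\<^esub> \<one>\<^bsub>K\<^esub> = r \<otimes>\<^bsub>K\<^esub> (r \<otimes>\<^bsub>K\<^esub> r)"
  proof -
    have "\<phi> (\<alpha> \<otimes>\<^bsub>A\<^esub> (\<alpha> \<otimes>\<^bsub>A\<^esub> \<alpha>)) = r \<otimes>\<^bsub>K\<^esub> (r \<otimes>\<^bsub>K\<^esub> r)"
      using blk(2) by (simp add: \<phi>s r_def)
    moreover have "\<phi> (n \<odot>\<^bsub>A\<^esub> \<epsilon>) = n \<odot>\<^bsub>K\<^esub> \<one>\<^bsub>K\<^esub>"
      using blk(1,3,7) by (simp add: \<phi>l)
    ultimately show ?thesis
      unfolding blk(5) by simp
  qed
  define E a \<rho> c where "E = inA \<epsilon>" and "a = inA \<alpha>" and "\<rho> = inK r" and "c = inK (inv\<^bsub>K\<^esub> d)"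
  have C: "E \<in> carrier B" "a \<in> carrier B" "\<rho> \<in> carrier B" "c \<in> carrier B"
    using blk r dc inA_closed inK_closed by (auto simp: E_def a_def \<rho>_def c_def simp del: base_change_simps)
  have Ea: "E \<otimes>\<^bsub>B\<^esub> a = a" and EE: "E \<otimes>\<^bsub>B\<^esub> E = E"
    unfolding E_def a_def using ring_hom_mult[OF inA_hom] blk by metis+
  have a3: "a \<otimes>\<^bsub>B\<^esub> (a \<otimes>\<^bsub>B\<^esub> a) = \<rho> \<otimes>\<^bsub>B\<^esub> (\<rho> \<otimes>\<^bsub>B\<^esub> \<rho>) \<otimes>\<^bsub>B\<^esub> E"
  proof -
    have "a \<otimes>\<^bsub>B\<^esub> (a \<otimes>\<^bsub>B\<^esub> a) = inA (\<alpha> \<otimes>\<^bsub>A\<^esub> (\<alpha> \<otimes>\<^bsub>A\<^esub> \<alpha>))"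
      unfolding a_def using blk(2) by (simp add: ring_hom_mult[OF inA_hom] del: base_change_simps)
    also have "\<dots> = inK (r \<otimes>\<^bsub>K\<^esub> (r \<otimes>\<^bsub>K\<^esub> r)) \<otimes>\<^bsub>B\<^esub> E"
      unfolding blk(5) E_def r3[symmetric] by (rule inA_smult[OF blk(3,1)])
    also have "inK (r \<otimes>\<^bsub>K\<^esub> (r \<otimes>\<^bsub>K\<^esub> r)) = \<rho> \<otimes>\<^bsub>B\<^esub> (\<rho> \<otimes>\<^bsub>B\<^esub> \<rho>)"
      unfolding \<rho>_def using r by (simp add: ring_hom_mult[OF inK_hom] del: base_change_simps)
    finally show ?thesis .
  qed
  define g where "g = a \<otimes>\<^bsub>B\<^esub> a \<oplus>\<^bsub>B\<^esub> (\<rho> \<otimes>\<^bsub>B\<^esub> a \<oplus>\<^bsub>B\<^esub> \<rho> \<otimes>\<^bsub>B\<^esub> \<rho> \<otimes>\<^bsub>B\<^esub> E)"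
  define e where "e = c \<otimes>\<^bsub>B\<^esub> g"
  have ge: "g \<in> carrier B" "e \<in> carrier B"
    using C by (simp_all add: g_def e_def del: base_change_simps)
  \<comment> \<open>\<open>(a - \<rho>) g = a\<^sup>3 - \<rho>\<^sup>3E = 0\<close>\<close>
  have ag: "a \<otimes>\<^bsub>B\<^esub> g = \<rho> \<otimes>\<^bsub>B\<^esub> g"
  proof -
    have aE: "a \<otimes>\<^bsub>B\<^esub> E = a"
      using Ea C B.m_comm by metis
    have "a \<otimes>\<^bsub>B\<^esub> g = a \<otimes>\<^bsub>B\<^esub> (a \<otimes>\<^bsub>B\<^esub> a) \<oplus>\<^bsub>B\<^esub> (\<rho> \<otimes>\<^bsub>B\<^esub> (a \<otimes>\<^bsub>B\<^esub> a) \<oplus>\<^bsub>B\<^esub> \<rho> \<otimes>\<^bsub>B\<^esub> \<rho> \<otimes>\<^bsub>B\<^esub> (a \<otimes>\<^bsub>B\<^esub> E))"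
      unfolding g_def using C by (simp add: B.r_distr B.m_ac del: base_change_simps)
    also have "\<dots> = \<rho> \<otimes>\<^bsub>B\<^esub> g"
      unfolding a3 aE g_def using C by (simp add: B.r_distr B.m_ac B.a_ac del: base_change_simps)
    finally show ?thesis .
  qed
  have ae: "a \<otimes>\<^bsub>B\<^esub> e = \<rho> \<otimes>\<^bsub>B\<^esub> e"
    using ag C ge B.m_lcomm unfolding e_def by metis
  have Ee: "E \<otimes>\<^bsub>B\<^esub> e = e"
  proof -
    have "E \<otimes>\<^bsub>B\<^esub> g = (E \<otimes>\<^bsub>B\<^esub> a) \<otimes>\<^bsub>B\<^esub> a \<oplus>\<^bsub>B\<^esub> (\<rho> \<otimes>\<^bsub>B\<^esub> (E \<otimes>\<^bsub>B\<^esub> a) \<oplus>\<^bsub>B\<^esub> \<rho> \<otimes>\<^bsub>B\<^esub> \<rho> \<otimes>\<^bsub>B\<^esub> (E \<otimes>\<^bsub>B\<^esub> E))"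
      unfolding g_def using C by (simp add: B.r_distr B.m_ac del: base_change_simps)
    then have "E \<otimes>\<^bsub>B\<^esub> g = g"
      unfolding Ea EE g_def .
    then show ?thesis
      unfolding e_def using C ge B.m_lcomm by metis
  qed
  have iso: "inA x \<otimes>\<^bsub>B\<^esub> e = inK (\<phi> x) \<otimes>\<^bsub>B\<^esub> e" if x: "x \<in> carrier A" for x
  proof -
    obtain u v w where uvw: "u \<in> carrier R" "v \<in> carrier R" "w \<in> carrier R"
      "x \<otimes>\<^bsub>A\<^esub> \<epsilon> = u \<odot>\<^bsub>A\<^esub> \<epsilon> \<oplus>\<^bsub>A\<^esub> (v \<odot>\<^bsub>A\<^esub> \<alpha> \<oplus>\<^bsub>A\<^esub> w \<odot>\<^bsub>A\<^esub> (\<alpha> \<otimes>\<^bsub>A\<^esub> \<alpha>))"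
      using span[OF x] by blast
    let ?U = "inK (u \<odot>\<^bsub>K\<^esub> \<one>\<^bsub>K\<^esub>)" and ?V = "inK (v \<odot>\<^bsub>K\<^esub> \<one>\<^bsub>K\<^esub>)" and ?W = "inK (w \<odot>\<^bsub>K\<^esub> \<one>\<^bsub>K\<^esub>)"
    have UVW: "?U \<in> carrier B" "?V \<in> carrier B" "?W \<in> carrier B"
      using uvw inK_closed by (simp_all del: base_change_simps)
    have "\<phi> x = \<phi> (x \<otimes>\<^bsub>A\<^esub> \<epsilon>)"
      using x blk by (simp add: \<phi>s)
    also have "\<dots> = u \<odot>\<^bsub>K\<^esub> \<one>\<^bsub>K\<^esub> \<oplus>\<^bsub>K\<^esub> (v \<odot>\<^bsub>K\<^esub> r \<oplus>\<^bsub>K\<^esub> w \<odot>\<^bsub>K\<^esub> (r \<otimes>\<^bsub>K\<^esub> r))"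
      unfolding uvw(4) using uvw blk by (simp add: \<phi>s \<phi>l r_def)
    also have "\<dots> = u \<odot>\<^bsub>K\<^esub> \<one>\<^bsub>K\<^esub> \<oplus>\<^bsub>K\<^esub> ((v \<odot>\<^bsub>K\<^esub> \<one>\<^bsub>K\<^esub>) \<otimes>\<^bsub>K\<^esub> r \<oplus>\<^bsub>K\<^esub> (w \<odot>\<^bsub>K\<^esub> \<one>\<^bsub>K\<^esub>) \<otimes>\<^bsub>K\<^esub> (r \<otimes>\<^bsub>K\<^esub> r))"
      using uvw r by (simp add: K.smult_assoc2)
    finally have \<phi>x: "inK (\<phi> x) = ?U \<oplus>\<^bsub>B\<^esub> (?V \<otimes>\<^bsub>B\<^esub> \<rho> \<oplus>\<^bsub>B\<^esub> ?W \<otimes>\<^bsub>B\<^esub> (\<rho> \<otimes>\<^bsub>B\<^esub> \<rho>))"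
      using uvw r unfolding \<rho>_def
      by (simp add: ring_hom_mult[OF inK_hom] ring_hom_add[OF inK_hom] del: base_change_simps)
    have "inA x \<otimes>\<^bsub>B\<^esub> e = (inA x \<otimes>\<^bsub>B\<^esub> E) \<otimes>\<^bsub>B\<^esub> e"
      using Ee C ge inA_closed[OF x] B.m_assoc by metis
    also have "inA x \<otimes>\<^bsub>B\<^esub> E = inA (x \<otimes>\<^bsub>A\<^esub> \<epsilon>)"
      unfolding E_def using x blk by (simp add: ring_hom_mult[OF inA_hom] del: base_change_simps)
    also have "\<dots> = ?U \<otimes>\<^bsub>B\<^esub> E \<oplus>\<^bsub>B\<^esub> (?V \<otimes>\<^bsub>B\<^esub> a \<oplus>\<^bsub>B\<^esub> ?W \<otimes>\<^bsub>B\<^esub> (a \<otimes>\<^bsub>B\<^esub> a))"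
      unfolding uvw(4) E_def a_def using uvw blk
      by (simp add: ring_hom_mult[OF inA_hom] ring_hom_add[OF inA_hom] inA_smult del: base_change_simps)
    also have "\<dots> \<otimes>\<^bsub>B\<^esub> e = ?U \<otimes>\<^bsub>B\<^esub> (E \<otimes>\<^bsub>B\<^esub> e) \<oplus>\<^bsub>B\<^esub> (?V \<otimes>\<^bsub>B\<^esub> (a \<otimes>\<^bsub>B\<^esub> e) \<oplus>\<^bsub>B\<^esub> ?W \<otimes>\<^bsub>B\<^esub> (a \<otimes>\<^bsub>B\<^esub> (a \<otimes>\<^bsub>B\<^esub> e)))"
      using C ge UVW by (simp add: B.l_distr B.m_assoc del: base_change_simps)
    also have "a \<otimes>\<^bsub>B\<^esub> (a \<otimes>\<^bsub>B\<^esub> e) = \<rho> \<otimes>\<^bsub>B\<^esub> (\<rho> \<otimes>\<^bsub>B\<^esub> e)"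
      unfolding ae using C ge ae B.m_lcomm by metis
    also have "?U \<otimes>\<^bsub>B\<^esub> (E \<otimes>\<^bsub>B\<^esub> e) \<oplus>\<^bsub>B\<^esub> (?V \<otimes>\<^bsub>B\<^esub> (a \<otimes>\<^bsub>B\<^esub> e) \<oplus>\<^bsub>B\<^esub> ?W \<otimes>\<^bsub>B\<^esub> (\<rho> \<otimes>\<^bsub>B\<^esub> (\<rho> \<otimes>\<^bsub>B\<^esub> e))) = inK (\<phi> x) \<otimes>\<^bsub>B\<^esub> e"
      unfolding Ee ae \<phi>x using C ge UVW by (simp add: B.l_distr B.m_assoc del: base_change_simps)
    finally show ?thesis .
  qed
  obtain \<psi> where \<psi>: "\<psi> \<in> ring_hom B K"
    and \<psi>pt: "\<And>x y. x \<in> carrier A \<Longrightarrow> y \<in> carrier K \<Longrightarrow> \<psi> (pt x y) = \<phi> x \<otimes>\<^bsub>K\<^esub> y"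
    using base_change_lift[OF \<phi>] by blast
  note \<psi>s = ring_hom_closed[OF \<psi>] ring_hom_mult[OF \<psi>] ring_hom_add[OF \<psi>]
  have \<psi>1: "\<psi> E = \<one>\<^bsub>K\<^esub>" "\<psi> a = r" "\<psi> \<rho> = r" "\<psi> c = inv\<^bsub>K\<^esub> d"
    using blk r dc by (simp_all add: E_def a_def \<rho>_def c_def \<psi>pt \<phi>s r_def)
  have \<psi>e: "\<psi> e = \<one>\<^bsub>K\<^esub>"
  proof -
    have "\<psi> e = inv\<^bsub>K\<^esub> d \<otimes>\<^bsub>K\<^esub> (r \<otimes>\<^bsub>K\<^esub> r \<oplus>\<^bsub>K\<^esub> (r \<otimes>\<^bsub>K\<^esub> r \<oplus>\<^bsub>K\<^esub> r \<otimes>\<^bsub>K\<^esub> r \<otimes>\<^bsub>K\<^esub> \<one>\<^bsub>K\<^esub>))"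
      unfolding e_def g_def using C by (simp add: \<psi>s \<psi>1 del: base_change_simps)
    also have "\<dots> = inv\<^bsub>K\<^esub> d \<otimes>\<^bsub>K\<^esub> d"
      using r by (simp add: d_def K.l_distr K.a_ac)
    finally show ?thesis
      using K.Units_l_inv[OF du] by simp
  qed
  have "\<psi> \<zero>\<^bsub>B\<^esub> = \<zero>\<^bsub>K\<^esub>"
    by (rule ring_hom_zero[OF \<psi> B.ring_axioms K.ring_axioms])
  then have e0: "e \<noteq> \<zero>\<^bsub>B\<^esub>"
    using \<psi>e K_field.one_not_zero by metis
  have fn: "\<phi> \<in> carrier A \<rightarrow> carrier K"
    using \<phi>s by auto
  \<comment> \<open>\<open>e\<close> acts on itself by a scalar, which is \<open>\<psi>(e) = 1\<close>\<close>
  obtain k where k: "k \<in> carrier K" "e \<otimes>\<^bsub>B\<^esub> e = inK k \<otimes>\<^bsub>B\<^esub> e"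
    using isolates_scalar2[OF fn ge(2) ge(2) iso ge(2) iso] by blast
  have "\<psi> (e \<otimes>\<^bsub>B\<^esub> e) = \<one>\<^bsub>K\<^esub>"
    using ring_hom_mult[OF \<psi> ge(2) ge(2)] \<psi>e by simp
  moreover have "\<psi> (inK k \<otimes>\<^bsub>B\<^esub> e) = k"
    using ring_hom_mult[OF \<psi> inK_closed[OF k(1)] ge(2)] \<psi>e k(1) by (simp add: \<psi>pt \<phi>s)
  ultimately have "k = \<one>\<^bsub>K\<^esub>"
    using k(2) by metis
  then have "e \<otimes>\<^bsub>B\<^esub> e = e"
    using k(2) B.l_one[OF ge(2)] by (simp add: pt_one del: base_change_simps)
  then show ?thesis
    using ge e0 iso unfolding isolates_def by blast
qed

end

section \<open>Homomorphisms from a product of algebras\<close>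

lemma alg_prod_Nil:
  "carrier (alg_prod []) = {[]}" "\<one>\<^bsub>alg_prod []\<^esub> = []" "\<zero>\<^bsub>alg_prod []\<^esub> = []"
  "[] \<otimes>\<^bsub>alg_prod []\<^esub> [] = []" "[] \<oplus>\<^bsub>alg_prod []\<^esub> [] = []" "r \<odot>\<^bsub>alg_prod []\<^esub> [] = []"
  by (simp_all add: alg_prod_def ring.defs monoid.defs)

lemma alg_prod_one: "\<one>\<^bsub>alg_prod (A # As)\<^esub> = \<one>\<^bsub>A\<^esub> # \<one>\<^bsub>alg_prod As\<^esub>"
  and alg_prod_zero: "\<zero>\<^bsub>alg_prod (A # As)\<^esub> = \<zero>\<^bsub>A\<^esub> # \<zero>\<^bsub>alg_prod As\<^esub>"
  by (simp_all add: alg_prod_def ring.defs RDirProd_list_one RDirProd_list_zero)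

lemma alg_prod_carrierE:
  assumes "zs \<in> carrier (alg_prod (A # As))"
  obtains x xs where "zs = x # xs" "x \<in> carrier A" "xs \<in> carrier (alg_prod As)"
  using assms by (auto simp: alg_prod_def ring.defs RDirProd_list_carrier)

lemma alg_prod_carrier:
  "x # xs \<in> carrier (alg_prod (A # As)) \<longleftrightarrow> x \<in> carrier A \<and> xs \<in> carrier (alg_prod As)"
  by (auto simp: alg_prod_def ring.defs RDirProd_list_carrier)

lemma alg_prod_smult: "r \<odot>\<^bsub>alg_prod (A # As)\<^esub> (x # xs) = (r \<odot>\<^bsub>A\<^esub> x) # (r \<odot>\<^bsub>alg_prod As\<^esub> xs)"
  by (simp add: alg_prod_def ring.defs)

lemma alg_prod_ops:
  assumes "x \<in> carrier A" "y \<in> carrier A" "xs \<in> carrier (alg_prod As)" "ys \<in> carrier (alg_prod As)"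
  shows alg_prod_mult: "(x # xs) \<otimes>\<^bsub>alg_prod (A # As)\<^esub> (y # ys) = (x \<otimes>\<^bsub>A\<^esub> y) # (xs \<otimes>\<^bsub>alg_prod As\<^esub> ys)"
    and alg_prod_add: "(x # xs) \<oplus>\<^bsub>alg_prod (A # As)\<^esub> (y # ys) = (x \<oplus>\<^bsub>A\<^esub> y) # (xs \<oplus>\<^bsub>alg_prod As\<^esub> ys)"
proof -
  have c: "(x, xs) \<in> carrier (RDirProd A (RDirProd_list As))" "(y, ys) \<in> carrier (RDirProd A (RDirProd_list As))"
    using assms by (auto simp: RDirProd_carrier alg_prod_def ring.defs)
  show "(x # xs) \<otimes>\<^bsub>alg_prod (A # As)\<^esub> (y # ys) = (x \<otimes>\<^bsub>A\<^esub> y) # (xs \<otimes>\<^bsub>alg_prod As\<^esub> ys)"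
    using ring_hom_mult[OF RDirProd_list_hom1 c]
    by (simp add: alg_prod_def ring.defs RDirProd_def DirProd_def monoid.defs)
  show "(x # xs) \<oplus>\<^bsub>alg_prod (A # As)\<^esub> (y # ys) = (x \<oplus>\<^bsub>A\<^esub> y) # (xs \<oplus>\<^bsub>alg_prod As\<^esub> ys)"
    using ring_hom_add[OF RDirProd_list_hom1 c]
    by (simp add: alg_prod_def ring.defs RDirProd_def DirProd_def monoid.defs)
qed

lemma algebra_alg_prod_Nil:
  assumes "cring R" shows "algebra R (alg_prod [])"
proof (rule algebraI[OF assms])
  show "cring (alg_prod [])"
    by (intro cringI abelian_groupI comm_monoidI) (auto simp: alg_prod_Nil)
qed (auto simp: alg_prod_Nil)

lemma algebra_alg_prod_Cons:
  assumes "algebra R A" "algebra R (alg_prod As)"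
  shows "algebra R (alg_prod (A # As))"
proof -
  interpret A: algebra R A by fact
  interpret Q: algebra R "alg_prod As" by fact
  note simps = alg_prod_carrier alg_prod_one alg_prod_zero alg_prod_smult alg_prod_mult alg_prod_add
  show ?thesis
  proof (rule algebraI[OF A.R_cring])
    show "cring (alg_prod (A # As))"
    proof (intro cringI abelian_groupI comm_monoidI)
      fix x assume "x \<in> carrier (alg_prod (A # As))"
      then obtain u us where "x = u # us" "u \<in> carrier A" "us \<in> carrier (alg_prod As)"
        by (rule alg_prod_carrierE)
      then show "\<exists>y\<in>carrier (alg_prod (A # As)). y \<oplus>\<^bsub>alg_prod (A # As)\<^esub> x = \<zero>\<^bsub>alg_prod (A # As)\<^esub>"
        by (intro bexI[of _ "(\<ominus>\<^bsub>A\<^esub> u) # (\<ominus>\<^bsub>alg_prod As\<^esub> us)"]) (auto simp: simps A.M.l_neg Q.M.l_neg)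
    qed (auto elim!: alg_prod_carrierE simp: simps A.M.a_ac Q.M.a_ac A.m_ac Q.m_ac A.l_distr Q.l_distr A.r_distr Q.r_distr)
  qed (auto elim!: alg_prod_carrierE simp: simps A.smult_l_distr A.smult_r_distr A.smult_assoc1 A.smult_assoc2
      Q.smult_l_distr Q.smult_r_distr Q.smult_assoc1 Q.smult_assoc2)
qed

text \<open>Algebras for which the factors of degree one of the base change to \<open>K\<close> are in bijection with the
  homomorphisms to \<open>K\<close>, because each homomorphism is nonzero on a cubic block.\<close>

definition cubic_split ::
    "('r, 'k) ring_scheme \<Rightarrow> ('r, 'b) module \<Rightarrow> ('r, 'a) module \<Rightarrow> bool" where
  "cubic_split R K A \<longleftrightarrow> algebra R A \<and> finite (alg_homs R A K) \<and>
     (\<forall>\<phi>\<in>alg_homs R A K. has_cubic_block R A K \<phi>)"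

lemma alg_homsD:
  assumes "\<phi> \<in> alg_homs R A K"
  shows "\<phi> \<in> extensional (carrier A)" "x \<in> carrier A \<Longrightarrow> \<phi> x \<in> carrier K"
    "x \<in> carrier A \<Longrightarrow> y \<in> carrier A \<Longrightarrow> \<phi> (x \<otimes>\<^bsub>A\<^esub> y) = \<phi> x \<otimes>\<^bsub>K\<^esub> \<phi> y"
    "x \<in> carrier A \<Longrightarrow> y \<in> carrier A \<Longrightarrow> \<phi> (x \<oplus>\<^bsub>A\<^esub> y) = \<phi> x \<oplus>\<^bsub>K\<^esub> \<phi> y"
    "\<phi> \<one>\<^bsub>A\<^esub> = \<one>\<^bsub>K\<^esub>" "r \<in> carrier R \<Longrightarrow> x \<in> carrier A \<Longrightarrow> \<phi> (r \<odot>\<^bsub>A\<^esub> x) = r \<odot>\<^bsub>K\<^esub> \<phi> x"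
  using assms by (auto simp: alg_homs_def ring_hom_def)

lemma alg_homsI:
  assumes "\<phi> \<in> extensional (carrier A)" "\<And>x. x \<in> carrier A \<Longrightarrow> \<phi> x \<in> carrier K"
    "\<And>x y. x \<in> carrier A \<Longrightarrow> y \<in> carrier A \<Longrightarrow> \<phi> (x \<otimes>\<^bsub>A\<^esub> y) = \<phi> x \<otimes>\<^bsub>K\<^esub> \<phi> y"
    "\<And>x y. x \<in> carrier A \<Longrightarrow> y \<in> carrier A \<Longrightarrow> \<phi> (x \<oplus>\<^bsub>A\<^esub> y) = \<phi> x \<oplus>\<^bsub>K\<^esub> \<phi> y"
    "\<phi> \<one>\<^bsub>A\<^esub> = \<one>\<^bsub>K\<^esub>" "\<And>r x. r \<in> carrier R \<Longrightarrow> x \<in> carrier A \<Longrightarrow> \<phi> (r \<odot>\<^bsub>A\<^esub> x) = r \<odot>\<^bsub>K\<^esub> \<phi> x"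
  shows "\<phi> \<in> alg_homs R A K"
  using assms by (auto simp: alg_homs_def ring_hom_def)

lemma alg_homs_zero:
  assumes "ring A" "ring K" "\<phi> \<in> alg_homs R A K" shows "\<phi> \<zero>\<^bsub>A\<^esub> = \<zero>\<^bsub>K\<^esub>"
  using ring_hom_zero[of \<phi> A K] assms by (auto simp: alg_homs_def)

text \<open>The empty product is the zero ring, which has no homomorphisms to a field.\<close>

lemma cubic_split_Nil:
  fixes R :: "('r, 'k) ring_scheme" and K :: "('r, 'b) module"
  assumes "cring R" "field K"
  shows "cubic_split R K (alg_prod [] :: ('r, 'a list) module)"
    and "alg_homs R (alg_prod [] :: ('r, 'a list) module) K = {}"
proof -
  interpret K: field K by fact
  have alg: "algebra R (alg_prod [] :: ('r, 'a list) module)"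
    by (rule algebra_alg_prod_Nil[OF assms(1)])
  then interpret Q: algebra R "alg_prod [] :: ('r, 'a list) module" .
  show "alg_homs R (alg_prod [] :: ('r, 'a list) module) K = {}"
  proof (rule equals0I)
    fix \<phi> assume \<phi>: "\<phi> \<in> alg_homs R (alg_prod [] :: ('r, 'a list) module) K"
    have "\<phi> [] = \<one>\<^bsub>K\<^esub>"
      using alg_homsD(5)[OF \<phi>] by (simp add: alg_prod_Nil)
    moreover have "\<phi> [] = \<zero>\<^bsub>K\<^esub>"
      using alg_homs_zero[OF Q.ring_axioms K.ring_axioms \<phi>] by (simp add: alg_prod_Nil)
    ultimately show False
      using K.one_not_zero by simp
  qed
  then show "cubic_split R K (alg_prod [] :: ('r, 'a list) module)"
    using alg by (simp add: cubic_split_def)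
qed

text \<open>A cubic block of one factor is one of the product, after padding \<open>\<epsilon>\<close> and \<open>\<alpha>\<close> with zeros.\<close>

lemma has_cubic_block_Cons_hd:
  assumes A: "algebra R A" and Q: "algebra R (alg_prod As)" and blk: "has_cubic_block R A K \<phi>"
    and \<psi>: "\<psi> = restrict (\<lambda>z. \<phi> (hd z)) (carrier (alg_prod (A # As)))"
  shows "has_cubic_block R (alg_prod (A # As)) K \<psi>"
proof -
  interpret A: algebra R A by fact
  interpret Q: algebra R "alg_prod As" by fact
  let ?z = "\<zero>\<^bsub>alg_prod As\<^esub>"
  note simps = alg_prod_carrier alg_prod_one alg_prod_zero alg_prod_smult alg_prod_mult alg_prod_add
  obtain \<epsilon> \<alpha> n where e: "\<epsilon> \<in> carrier A" "\<alpha> \<in> carrier A" "n \<in> carrier R"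
    "\<epsilon> \<otimes>\<^bsub>A\<^esub> \<alpha> = \<alpha>" "\<alpha> \<otimes>\<^bsub>A\<^esub> (\<alpha> \<otimes>\<^bsub>A\<^esub> \<alpha>) = n \<odot>\<^bsub>A\<^esub> \<epsilon>" "\<epsilon> \<otimes>\<^bsub>A\<^esub> \<epsilon> = \<epsilon>"
    "\<phi> \<epsilon> = \<one>\<^bsub>K\<^esub>" "\<phi> \<alpha> \<noteq> \<zero>\<^bsub>K\<^esub>"
    and span: "\<And>x. x \<in> carrier A \<Longrightarrow> \<exists>u\<in>carrier R. \<exists>v\<in>carrier R. \<exists>w\<in>carrier R.
         x \<otimes>\<^bsub>A\<^esub> \<epsilon> = u \<odot>\<^bsub>A\<^esub> \<epsilon> \<oplus>\<^bsub>A\<^esub> (v \<odot>\<^bsub>A\<^esub> \<alpha> \<oplus>\<^bsub>A\<^esub> w \<odot>\<^bsub>A\<^esub> (\<alpha> \<otimes>\<^bsub>A\<^esub> \<alpha>))"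
    using blk unfolding has_cubic_block_def by blast
  show "has_cubic_block R (alg_prod (A # As)) K \<psi>"
    unfolding has_cubic_block_def
  proof (rule bexI[of _ "\<epsilon> # ?z"], rule bexI[of _ "\<alpha> # ?z"], rule bexI[of _ n], intro conjI ballI)
    fix z assume "z \<in> carrier (alg_prod (A # As))"
    then obtain x xs where x: "z = x # xs" "x \<in> carrier A" "xs \<in> carrier (alg_prod As)"
      by (rule alg_prod_carrierE)
    obtain u v w where uvw: "u \<in> carrier R" "v \<in> carrier R" "w \<in> carrier R"
      "x \<otimes>\<^bsub>A\<^esub> \<epsilon> = u \<odot>\<^bsub>A\<^esub> \<epsilon> \<oplus>\<^bsub>A\<^esub> (v \<odot>\<^bsub>A\<^esub> \<alpha> \<oplus>\<^bsub>A\<^esub> w \<odot>\<^bsub>A\<^esub> (\<alpha> \<otimes>\<^bsub>A\<^esub> \<alpha>))"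
      using span[OF x(2)] by blast
    show "\<exists>u\<in>carrier R. \<exists>v\<in>carrier R. \<exists>w\<in>carrier R. z \<otimes>\<^bsub>alg_prod (A # As)\<^esub> (\<epsilon> # ?z) =
        u \<odot>\<^bsub>alg_prod (A # As)\<^esub> (\<epsilon> # ?z) \<oplus>\<^bsub>alg_prod (A # As)\<^esub> (v \<odot>\<^bsub>alg_prod (A # As)\<^esub> (\<alpha> # ?z)
        \<oplus>\<^bsub>alg_prod (A # As)\<^esub> w \<odot>\<^bsub>alg_prod (A # As)\<^esub> ((\<alpha> # ?z) \<otimes>\<^bsub>alg_prod (A # As)\<^esub> (\<alpha> # ?z)))"
      using x uvw e by (intro bexI[of _ u] bexI[of _ v] bexI[of _ w]) (simp_all add: simps)
  qed (use e in \<open>auto simp: simps \<psi>\<close>)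
qed

lemma has_cubic_block_Cons_tl:
  assumes A: "algebra R A" and Q: "algebra R (alg_prod As)" and blk: "has_cubic_block R (alg_prod As) K \<phi>'"
    and \<psi>: "\<psi> = restrict (\<lambda>z. \<phi>' (tl z)) (carrier (alg_prod (A # As)))"
  shows "has_cubic_block R (alg_prod (A # As)) K \<psi>"
proof -
  interpret A: algebra R A by fact
  interpret Q: algebra R "alg_prod As" by fact
  let ?z = "\<zero>\<^bsub>alg_prod As\<^esub>"
  note simps = alg_prod_carrier alg_prod_one alg_prod_zero alg_prod_smult alg_prod_mult alg_prod_add
  obtain \<epsilon> \<alpha> n where e: "\<epsilon> \<in> carrier (alg_prod As)" "\<alpha> \<in> carrier (alg_prod As)" "n \<in> carrier R"
    "\<epsilon> \<otimes>\<^bsub>alg_prod As\<^esub> \<alpha> = \<alpha>" "\<alpha> \<otimes>\<^bsub>alg_prod As\<^esub> (\<alpha> \<otimes>\<^bsub>alg_prod As\<^esub> \<alpha>) = n \<odot>\<^bsub>alg_prod As\<^esub> \<epsilon>"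
    "\<epsilon> \<otimes>\<^bsub>alg_prod As\<^esub> \<epsilon> = \<epsilon>" "\<phi>' \<epsilon> = \<one>\<^bsub>K\<^esub>" "\<phi>' \<alpha> \<noteq> \<zero>\<^bsub>K\<^esub>"
    and span: "\<And>x. x \<in> carrier (alg_prod As) \<Longrightarrow> \<exists>u\<in>carrier R. \<exists>v\<in>carrier R. \<exists>w\<in>carrier R.
         x \<otimes>\<^bsub>alg_prod As\<^esub> \<epsilon> = u \<odot>\<^bsub>alg_prod As\<^esub> \<epsilon> \<oplus>\<^bsub>alg_prod As\<^esub> (v \<odot>\<^bsub>alg_prod As\<^esub> \<alpha> \<oplus>\<^bsub>alg_prod As\<^esub> w \<odot>\<^bsub>alg_prod As\<^esub> (\<alpha> \<otimes>\<^bsub>alg_prod As\<^esub> \<alpha>))"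
    using blk unfolding has_cubic_block_def by blast
  show "has_cubic_block R (alg_prod (A # As)) K \<psi>"
    unfolding has_cubic_block_def
  proof (rule bexI[of _ "\<zero>\<^bsub>A\<^esub> # \<epsilon>"], rule bexI[of _ "\<zero>\<^bsub>A\<^esub> # \<alpha>"], rule bexI[of _ n],
      intro conjI ballI)
    fix z assume "z \<in> carrier (alg_prod (A # As))"
    then obtain x xs where x: "z = x # xs" "x \<in> carrier A" "xs \<in> carrier (alg_prod As)"
      by (rule alg_prod_carrierE)
    obtain u v w where uvw: "u \<in> carrier R" "v \<in> carrier R" "w \<in> carrier R"
      "xs \<otimes>\<^bsub>alg_prod As\<^esub> \<epsilon> = u \<odot>\<^bsub>alg_prod As\<^esub> \<epsilon> \<oplus>\<^bsub>alg_prod As\<^esub> (v \<odot>\<^bsub>alg_prod As\<^esub> \<alpha> \<oplus>\<^bsub>alg_prod As\<^esub> w \<odot>\<^bsub>alg_prod As\<^esub> (\<alpha> \<otimes>\<^bsub>alg_prod As\<^esub> \<alpha>))"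
      using span[OF x(3)] by blast
    show "\<exists>u\<in>carrier R. \<exists>v\<in>carrier R. \<exists>w\<in>carrier R. z \<otimes>\<^bsub>alg_prod (A # As)\<^esub> (\<zero>\<^bsub>A\<^esub> # \<epsilon>) =
        u \<odot>\<^bsub>alg_prod (A # As)\<^esub> (\<zero>\<^bsub>A\<^esub> # \<epsilon>) \<oplus>\<^bsub>alg_prod (A # As)\<^esub> (v \<odot>\<^bsub>alg_prod (A # As)\<^esub> (\<zero>\<^bsub>A\<^esub> # \<alpha>)
        \<oplus>\<^bsub>alg_prod (A # As)\<^esub> w \<odot>\<^bsub>alg_prod (A # As)\<^esub> ((\<zero>\<^bsub>A\<^esub> # \<alpha>) \<otimes>\<^bsub>alg_prod (A # As)\<^esub> (\<zero>\<^bsub>A\<^esub> # \<alpha>)))"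
      using x uvw e by (intro bexI[of _ u] bexI[of _ v] bexI[of _ w]) (simp_all add: simps)
  qed (use e in \<open>auto simp: simps \<psi>\<close>)
qed

text \<open>Since \<open>K\<close> is a domain, a homomorphism to \<open>K\<close> kills one of the idempotents \<open>(1, 0)\<close> and \<open>(0, 1)\<close>, so that it
  comes from a homomorphism on exactly one of the two factors.\<close>

lemma alg_homs_Cons:
  assumes A: "algebra R A" and Q: "algebra R (alg_prod As)" and K: "algebra R K" "field K"
  defines "F1 \<equiv> \<lambda>\<phi>. restrict (\<lambda>z. \<phi> (hd z)) (carrier (alg_prod (A # As)))"
    and "F2 \<equiv> \<lambda>\<phi>. restrict (\<lambda>z. \<phi> (tl z)) (carrier (alg_prod (A # As)))"
  shows "alg_homs R (alg_prod (A # As)) K = F1 ` alg_homs R A K \<union> F2 ` alg_homs R (alg_prod As) K"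
    and "F1 ` alg_homs R A K \<inter> F2 ` alg_homs R (alg_prod As) K = {}"
    and "inj_on F1 (alg_homs R A K)" and "inj_on F2 (alg_homs R (alg_prod As) K)"
proof -
  interpret A: algebra R A by fact
  interpret Q: algebra R "alg_prod As" by fact
  interpret K: field K by fact
  interpret KA: algebra R K by fact
  let ?P = "alg_prod (A # As)" and ?Q = "alg_prod As"
  interpret P: algebra R ?P by (rule algebra_alg_prod_Cons[OF A Q])
  note simps = alg_prod_carrier alg_prod_one alg_prod_zero alg_prod_smult alg_prod_mult alg_prod_add
  have 1: "F1 \<phi> \<in> alg_homs R ?P K" if \<phi>: "\<phi> \<in> alg_homs R A K" for \<phi>
    by (rule alg_homsI) (auto simp: F1_def simps elim!: alg_prod_carrierE intro!: alg_homsD[OF \<phi>])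
  have 2: "F2 \<phi> \<in> alg_homs R ?P K" if \<phi>: "\<phi> \<in> alg_homs R ?Q K" for \<phi>
    by (rule alg_homsI) (auto simp: F2_def simps elim!: alg_prod_carrierE intro!: alg_homsD[OF \<phi>])
  have 3: "\<phi> \<in> F1 ` alg_homs R A K \<union> F2 ` alg_homs R ?Q K" if \<phi>: "\<phi> \<in> alg_homs R ?P K" for \<phi>
  proof -
    note h = alg_homsD[OF \<phi>]
    let ?a = "\<one>\<^bsub>A\<^esub> # \<zero>\<^bsub>?Q\<^esub>" and ?b = "\<zero>\<^bsub>A\<^esub> # \<one>\<^bsub>?Q\<^esub>"
    have ab: "?a \<in> carrier ?P" "?b \<in> carrier ?P"
      by (auto simp: simps)
    have \<phi>z: "\<phi> (\<zero>\<^bsub>A\<^esub> # \<zero>\<^bsub>?Q\<^esub>) = \<zero>\<^bsub>K\<^esub>"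
      using alg_homs_zero[OF P.ring_axioms K.ring_axioms \<phi>] by (simp add: simps)
    have s: "\<phi> ?a \<oplus>\<^bsub>K\<^esub> \<phi> ?b = \<one>\<^bsub>K\<^esub>"
      using h(4)[OF ab] h(5) by (simp add: simps)
    have "\<phi> ?a \<otimes>\<^bsub>K\<^esub> \<phi> ?b = \<zero>\<^bsub>K\<^esub>"
      using h(3)[OF ab] \<phi>z by (simp add: simps)
    then have "\<phi> ?a = \<zero>\<^bsub>K\<^esub> \<or> \<phi> ?b = \<zero>\<^bsub>K\<^esub>"
      using K.integral h(2) ab by blast
    then show ?thesis
    proof
      assume b: "\<phi> ?b = \<zero>\<^bsub>K\<^esub>"
      then have a: "\<phi> ?a = \<one>\<^bsub>K\<^esub>"
        using s h(2)[OF ab(1)] by simp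
      define \<psi> where "\<psi> = restrict (\<lambda>x. \<phi> (x # \<zero>\<^bsub>?Q\<^esub>)) (carrier A)"
      have "\<psi> \<in> alg_homs R A K"
      proof (rule alg_homsI)
        fix x y assume xy: "x \<in> carrier A" "y \<in> carrier A"
        show "\<psi> (x \<otimes>\<^bsub>A\<^esub> y) = \<psi> x \<otimes>\<^bsub>K\<^esub> \<psi> y"
          using xy h(3)[of "x # \<zero>\<^bsub>?Q\<^esub>" "y # \<zero>\<^bsub>?Q\<^esub>"] by (simp add: \<psi>_def simps)
        show "\<psi> (x \<oplus>\<^bsub>A\<^esub> y) = \<psi> x \<oplus>\<^bsub>K\<^esub> \<psi> y"
          using xy h(4)[of "x # \<zero>\<^bsub>?Q\<^esub>" "y # \<zero>\<^bsub>?Q\<^esub>"] by (simp add: \<psi>_def simps)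
      next
        fix r x assume rx: "r \<in> carrier R" "x \<in> carrier A"
        then show "\<psi> (r \<odot>\<^bsub>A\<^esub> x) = r \<odot>\<^bsub>K\<^esub> \<psi> x"
          using h(6)[of r "x # \<zero>\<^bsub>?Q\<^esub>"] by (simp add: \<psi>_def simps)
      qed (use a in \<open>auto simp: \<psi>_def simps intro!: h(2)\<close>)
      moreover have "\<phi> = F1 \<psi>"
      proof (rule extensionalityI[OF h(1)])
        show "F1 \<psi> \<in> extensional (carrier ?P)"
          by (simp add: F1_def)
        fix z assume z: "z \<in> carrier ?P"
        then obtain x xs where x: "z = x # xs" "x \<in> carrier A" "xs \<in> carrier ?Q"
          by (rule alg_prod_carrierE)
        have "\<phi> z = \<phi> (z \<otimes>\<^bsub>?P\<^esub> ?a)"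
          using h(3)[OF z ab(1)] a h(2)[OF z] by simp
        then show "\<phi> z = F1 \<psi> z"
          using x z by (simp add: simps F1_def \<psi>_def)
      qed
      ultimately show ?thesis
        by blast
    next
      assume a: "\<phi> ?a = \<zero>\<^bsub>K\<^esub>"
      then have b: "\<phi> ?b = \<one>\<^bsub>K\<^esub>"
        using s h(2)[OF ab(2)] by simp
      define \<psi> where "\<psi> = restrict (\<lambda>x. \<phi> (\<zero>\<^bsub>A\<^esub> # x)) (carrier ?Q)"
      have "\<psi> \<in> alg_homs R ?Q K"
      proof (rule alg_homsI)
        fix x y assume xy: "x \<in> carrier ?Q" "y \<in> carrier ?Q"
        show "\<psi> (x \<otimes>\<^bsub>?Q\<^esub> y) = \<psi> x \<otimes>\<^bsub>K\<^esub> \<psi> y"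
          using xy h(3)[of "\<zero>\<^bsub>A\<^esub> # x" "\<zero>\<^bsub>A\<^esub> # y"] by (simp add: \<psi>_def simps)
        show "\<psi> (x \<oplus>\<^bsub>?Q\<^esub> y) = \<psi> x \<oplus>\<^bsub>K\<^esub> \<psi> y"
          using xy h(4)[of "\<zero>\<^bsub>A\<^esub> # x" "\<zero>\<^bsub>A\<^esub> # y"] by (simp add: \<psi>_def simps)
      next
        fix r x assume rx: "r \<in> carrier R" "x \<in> carrier ?Q"
        then show "\<psi> (r \<odot>\<^bsub>?Q\<^esub> x) = r \<odot>\<^bsub>K\<^esub> \<psi> x"
          using h(6)[of r "\<zero>\<^bsub>A\<^esub> # x"] by (simp add: \<psi>_def simps)
      qed (use b in \<open>auto simp: \<psi>_def simps intro!: h(2)\<close>)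
      moreover have "\<phi> = F2 \<psi>"
      proof (rule extensionalityI[OF h(1)])
        show "F2 \<psi> \<in> extensional (carrier ?P)"
          by (simp add: F2_def)
        fix z assume z: "z \<in> carrier ?P"
        then obtain x xs where x: "z = x # xs" "x \<in> carrier A" "xs \<in> carrier ?Q"
          by (rule alg_prod_carrierE)
        have "\<phi> z = \<phi> (z \<otimes>\<^bsub>?P\<^esub> ?b)"
          using h(3)[OF z ab(2)] b h(2)[OF z] by simp
        then show "\<phi> z = F2 \<psi> z"
          using x z by (simp add: simps F2_def \<psi>_def)
      qed
      ultimately show ?thesis
        by blast
    qed
  qed
  show "alg_homs R ?P K = F1 ` alg_homs R A K \<union> F2 ` alg_homs R ?Q K"
    using 1 2 3 by blast
  show "F1 ` alg_homs R A K \<inter> F2 ` alg_homs R ?Q K = {}"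
  proof (rule equals0I)
    fix \<chi> assume "\<chi> \<in> F1 ` alg_homs R A K \<inter> F2 ` alg_homs R ?Q K"
    then obtain \<phi> \<psi> where *: "\<phi> \<in> alg_homs R A K" "\<psi> \<in> alg_homs R ?Q K" "F1 \<phi> = F2 \<psi>"
      by blast
    have "\<phi> \<one>\<^bsub>A\<^esub> = \<psi> \<zero>\<^bsub>?Q\<^esub>"
      using fun_cong[OF *(3), of "\<one>\<^bsub>A\<^esub> # \<zero>\<^bsub>?Q\<^esub>"] by (simp add: F1_def F2_def simps)
    then show False
      using alg_homsD(5)[OF *(1)] alg_homs_zero[OF Q.ring_axioms K.ring_axioms *(2)] by simp
  qed
  show "inj_on F1 (alg_homs R A K)"
  proof (rule inj_onI)
    fix \<phi> \<psi> assume *: "\<phi> \<in> alg_homs R A K" "\<psi> \<in> alg_homs R A K" "F1 \<phi> = F1 \<psi>"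
    show "\<phi> = \<psi>"
    proof (rule extensionalityI[OF alg_homsD(1)[OF *(1)] alg_homsD(1)[OF *(2)]])
      fix x assume "x \<in> carrier A"
      then show "\<phi> x = \<psi> x"
        using fun_cong[OF *(3), of "x # \<zero>\<^bsub>?Q\<^esub>"] by (simp add: F1_def simps)
    qed
  qed
  show "inj_on F2 (alg_homs R ?Q K)"
  proof (rule inj_onI)
    fix \<phi> \<psi> assume *: "\<phi> \<in> alg_homs R ?Q K" "\<psi> \<in> alg_homs R ?Q K" "F2 \<phi> = F2 \<psi>"
    show "\<phi> = \<psi>"
    proof (rule extensionalityI[OF alg_homsD(1)[OF *(1)] alg_homsD(1)[OF *(2)]])
      fix x assume "x \<in> carrier ?Q"
      then show "\<phi> x = \<psi> x"
        using fun_cong[OF *(3), of "\<zero>\<^bsub>A\<^esub> # x"] by (simp add: F2_def simps)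
    qed
  qed
qed

lemma cubic_split_Cons:
  assumes A: "cubic_split R K A" and Q: "cubic_split R K (alg_prod As)" and K: "algebra R K" "field K"
  shows "cubic_split R K (alg_prod (A # As))"
    and "card (alg_homs R (alg_prod (A # As)) K) = card (alg_homs R A K) + card (alg_homs R (alg_prod As) K)"
proof -
  have alg: "algebra R A" "algebra R (alg_prod As)" and fin: "finite (alg_homs R A K)" "finite (alg_homs R (alg_prod As) K)"
    using A Q by (auto simp: cubic_split_def)
  note h = alg_homs_Cons[OF alg K]
  have "has_cubic_block R (alg_prod (A # As)) K \<phi>" if "\<phi> \<in> alg_homs R (alg_prod (A # As)) K" for \<phi>
    using that A Q has_cubic_block_Cons_hd[OF alg] has_cubic_block_Cons_tl[OF alg]
    unfolding h(1) cubic_split_def by blast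
  then show "cubic_split R K (alg_prod (A # As))"
    using algebra_alg_prod_Cons[OF alg] fin unfolding cubic_split_def h(1) by blast
  show "card (alg_homs R (alg_prod (A # As)) K) = card (alg_homs R A K) + card (alg_homs R (alg_prod As) K)"
    unfolding h(1) using fin h(2-4) by (simp add: card_Un_disjoint card_image)
qed

lemma cubic_split_alg_prod:
  assumes K: "algebra R K" "field K" and "\<And>A. A \<in> set As \<Longrightarrow> cubic_split R K A"
  shows "cubic_split R K (alg_prod As)"
    and "card (alg_homs R (alg_prod As) K) = (\<Sum>A\<leftarrow>As. card (alg_homs R A K))"
proof -
  have R: "cring R"
    using algebra.R_cring[OF K(1)] .
  have "cubic_split R K (alg_prod As) \<and> card (alg_homs R (alg_prod As) K) = (\<Sum>A\<leftarrow>As. card (alg_homs R A K))"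
    using assms(3)
  proof (induction As)
    case Nil
    then show ?case
      by (simp add: cubic_split_Nil[OF R K(2)])
  next
    case (Cons A As)
    then show ?case
      using cubic_split_Cons[OF _ _ K, of A As] by simp
  qed
  then show "cubic_split R K (alg_prod As)"
    and "card (alg_homs R (alg_prod As) K) = (\<Sum>A\<leftarrow>As. card (alg_homs R A K))"
    by blast+
qed

section \<open>Pure cubic extensions of the rationals\<close>

abbreviation "rat_ring \<equiv> (ring_of_type_algebra :: rat ring)"

lemma ring_of_type_algebra_simps [simp]:
  "carrier ring_of_type_algebra = UNIV" "x \<otimes>\<^bsub>ring_of_type_algebra\<^esub> y = x * y"
  "x \<oplus>\<^bsub>ring_of_type_algebra\<^esub> y = x + y" "\<one>\<^bsub>ring_of_type_algebra\<^esub> = 1" "\<zero>\<^bsub>ring_of_type_algebra\<^esub> = 0"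
  by (simp_all add: ring_of_type_algebra_def)

lemma ring_of_type_algebra_uminus [simp]: "\<ominus>\<^bsub>ring_of_type_algebra\<^esub> x = - (x :: 'a :: comm_ring_1)"
proof -
  interpret cring "ring_of_type_algebra :: 'a ring" ..
  show ?thesis
    by (rule minus_equality) auto
qed

lemma ring_of_type_algebra_inverse:
  assumes "x \<noteq> 0" shows "inv\<^bsub>ring_of_type_algebra\<^esub> x = inverse (x :: 'a :: Fields.field)"
proof -
  interpret cring "ring_of_type_algebra :: 'a ring" ..
  show ?thesis
    using assms by (intro comm_inv_char) auto
qed

lemma rat_adjoin_simps [simp]:
  "carrier (rat_adjoin S) = generate_field ring_of_type_algebra (\<rat> \<union> S)"
  "x \<otimes>\<^bsub>rat_adjoin S\<^esub> y = x * y" "x \<oplus>\<^bsub>rat_adjoin S\<^esub> y = x + y"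
  "\<one>\<^bsub>rat_adjoin S\<^esub> = 1" "\<zero>\<^bsub>rat_adjoin S\<^esub> = 0" "q \<odot>\<^bsub>rat_adjoin S\<^esub> x = of_rat q * x"
  by (simp_all add: rat_adjoin_def ring.defs)

lemma rat_adjoin_algebra: "algebra rat_ring (rat_adjoin S)"
proof (rule algebraI)
  interpret C: Ring.field "ring_of_type_algebra :: complex ring" ..
  have "Ring.field (ring_of_type_algebra\<lparr>carrier := generate_field ring_of_type_algebra (\<rat> \<union> S)\<rparr>)"
    by (rule C.generate_field_is_field) simp
  then show "cring (rat_adjoin S)"
    unfolding rat_adjoin_def by (intro cring_extend) (simp add: Ring.field_def domain_def)
  show "cring rat_ring" ..
  fix q x assume "x \<in> carrier (rat_adjoin S)"
  then show "q \<odot>\<^bsub>rat_adjoin S\<^esub> x \<in> carrier (rat_adjoin S)"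
    using generate_field.eng_mult[of "of_rat q" ring_of_type_algebra "\<rat> \<union> S" x]
      generate_field.incl[of "of_rat q" "\<rat> \<union> S" ring_of_type_algebra] by simp
qed (auto simp: algebra_simps of_rat_add of_rat_mult)

text \<open>The additive span of \<open>1, \<alpha>, \<alpha>\<^sup>2\<close> over the rationals. It is used with \<open>\<alpha>\<^sup>3\<close> rational; the three powers
  need not be independent.\<close>

definition cubic_span :: "complex \<Rightarrow> complex set" where
  "cubic_span \<alpha> = {of_rat u + of_rat v * \<alpha> + of_rat w * \<alpha> ^ 2 | u v w. True}"

lemma cubic_spanI: "x = of_rat u + of_rat v * \<alpha> + of_rat w * \<alpha> ^ 2 \<Longrightarrow> x \<in> cubic_span \<alpha>"
  unfolding cubic_span_def by blast

lemma cubic_span_mult: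
  assumes \<alpha>: "\<alpha> ^ 3 = of_rat n" and "x \<in> cubic_span \<alpha>" "y \<in> cubic_span \<alpha>"
  shows "x * y \<in> cubic_span \<alpha>"
proof -
  obtain u v w u' v' w' where x: "x = of_rat u + of_rat v * \<alpha> + of_rat w * \<alpha> ^ 2"
    and y: "y = of_rat u' + of_rat v' * \<alpha> + of_rat w' * \<alpha> ^ 2"
    using assms by (auto simp: cubic_span_def)
  show ?thesis
  proof (rule cubic_spanI)
    have "x * y = of_rat u * of_rat u' + of_rat (v * w' + w * v') * \<alpha> ^ 3 +
        (of_rat u * of_rat v' + of_rat v * of_rat u' + of_rat (w * w') * \<alpha> ^ 3) * \<alpha> +
        of_rat (u * w' + v * v' + w * u') * \<alpha> ^ 2"
      unfolding x y by (simp add: of_rat_add of_rat_mult algebra_simps power2_eq_square power3_eq_cube)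
    then show "x * y = of_rat (u * u' + (v * w' + w * v') * n) + of_rat (u * v' + v * u' + w * w' * n) * \<alpha> +
        of_rat (u * w' + v * v' + w * u') * \<alpha> ^ 2"
      unfolding \<alpha> by (simp add: of_rat_add of_rat_mult)
  qed
qed

text \<open>The hypothesis on \<open>S\<close> covers \<open>S = {\<alpha>}\<close> and also \<open>S = {}\<close> with \<open>\<alpha> = 1\<close>.\<close>

lemma generate_field_cubic_span:
  assumes \<alpha>: "\<alpha> ^ 3 = of_rat n" and S: "S \<subseteq> cubic_span \<alpha>" "\<alpha> \<in> \<rat> \<union> S"
    and inv: "\<And>x. x \<in> cubic_span \<alpha> \<Longrightarrow> x \<noteq> 0 \<Longrightarrow> inverse x \<in> cubic_span \<alpha>"
  shows "generate_field ring_of_type_algebra (\<rat> \<union> S) = cubic_span \<alpha>"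
proof (intro equalityI subsetI)
  have rat: "of_rat u \<in> cubic_span \<alpha>" for u
    by (rule cubic_spanI[of _ u 0 _ 0]) simp
  fix x assume "x \<in> generate_field ring_of_type_algebra (\<rat> \<union> S)"
  then show "x \<in> cubic_span \<alpha>"
  proof (induction rule: generate_field.induct)
    case one
    then show ?case
      using rat[of 1] by simp
  next
    case (incl h)
    then show ?case
      using rat S by (auto elim!: Rats_cases)
  next
    case (a_inv h)
    then obtain u v w where "h = of_rat u + of_rat v * \<alpha> + of_rat w * \<alpha> ^ 2"
      by (auto simp: cubic_span_def)
    then show ?case
      by (intro cubic_spanI[of _ "- u" "- v" _ "- w"]) (simp add: of_rat_minus)
  next
    case (m_inv h)
    then show ?case
      using inv by (simp add: ring_of_type_algebra_inverse)
  next
    case (eng_add h1 h2)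
    then obtain u v w u' v' w' where "h1 = of_rat u + of_rat v * \<alpha> + of_rat w * \<alpha> ^ 2"
      "h2 = of_rat u' + of_rat v' * \<alpha> + of_rat w' * \<alpha> ^ 2"
      by (auto simp: cubic_span_def)
    then show ?case
      by (intro cubic_spanI[of _ "u + u'" "v + v'" _ "w + w'"]) (simp add: of_rat_add algebra_simps)
  next
    case (eng_mult h1 h2)
    then show ?case
      using cubic_span_mult[OF \<alpha>] by simp
  qed
next
  let ?F = "generate_field ring_of_type_algebra (\<rat> \<union> S)"
  have rat: "of_rat u \<in> ?F" for u
    by (rule generate_field.incl) simp
  have add: "x + y \<in> ?F" and mult: "x * y \<in> ?F" if "x \<in> ?F" "y \<in> ?F" for x y
    using generate_field.eng_add[OF that] generate_field.eng_mult[OF that] by simp_all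
  have "\<alpha> \<in> ?F"
    using S(2) by (rule generate_field.incl)
  then show "x \<in> ?F" if "x \<in> cubic_span \<alpha>" for x
    using that unfolding cubic_span_def power2_eq_square by (auto intro!: add mult rat)
qed

text \<open>A field that contains the rationals.\<close>

locale rat_field_algebra = K: algebra rat_ring K + K_field: Ring.field K
  for K :: "(rat, 'b) module" (structure)
begin

lemma smult_simps [simp]:
  "x \<in> carrier K \<Longrightarrow> q \<odot> x \<in> carrier K"
  "x \<in> carrier K \<Longrightarrow> 1 \<odot> x = x"
  "x \<in> carrier K \<Longrightarrow> 0 \<odot> x = \<zero>"
  using K.smult_closed[of q x] K.smult_one[of x] K.smult_l_null[of x] by auto

lemma smult_ops:
  "x \<in> carrier K \<Longrightarrow> (p + q) \<odot> x = p \<odot> x \<oplus> q \<odot> x"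
  "x \<in> carrier K \<Longrightarrow> y \<in> carrier K \<Longrightarrow> q \<odot> (x \<oplus> y) = q \<odot> x \<oplus> q \<odot> y"
  "x \<in> carrier K \<Longrightarrow> (p * q) \<odot> x = p \<odot> (q \<odot> x)"
  "x \<in> carrier K \<Longrightarrow> y \<in> carrier K \<Longrightarrow> (q \<odot> x) \<otimes> y = q \<odot> (x \<otimes> y)"
  "x \<in> carrier K \<Longrightarrow> y \<in> carrier K \<Longrightarrow> x \<otimes> (q \<odot> y) = q \<odot> (x \<otimes> y)"
  using K.smult_l_distr[of p q x] K.smult_r_distr[of q x y] K.smult_assoc1[of p q x]
    K.smult_assoc2[of q x y] K.smult_assoc2[of q y x] by (auto simp: K.m_comm)

lemma smult_minus: "x \<in> carrier K \<Longrightarrow> (- q) \<odot> x = \<ominus> (q \<odot> x)"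
  using K.smult_l_minus[of q x] by simp

lemma smult_eq_zero:
  assumes "x \<in> carrier K" "q \<odot> x = \<zero>" "q \<noteq> 0" shows "x = \<zero>"
proof -
  have "x = (inverse q * q) \<odot> x"
    using assms by simp
  also have "\<dots> = inverse q \<odot> \<zero>"
    using assms by (simp only: smult_ops)
  also have "\<dots> = \<zero>"
    using K.smult_r_null[of "inverse q"] by simp
  finally show ?thesis .
qed

lemma three_nonzero: "\<one> \<oplus> \<one> \<oplus> \<one> \<noteq> \<zero>"
proof
  assume "\<one> \<oplus> \<one> \<oplus> \<one> = \<zero>"
  moreover have "(1 + 1 + 1 :: rat) \<odot> \<one> = \<one> \<oplus> \<one> \<oplus> \<one>"
    using smult_simps(2)[OF K.one_closed] by (simp only: smult_ops K.one_closed)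
  ultimately have "\<one> = \<zero>"
    using smult_eq_zero[of \<one> "1 + 1 + 1"] by simp
  then show False
    using K_field.one_not_zero by simp
qed

text \<open>The value at \<open>r\<close> of the polynomial \<open>u + vX + wX\<^sup>2\<close>.\<close>

definition cval :: "'b \<Rightarrow> rat \<Rightarrow> rat \<Rightarrow> rat \<Rightarrow> 'b" where
  "cval r u v w = u \<odot> \<one> \<oplus> (v \<odot> r \<oplus> w \<odot> (r \<otimes> r))"

text \<open>The possible images of \<open>\<alpha>\<close> under homomorphisms to \<open>K\<close>, where \<open>\<alpha>\<^sup>3 = n\<close>.\<close>

definition cubic_images :: "complex \<Rightarrow> rat \<Rightarrow> 'b set" where
  "cubic_images \<alpha> n = {r \<in> carrier K. r \<otimes> (r \<otimes> r) = n \<odot> \<one> \<and>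
     (\<forall>u v w. of_rat u + of_rat v * \<alpha> + of_rat w * \<alpha> ^ 2 = 0 \<longrightarrow> cval r u v w = \<zero>)}"

lemma cval_closed: "r \<in> carrier K \<Longrightarrow> cval r u v w \<in> carrier K"
  by (simp add: cval_def)

lemma cval_add: "r \<in> carrier K \<Longrightarrow> cval r (u + u') (v + v') (w + w') = cval r u v w \<oplus> cval r u' v' w'"
  by (simp add: cval_def smult_ops K.M.a_ac)

lemma cval_smult: "r \<in> carrier K \<Longrightarrow> cval r (q * u) (q * v) (q * w) = q \<odot> cval r u v w"
  by (simp add: cval_def smult_ops)

lemma cval_root:
  "r \<in> carrier K \<Longrightarrow> r \<otimes> (r \<otimes> r) = n \<odot> \<one> \<Longrightarrow> cval r (w * n) u v = r \<otimes> cval r u v w"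
  by (simp add: cval_def smult_ops K.r_distr K.M.a_ac)

text \<open>A homomorphism on the span of \<open>1, \<alpha>, \<alpha>\<^sup>2\<close> is evaluation at the image \<open>r\<close> of \<open>\<alpha>\<close>. Evaluation at \<open>r\<close> is well
  defined if \<open>r\<close> satisfies the linear relations between these powers, and it is multiplicative because it
  commutes with multiplication by \<open>\<alpha>\<close>.\<close>

lemma alg_homs_cubic:
  assumes car: "carrier (rat_adjoin S) = cubic_span \<alpha>" and \<alpha>: "\<alpha> ^ 3 = of_rat n"
  shows "bij_betw (\<lambda>\<phi>. \<phi> \<alpha>) (alg_homs rat_ring (rat_adjoin S) K) (cubic_images \<alpha> n)"
proof (rule bij_betw_imageI)
  let ?A = "rat_adjoin S"
  interpret A: algebra rat_ring ?A
    by (rule rat_adjoin_algebra)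
  have rat_mem: "of_rat u \<in> cubic_span \<alpha>" for u
    by (rule cubic_spanI[of _ u 0 _ 0]) simp
  have \<alpha>_mem: "\<alpha> \<in> cubic_span \<alpha>"
    by (rule cubic_spanI[of _ 0 1 _ 0]) simp
  have expand: "\<phi> (of_rat u + of_rat v * \<alpha> + of_rat w * \<alpha> ^ 2) = cval (\<phi> \<alpha>) u v w"
    if \<phi>: "\<phi> \<in> alg_homs rat_ring ?A K" for \<phi> u v w
  proof -
    note h = alg_homsD[OF \<phi>, unfolded car, simplified]
    have mem: "1 \<in> cubic_span \<alpha>" "\<alpha> * \<alpha> \<in> cubic_span \<alpha>" "of_rat u * 1 \<in> cubic_span \<alpha>"
      "of_rat v * \<alpha> \<in> cubic_span \<alpha>" "of_rat w * (\<alpha> * \<alpha>) \<in> cubic_span \<alpha>"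
      "of_rat v * \<alpha> + of_rat w * (\<alpha> * \<alpha>) \<in> cubic_span \<alpha>"
      using rat_mem[of 1] \<alpha>_mem cubic_span_mult[OF \<alpha>] rat_mem
      by (auto intro!: cubic_spanI[of _ 0 v _ w] simp: power2_eq_square)
    have eq: "of_rat u + of_rat v * \<alpha> + of_rat w * \<alpha> ^ 2 = of_rat u * 1 + (of_rat v * \<alpha> + of_rat w * (\<alpha> * \<alpha>))"
      by (simp add: power2_eq_square)
    show ?thesis
      unfolding eq
      using h(4)[OF mem(3,6)] h(4)[OF mem(4,5)] h(6)[OF mem(1), of u] h(6)[OF \<alpha>_mem, of v]
        h(6)[OF mem(2), of w] h(3)[OF \<alpha>_mem \<alpha>_mem] h(5) by (simp add: cval_def)
  qed
  show "inj_on (\<lambda>\<phi>. \<phi> \<alpha>) (alg_homs rat_ring ?A K)"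
  proof (rule inj_onI)
    fix \<phi> \<psi> assume *: "\<phi> \<in> alg_homs rat_ring ?A K" "\<psi> \<in> alg_homs rat_ring ?A K" "\<phi> \<alpha> = \<psi> \<alpha>"
    show "\<phi> = \<psi>"
    proof (rule extensionalityI[OF alg_homsD(1)[OF *(1)] alg_homsD(1)[OF *(2)]])
      fix x assume "x \<in> carrier ?A"
      then obtain u v w where "x = of_rat u + of_rat v * \<alpha> + of_rat w * \<alpha> ^ 2"
        unfolding car cubic_span_def by blast
      then show "\<phi> x = \<psi> x"
        using expand[OF *(1)] expand[OF *(2)] *(3) by simp
    qed
  qed
  show "(\<lambda>\<phi>. \<phi> \<alpha>) ` alg_homs rat_ring ?A K = cubic_images \<alpha> n"
  proof (intro equalityI subsetI)
    fix r assume "r \<in> (\<lambda>\<phi>. \<phi> \<alpha>) ` alg_homs rat_ring ?A K"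
    then obtain \<phi> where \<phi>: "\<phi> \<in> alg_homs rat_ring ?A K" "r = \<phi> \<alpha>"
      by blast
    note h = alg_homsD[OF \<phi>(1), unfolded car, simplified]
    have "r \<otimes> (r \<otimes> r) = \<phi> (\<alpha> * (\<alpha> * \<alpha>))"
      using \<alpha>_mem cubic_span_mult[OF \<alpha>] by (simp add: h \<phi>(2))
    also have "\<alpha> * (\<alpha> * \<alpha>) = of_rat n + of_rat 0 * \<alpha> + of_rat 0 * \<alpha> ^ 2"
      using \<alpha> by (simp add: power3_eq_cube mult.assoc)
    also have "\<phi> \<dots> = n \<odot> \<one>"
      unfolding expand[OF \<phi>(1)] using h(2)[OF \<alpha>_mem] by (simp add: cval_def)
    finally have "r \<otimes> (r \<otimes> r) = n \<odot> \<one>" .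
    moreover have "cval r u v w = \<zero>" if "of_rat u + of_rat v * \<alpha> + of_rat w * \<alpha> ^ 2 = 0" for u v w
      using expand[OF \<phi>(1), of u v w] alg_homs_zero[OF A.ring_axioms K.ring_axioms \<phi>(1)]
      unfolding that \<phi>(2) by simp
    ultimately show "r \<in> cubic_images \<alpha> n"
      using h(2)[OF \<alpha>_mem] \<phi>(2) by (simp add: cubic_images_def)
  next
    fix r assume r: "r \<in> cubic_images \<alpha> n"
    then have rc: "r \<in> carrier K" and r3: "r \<otimes> (r \<otimes> r) = n \<odot> \<one>"
      and rel: "\<And>u v w. of_rat u + of_rat v * \<alpha> + of_rat w * \<alpha> ^ 2 = 0 \<Longrightarrow> cval r u v w = \<zero>"
      by (auto simp: cubic_images_def)
    \<comment> \<open>\<open>P x y\<close> says that evaluation at \<open>r\<close> sends \<open>x\<close> to \<open>y\<close>\<close>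
    define P where "P x y \<longleftrightarrow> (\<exists>u v w. x = of_rat u + of_rat v * \<alpha> + of_rat w * \<alpha> ^ 2 \<and> y = cval r u v w)" for x y
    have unique: "y = y'" if y: "P x y" and y': "P x y'" for x y y'
    proof -
      obtain u v w u' v' w' where *: "x = of_rat u + of_rat v * \<alpha> + of_rat w * \<alpha> ^ 2" "y = cval r u v w"
        "x = of_rat u' + of_rat v' * \<alpha> + of_rat w' * \<alpha> ^ 2" "y' = cval r u' v' w'"
        using y y' unfolding P_def by blast
      have "of_rat (u - u') + of_rat (v - v') * \<alpha> + of_rat (w - w') * \<alpha> ^ 2 = 0"
        using *(1,3) by (simp add: of_rat_diff algebra_simps)
      then have "cval r (u - u') (v - v') (w - w') = \<zero>"
        by (rule rel)
      then have "cval r ((u - u') + u') ((v - v') + v') ((w - w') + w') = cval r u' v' w'"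
        unfolding cval_add[OF rc] using cval_closed[OF rc] by simp
      then show ?thesis
        using * by simp
    qed
    define \<phi> where "\<phi> = restrict (\<lambda>x. SOME y. P x y) (cubic_span \<alpha>)"
    have ex: "\<exists>y. P x y" if "x \<in> cubic_span \<alpha>" for x
      using that unfolding cubic_span_def P_def by blast
    have \<phi>P: "P x (\<phi> x)" if "x \<in> cubic_span \<alpha>" for x
      using someI_ex[OF ex[OF that]] that by (simp add: \<phi>_def)
    have \<phi>_eq: "\<phi> x = y" if "P x y" for x y
    proof -
      have "x \<in> cubic_span \<alpha>"
        using that unfolding P_def cubic_span_def by blast
      then show ?thesis
        using \<phi>P unique that by blast
    qed
    have \<phi>_val: "\<phi> (of_rat u + of_rat v * \<alpha> + of_rat w * \<alpha> ^ 2) = cval r u v w" for u v w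
      by (rule \<phi>_eq) (unfold P_def, blast)
    have rep: "\<exists>u v w. x = of_rat u + of_rat v * \<alpha> + of_rat w * \<alpha> ^ 2" if "x \<in> cubic_span \<alpha>" for x
      using that unfolding cubic_span_def by blast
    have \<phi>_closed: "\<phi> x \<in> carrier K" if x: "x \<in> cubic_span \<alpha>" for x
      using rep[OF x] \<phi>_val cval_closed[OF rc] by metis
    have \<phi>_add: "\<phi> (x + y) = \<phi> x \<oplus> \<phi> y" if x: "x \<in> cubic_span \<alpha>" and y: "y \<in> cubic_span \<alpha>" for x y
    proof -
      obtain u v w u' v' w' where *: "x = of_rat u + of_rat v * \<alpha> + of_rat w * \<alpha> ^ 2"
        "y = of_rat u' + of_rat v' * \<alpha> + of_rat w' * \<alpha> ^ 2"
        using rep[OF x] rep[OF y] by blast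
      have "x + y = of_rat (u + u') + of_rat (v + v') * \<alpha> + of_rat (w + w') * \<alpha> ^ 2"
        unfolding * by (simp add: of_rat_add algebra_simps)
      then show ?thesis
        unfolding * by (simp only: \<phi>_val cval_add[OF rc])
    qed
    have \<phi>_smult: "\<phi> (of_rat q * x) = q \<odot> \<phi> x" if x: "x \<in> cubic_span \<alpha>" for q x
    proof -
      obtain u v w where *: "x = of_rat u + of_rat v * \<alpha> + of_rat w * \<alpha> ^ 2"
        using rep[OF x] by blast
      have "of_rat q * x = of_rat (q * u) + of_rat (q * v) * \<alpha> + of_rat (q * w) * \<alpha> ^ 2"
        unfolding * by (simp add: of_rat_mult algebra_simps)
      then show ?thesis
        unfolding * by (simp only: \<phi>_val cval_smult[OF rc])
    qed
    have \<phi>_root: "\<phi> (\<alpha> * x) = r \<otimes> \<phi> x" if x: "x \<in> cubic_span \<alpha>" for x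
    proof -
      obtain u v w where *: "x = of_rat u + of_rat v * \<alpha> + of_rat w * \<alpha> ^ 2"
        using rep[OF x] by blast
      have "\<alpha> * x = of_rat w * \<alpha> ^ 3 + of_rat u * \<alpha> + of_rat v * \<alpha> ^ 2"
        unfolding * by (simp add: algebra_simps power2_eq_square power3_eq_cube)
      also have "\<dots> = of_rat (w * n) + of_rat u * \<alpha> + of_rat v * \<alpha> ^ 2"
        unfolding \<alpha> by (simp add: of_rat_mult)
      finally show ?thesis
        unfolding * by (simp only: \<phi>_val cval_root[OF rc r3])
    qed
    have \<phi>_mult: "\<phi> (x * y) = \<phi> x \<otimes> \<phi> y" if x: "x \<in> cubic_span \<alpha>" and y: "y \<in> cubic_span \<alpha>" for x y
    proof -
      obtain u v w where *: "x = of_rat u + of_rat v * \<alpha> + of_rat w * \<alpha> ^ 2"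
        using rep[OF x] by blast
      note mem = cubic_span_mult[OF \<alpha>]
      have m: "of_rat u * y \<in> cubic_span \<alpha>" "\<alpha> * y \<in> cubic_span \<alpha>" "of_rat v * (\<alpha> * y) \<in> cubic_span \<alpha>"
        "\<alpha> * (\<alpha> * y) \<in> cubic_span \<alpha>" "of_rat w * (\<alpha> * (\<alpha> * y)) \<in> cubic_span \<alpha>"
        "of_rat u * y + of_rat v * (\<alpha> * y) \<in> cubic_span \<alpha>"
      proof -
        show m1: "of_rat u * y \<in> cubic_span \<alpha>" and m2: "\<alpha> * y \<in> cubic_span \<alpha>"
          using y \<alpha>_mem rat_mem mem by blast+
        then show m3: "of_rat v * (\<alpha> * y) \<in> cubic_span \<alpha>" and m4: "\<alpha> * (\<alpha> * y) \<in> cubic_span \<alpha>"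
          using \<alpha>_mem rat_mem mem by blast+
        then show "of_rat w * (\<alpha> * (\<alpha> * y)) \<in> cubic_span \<alpha>"
          using rat_mem mem by blast
        have "of_rat u + of_rat v * \<alpha> \<in> cubic_span \<alpha>"
          by (rule cubic_spanI[of _ u v _ 0]) simp
        then have "(of_rat u + of_rat v * \<alpha>) * y \<in> cubic_span \<alpha>"
          using y mem by blast
        then show "of_rat u * y + of_rat v * (\<alpha> * y) \<in> cubic_span \<alpha>"
          by (simp add: algebra_simps)
      qed
      have "x * y = (of_rat u * y + of_rat v * (\<alpha> * y)) + of_rat w * (\<alpha> * (\<alpha> * y))"
        unfolding * by (simp add: algebra_simps power2_eq_square)
      also have "\<phi> \<dots> = (u \<odot> \<phi> y \<oplus> v \<odot> (r \<otimes> \<phi> y)) \<oplus> w \<odot> (r \<otimes> (r \<otimes> \<phi> y))"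
        using m y by (simp only: \<phi>_add \<phi>_smult \<phi>_root)
      also have "\<dots> = \<phi> x \<otimes> \<phi> y"
        unfolding * \<phi>_val cval_def using rc \<phi>_closed[OF y] by (simp add: smult_ops K.l_distr K.m_assoc K.M.a_assoc)
      finally show ?thesis .
    qed
    have "\<phi> \<in> alg_homs rat_ring ?A K"
    proof (rule alg_homsI)
      show "\<phi> \<one>\<^bsub>?A\<^esub> = \<one>"
        using \<phi>_val[of 1 0 0] rc by (simp add: cval_def)
    qed (use \<phi>_closed \<phi>_add \<phi>_mult \<phi>_smult in \<open>auto simp: car[simplified] \<phi>_def\<close>)
    moreover have "\<phi> \<alpha> = r"
      using \<phi>_val[of 0 1 0] rc by (simp add: cval_def)
    ultimately show "r \<in> (\<lambda>\<phi>. \<phi> \<alpha>) ` alg_homs rat_ring ?A K"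
      by blast
  qed
qed

lemma cubic_split_rat_adjoin:
  assumes car: "carrier (rat_adjoin S) = cubic_span \<alpha>" and \<alpha>: "\<alpha> ^ 3 = of_rat n" and n: "n \<noteq> 0"
    and fin: "finite (cubic_images \<alpha> n)"
  shows "cubic_split rat_ring K (rat_adjoin S)"
    and "card (alg_homs rat_ring (rat_adjoin S) K) = card (cubic_images \<alpha> n)"
proof -
  let ?A = "rat_adjoin S"
  interpret A: algebra rat_ring ?A
    by (rule rat_adjoin_algebra)
  note bij = alg_homs_cubic[OF car \<alpha>]
  show "card (alg_homs rat_ring ?A K) = card (cubic_images \<alpha> n)"
    by (rule bij_betw_same_card[OF bij])
  have "has_cubic_block rat_ring ?A K \<phi>" if \<phi>: "\<phi> \<in> alg_homs rat_ring ?A K" for \<phi>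
    unfolding has_cubic_block_def
  proof (rule bexI[of _ 1], rule bexI[of _ \<alpha>], rule bexI[of _ n], intro conjI ballI)
    fix x assume "x \<in> carrier ?A"
    then obtain u v w where "x = of_rat u + of_rat v * \<alpha> + of_rat w * \<alpha> ^ 2"
      unfolding car cubic_span_def by blast
    then show "\<exists>u\<in>carrier rat_ring. \<exists>v\<in>carrier rat_ring. \<exists>w\<in>carrier rat_ring.
        x \<otimes>\<^bsub>?A\<^esub> 1 = u \<odot>\<^bsub>?A\<^esub> 1 \<oplus>\<^bsub>?A\<^esub> (v \<odot>\<^bsub>?A\<^esub> \<alpha> \<oplus>\<^bsub>?A\<^esub> w \<odot>\<^bsub>?A\<^esub> (\<alpha> \<otimes>\<^bsub>?A\<^esub> \<alpha>))"
      by (auto simp: power2_eq_square add.assoc)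
  next
    have "\<phi> \<alpha> \<in> cubic_images \<alpha> n"
      using bij \<phi> by (auto simp: bij_betw_def)
    then have r: "\<phi> \<alpha> \<in> carrier K" "\<phi> \<alpha> \<otimes> (\<phi> \<alpha> \<otimes> \<phi> \<alpha>) = n \<odot> \<one>"
      by (auto simp: cubic_images_def)
    show "\<phi> \<alpha> \<noteq> \<zero>"
    proof
      assume "\<phi> \<alpha> = \<zero>"
      then have "\<one> = \<zero>"
        using r smult_eq_zero[of \<one> n] n by simp
      then show False
        using K_field.one_not_zero by simp
    qed
    show "\<phi> 1 = \<one>"
      using alg_homsD(5)[OF \<phi>] by simp
    show "\<alpha> \<otimes>\<^bsub>?A\<^esub> (\<alpha> \<otimes>\<^bsub>?A\<^esub> \<alpha>) = n \<odot>\<^bsub>?A\<^esub> 1"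
      using \<alpha> by (simp add: power3_eq_cube mult.assoc)
    show "\<alpha> \<in> carrier ?A"
      unfolding car by (rule cubic_spanI[of _ 0 1 _ 0]) simp
    show "1 \<in> carrier ?A"
      using A.one_closed by simp
  qed auto
  moreover have "finite (alg_homs rat_ring ?A K)"
    using bij_betw_finite[OF bij] fin by blast
  ultimately show "cubic_split rat_ring K ?A"
    unfolding cubic_split_def using rat_adjoin_algebra by blast
qed

end

subsection \<open>The fields generated by cube roots\<close>

lemma rat_adjoin_empty: "carrier (rat_adjoin {}) = cubic_span 1"
proof -
  have "x \<in> \<rat>" if "x \<in> cubic_span 1" for x
    using that by (auto simp: cubic_span_def)
  moreover have "x \<in> cubic_span 1" if "x \<in> \<rat>" for x
    using that by (elim Rats_cases) (auto intro: cubic_spanI[of _ _ 0 _ 0])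
  ultimately have "cubic_span 1 = \<rat>"
    by blast
  then have "generate_field ring_of_type_algebra (\<rat> \<union> {}) = cubic_span 1"
    by (intro generate_field_cubic_span[of 1 1]) auto
  then show ?thesis
    by simp
qed

lemma primitive_root_quadratic:
  fixes \<theta> :: complex
  assumes "\<theta> ^ 3 = 1" "\<theta> \<noteq> 1"
  shows "\<theta> ^ 2 = - 1 - \<theta>"
proof -
  have "(\<theta> - 1) * (\<theta> ^ 2 + \<theta> + 1) = \<theta> ^ 3 - 1"
    by (simp add: algebra_simps power2_eq_square power3_eq_cube)
  then have "\<theta> ^ 2 + \<theta> + 1 = 0"
    using assms by simp
  then show ?thesis
    by (simp add: algebra_simps eq_neg_iff_add_eq_0)
qed

lemma primitive_root_independent:
  fixes \<theta> :: complex
  assumes \<theta>: "\<theta> ^ 3 = 1" "\<theta> \<noteq> 1" and eq: "of_rat u + of_rat v * \<theta> = 0"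
  shows "u = 0 \<and> v = 0"
proof -
  have "v = 0"
  proof (rule ccontr)
    assume v: "v \<noteq> 0"
    define q where "q = - u / v"
    have "\<theta> = of_rat q"
      using eq v by (simp add: q_def of_rat_divide of_rat_minus field_simps eq_neg_iff_add_eq_0)
    then have "(of_rat (q ^ 2 + q + 1) :: complex) = of_rat 0"
      using primitive_root_quadratic[OF \<theta>] by (simp add: of_rat_add of_rat_power)
    then have "q ^ 2 + q + 1 = 0"
      by (simp only: of_rat_eq_iff)
    then have "(2 * q + 1) ^ 2 + 3 = 0"
      by (simp add: power2_eq_square algebra_simps)
    then show False
      using zero_le_power2[of "2 * q + 1"] by linarith
  qed
  then show ?thesis
    using eq by simp
qed

lemma rat_adjoin_primitive_root:
  assumes \<theta>: "\<theta> ^ 3 = 1" "\<theta> \<noteq> 1"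
  shows "carrier (rat_adjoin {\<theta>}) = cubic_span \<theta>"
proof -
  note quad = primitive_root_quadratic[OF \<theta>]
  have "inverse x \<in> cubic_span \<theta>" if x: "x \<in> cubic_span \<theta>" "x \<noteq> 0" for x
  proof -
    obtain u0 v0 w0 where "x = of_rat u0 + of_rat v0 * \<theta> + of_rat w0 * \<theta> ^ 2"
      using x by (auto simp: cubic_span_def)
    then have "x = of_rat (u0 - w0) + of_rat (v0 - w0) * \<theta>"
      unfolding quad by (simp add: of_rat_diff algebra_simps)
    then obtain u v where uv: "x = of_rat u + of_rat v * \<theta>"
      by blast
    define D where "D = u ^ 2 - u * v + v ^ 2"
    have "D \<noteq> 0"
    proof
      assume "D = 0"
      then have "(2 * u - v) ^ 2 + 3 * v ^ 2 = 0"
        by (simp add: D_def power2_eq_square algebra_simps)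
      moreover have "(2 * u - v) ^ 2 \<ge> 0" "v ^ 2 \<ge> 0"
        by simp_all
      ultimately have "v ^ 2 = 0" "(2 * u - v) ^ 2 = 0"
        by linarith+
      then show False
        using x(2) uv by simp
    qed
    have "x * (of_rat (u - v) - of_rat v * \<theta>) = of_rat (u ^ 2 - u * v) - of_rat (v ^ 2) * (\<theta> + \<theta> ^ 2)"
      unfolding uv by (simp add: of_rat_diff of_rat_mult of_rat_power power2_eq_square algebra_simps)
    also have "\<dots> = of_rat D"
      unfolding quad D_def by (simp add: of_rat_diff of_rat_add)
    finally have "inverse x = (of_rat (u - v) - of_rat v * \<theta>) / of_rat D"
      using x(2) \<open>D \<noteq> 0\<close> by (simp add: field_simps)
    then show ?thesis
      by (intro cubic_spanI[of _ "(u - v) / D" "- v / D" _ 0])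
        (simp add: of_rat_divide of_rat_minus of_rat_diff diff_divide_distrib)
  qed
  then have "generate_field ring_of_type_algebra (\<rat> \<union> {\<theta>}) = cubic_span \<theta>"
    using \<theta> by (intro generate_field_cubic_span[of \<theta> 1]) (auto intro: cubic_spanI[of _ 0 1 _ 0])
  then show ?thesis
    by simp
qed

lemma cube_root_irrational:
  fixes \<gamma> :: complex
  assumes \<gamma>: "\<gamma> ^ 3 = of_rat n" and n: "\<And>r. r ^ 3 \<noteq> n"
  shows "\<gamma> \<noteq> of_rat q"
proof
  assume "\<gamma> = of_rat q"
  then have "(of_rat (q ^ 3) :: complex) = of_rat n"
    using \<gamma> by (simp add: of_rat_power)
  then show False
    using n by (simp only: of_rat_eq_iff)
qed

lemma cube_root_linear_independent:
  fixes \<gamma> :: complex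
  assumes \<gamma>: "\<gamma> ^ 3 = of_rat n" and n: "\<And>r. r ^ 3 \<noteq> n" and eq: "of_rat u + of_rat v * \<gamma> = 0"
  shows "u = 0 \<and> v = 0"
proof -
  have "v = 0"
  proof (rule ccontr)
    assume v: "v \<noteq> 0"
    then have "\<gamma> = of_rat (- u / v)"
      using eq by (simp add: of_rat_divide of_rat_minus field_simps eq_neg_iff_add_eq_0)
    then show False
      using cube_root_irrational[OF \<gamma> n] by blast
  qed
  then show ?thesis
    using eq by simp
qed

text \<open>If \<open>\<gamma>\<^sup>2 = s + t\<gamma>\<close>, then comparing \<open>\<gamma>\<^sup>3 = n\<close> with \<open>st + (s + t\<^sup>2)\<gamma>\<close> gives \<open>s = -t\<^sup>2\<close> and \<open>n = (-t)\<^sup>3\<close>.\<close>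

lemma cube_root_independent:
  fixes \<gamma> :: complex
  assumes \<gamma>: "\<gamma> ^ 3 = of_rat n" and n: "\<And>r. r ^ 3 \<noteq> n"
    and eq: "of_rat u + of_rat v * \<gamma> + of_rat w * \<gamma> ^ 2 = 0"
  shows "u = 0 \<and> v = 0 \<and> w = 0"
proof -
  have "w = 0"
  proof (rule ccontr)
    assume w: "w \<noteq> 0"
    define s t where "s = - u / w" and "t = - v / w"
    have quad: "\<gamma> ^ 2 = of_rat s + of_rat t * \<gamma>"
    proof -
      have "of_rat w * \<gamma> ^ 2 = - of_rat u - of_rat v * \<gamma>"
        using eq by (simp add: algebra_simps eq_neg_iff_add_eq_0)
      then have "\<gamma> ^ 2 = (- of_rat u - of_rat v * \<gamma>) / of_rat w"
        using w by (simp add: field_simps)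
      then show ?thesis
        by (simp add: s_def t_def of_rat_divide of_rat_minus diff_divide_distrib)
    qed
    have "of_rat n = \<gamma> * \<gamma> ^ 2"
      using \<gamma> by (simp add: power2_eq_square power3_eq_cube mult.assoc)
    also have "\<dots> = of_rat s * \<gamma> + of_rat t * \<gamma> ^ 2"
      by (subst quad) (simp add: algebra_simps power2_eq_square)
    also have "\<dots> = of_rat (s + t ^ 2) * \<gamma> + of_rat (s * t)"
      unfolding quad by (simp add: algebra_simps of_rat_add of_rat_mult of_rat_power power2_eq_square)
    finally have "of_rat (s * t - n) + of_rat (s + t ^ 2) * \<gamma> = 0"
      by (simp add: of_rat_diff)
    then have "s * t - n = 0 \<and> s + t ^ 2 = 0"
      by (rule cube_root_linear_independent[OF \<gamma> n])
    then have "s * t = n" "s = - (t ^ 2)"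
      by (auto simp: eq_neg_iff_add_eq_0)
    then have "(- t) ^ 3 = n"
      by (simp add: power2_eq_square power3_eq_cube)
    then show False
      using n by blast
  qed
  then show ?thesis
    using eq cube_root_linear_independent[OF \<gamma> n, of u v] by simp
qed

text \<open>The inverse of \<open>u + v\<gamma> + w\<gamma>\<^sup>2\<close> is its adjugate divided by its norm.\<close>

lemma rat_adjoin_cube_root:
  assumes \<gamma>: "\<gamma> ^ 3 = of_rat n" and n: "\<And>r. r ^ 3 \<noteq> n"
  shows "carrier (rat_adjoin {\<gamma>}) = cubic_span \<gamma>"
proof -
  have "inverse x \<in> cubic_span \<gamma>" if x: "x \<in> cubic_span \<gamma>" "x \<noteq> 0" for x
  proof -
    obtain u v w where uvw: "x = of_rat u + of_rat v * \<gamma> + of_rat w * \<gamma> ^ 2"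
      using x by (auto simp: cubic_span_def)
    define u' v' w' where "u' = u ^ 2 - n * v * w" and "v' = n * w ^ 2 - u * v" and "w' = v ^ 2 - u * w"
    define y where "y = of_rat u' + of_rat v' * \<gamma> + of_rat w' * \<gamma> ^ 2"
    \<comment> \<open>the norm of \<open>x\<close>, with \<open>y\<close> the product of the other conjugates\<close>
    define N where "N = u ^ 3 + n * v ^ 3 + n ^ 2 * w ^ 3 - 3 * n * u * v * w"
    have "x * y = of_rat u * of_rat u' + of_rat (v * w' + w * v') * \<gamma> ^ 3 +
        (of_rat u * of_rat v' + of_rat v * of_rat u' + of_rat (w * w') * \<gamma> ^ 3) * \<gamma> +
        of_rat (u * w' + v * v' + w * u') * \<gamma> ^ 2"
      unfolding uvw y_def by (simp add: of_rat_add of_rat_mult algebra_simps power2_eq_square power3_eq_cube)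
    also have "\<dots> = of_rat (u * u' + (v * w' + w * v') * n) + of_rat (u * v' + v * u' + w * w' * n) * \<gamma> +
        of_rat (u * w' + v * v' + w * u') * \<gamma> ^ 2"
      unfolding \<gamma> by (simp add: of_rat_add of_rat_mult)
    also have "u * u' + (v * w' + w * v') * n = N"
      by (simp add: u'_def v'_def w'_def N_def algebra_simps power2_eq_square power3_eq_cube)
    also have "u * v' + v * u' + w * w' * n = 0"
      by (simp add: u'_def v'_def w'_def algebra_simps power2_eq_square)
    also have "u * w' + v * v' + w * u' = 0"
      by (simp add: u'_def v'_def w'_def algebra_simps power2_eq_square)
    finally have xy: "x * y = of_rat N"
      by simp
    have "N \<noteq> 0"
    proof
      assume "N = 0"
      then have "y = 0"
        using xy x(2) by simp
      then have "u' = 0 \<and> v' = 0 \<and> w' = 0"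
        unfolding y_def by (rule cube_root_independent[OF \<gamma> n])
      then have rel: "u ^ 2 = n * v * w" "n * w ^ 2 = u * v" "v ^ 2 = u * w"
        by (auto simp: u'_def v'_def w'_def)
      have n0: "n \<noteq> 0"
        using n[of 0] by simp
      show False
      proof (cases "u = 0")
        case True
        then show False
          using rel n0 x(2) uvw by simp
      next
        case False
        \<comment> \<open>a vanishing norm makes \<open>n\<close> the cube of \<open>u / v\<close>\<close>
        have "n * v ^ 3 = u ^ 3"
        proof -
          have "u * (n * v ^ 3) = n * v * (u * v ^ 2)"
            by (simp add: power2_eq_square power3_eq_cube)
          also have "\<dots> = n * v * w * u ^ 2"
            unfolding rel(3) by (simp add: power2_eq_square)
          also have "\<dots> = u * u ^ 3"
            unfolding rel(1)[symmetric] by (simp add: power2_eq_square power3_eq_cube)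
          finally show ?thesis
            using False by simp
        qed
        moreover have "v \<noteq> 0"
          using rel(1) False by auto
        ultimately have "(u / v) ^ 3 = n"
          by (simp add: power_divide field_simps)
        then show False
          using n by blast
      qed
    qed
    then have "inverse x = y / of_rat N"
      using x(2) xy by (simp add: field_simps)
    then show ?thesis
      by (intro cubic_spanI[of _ "u' / N" "v' / N" _ "w' / N"])
        (simp add: y_def of_rat_divide add_divide_distrib)
  qed
  then have "generate_field ring_of_type_algebra (\<rat> \<union> {\<gamma>}) = cubic_span \<gamma>"
    using \<gamma> by (intro generate_field_cubic_span[of \<gamma> n]) (auto intro: cubic_spanI[of _ 0 1 _ 0])
  then show ?thesis
    by simp
qed

subsection \<open>Homomorphisms and cube roots\<close>

context rat_field_algebra
begin

text \<open>The cube roots of \<open>n\<close> in \<open>K\<close>.\<close>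

definition cube_roots :: "rat \<Rightarrow> 'b set" where
  "cube_roots n = {r \<in> carrier K. r \<otimes> (r \<otimes> r) = n \<odot> \<one>}"

lemma cubic_images_subset: "cubic_images \<alpha> n \<subseteq> cube_roots n"
  by (auto simp: cubic_images_def cube_roots_def)

lemma cubic_images_one: "cubic_images 1 1 = {\<one>}"
proof (intro equalityI subsetI)
  fix r assume "r \<in> cubic_images 1 1"
  then have "r \<in> carrier K" "cval r (- 1) 1 0 = \<zero>"
    by (auto simp: cubic_images_def of_rat_minus)
  then show "r \<in> {\<one>}"
    using K.minus_equality[of r "\<ominus> \<one>"] by (simp add: cval_def smult_minus K.M.a_comm)
next
  fix r assume r: "r \<in> {\<one>}"
  have "cval \<one> u v w = \<zero>" if "of_rat u + of_rat v * 1 + of_rat w * 1 ^ 2 = (0 :: complex)" for u v w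
  proof -
    have "(of_rat (u + (v + w)) :: complex) = of_rat 0"
      using that by (simp add: of_rat_add add.assoc)
    then have "u + (v + w) = 0"
      by (simp only: of_rat_eq_iff)
    moreover have "cval \<one> u v w = (u + (v + w)) \<odot> \<one>"
      by (simp add: cval_def smult_ops)
    ultimately show ?thesis
      by simp
  qed
  then show "r \<in> cubic_images 1 1"
    using r by (simp add: cubic_images_def)
qed

text \<open>The relations between \<open>1, \<theta>, \<theta>\<^sup>2\<close> are the multiples of \<open>1 + \<theta> + \<theta>\<^sup>2 = 0\<close>, so the images of \<open>\<theta>\<close> are the primitive
  cube roots of unity in \<open>K\<close>.\<close>

lemma cubic_images_primitive_root:
  assumes \<theta>: "\<theta> ^ 3 = 1" "\<theta> \<noteq> 1"
  shows "cubic_images \<theta> 1 = cube_roots 1 - {\<one>}"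
proof (intro equalityI subsetI)
  note quad = primitive_root_quadratic[OF \<theta>]
  fix r assume r: "r \<in> cubic_images \<theta> 1"
  have "of_rat 1 + of_rat 1 * \<theta> + of_rat 1 * \<theta> ^ 2 = 0"
    unfolding quad by simp
  then have "cval r 1 1 1 = \<zero>"
    using r unfolding cubic_images_def by blast
  then have "r \<noteq> \<one>"
    using three_nonzero by (auto simp: cval_def K.M.a_assoc)
  then show "r \<in> cube_roots 1 - {\<one>}"
    using r by (auto simp: cubic_images_def cube_roots_def)
next
  note quad = primitive_root_quadratic[OF \<theta>]
  fix r assume "r \<in> cube_roots 1 - {\<one>}"
  then have r: "r \<in> carrier K" "r \<otimes> (r \<otimes> r) = \<one>" "r \<noteq> \<one>"
    by (auto simp: cube_roots_def)
  have "(r \<ominus> \<one>) \<otimes> (\<one> \<oplus> (r \<oplus> r \<otimes> r)) = r \<otimes> (r \<otimes> r) \<ominus> \<one>"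
    using r(1) by (simp add: K.minus_eq K.l_distr K.r_distr K.l_minus K.M.a_ac K.r_neg K.r_neg1 K.r_neg2)
  also have "\<dots> = \<zero>"
    using r by (simp add: K.minus_eq K.r_neg)
  finally have "\<one> \<oplus> (r \<oplus> r \<otimes> r) = \<zero>"
    using r K_field.integral[of "r \<ominus> \<one>" "\<one> \<oplus> (r \<oplus> r \<otimes> r)"] by auto
  have "cval r u v w = \<zero>" if "of_rat u + of_rat v * \<theta> + of_rat w * \<theta> ^ 2 = 0" for u v w
  proof -
    have "of_rat (u - w) + of_rat (v - w) * \<theta> = 0"
      using that unfolding quad by (simp add: of_rat_diff algebra_simps)
    then have "u - w = 0 \<and> v - w = 0"
      by (rule primitive_root_independent[OF \<theta>])
    then have "cval r u v w = w \<odot> (\<one> \<oplus> (r \<oplus> r \<otimes> r))"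
      using r(1) by (simp add: cval_def smult_ops)
    also have "\<dots> = \<zero>"
      unfolding \<open>\<one> \<oplus> (r \<oplus> r \<otimes> r) = \<zero>\<close> using K.smult_r_null[of w] by simp
    finally show ?thesis .
  qed
  then show "r \<in> cubic_images \<theta> 1"
    using r by (simp add: cubic_images_def)
qed

lemma cubic_images_cube_root:
  assumes \<gamma>: "\<gamma> ^ 3 = of_rat n" and n: "\<And>r. r ^ 3 \<noteq> n"
  shows "cubic_images \<gamma> n = cube_roots n"
proof -
  have "cval r u v w = \<zero>"
    if "r \<in> carrier K" "of_rat u + of_rat v * \<gamma> + of_rat w * \<gamma> ^ 2 = 0" for r u v w
    using cube_root_independent[OF \<gamma> n that(2)] that(1) by (simp add: cval_def)
  then show ?thesis
    unfolding cubic_images_def cube_roots_def by blast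
qed

lemma cube_roots_scale:
  assumes s: "s \<noteq> 0"
  shows "bij_betw (\<lambda>r. s \<odot> r) (cube_roots 1) (cube_roots (s ^ 3))"
proof -
  have cube: "(q \<odot> r) \<otimes> ((q \<odot> r) \<otimes> (q \<odot> r)) = q ^ 3 \<odot> (r \<otimes> (r \<otimes> r))" if "r \<in> carrier K" for q r
    using that by (simp add: smult_ops power3_eq_cube)
  show ?thesis
  proof (rule bij_betw_byWitness[where f' = "\<lambda>r. inverse s \<odot> r"])
    show "\<forall>r\<in>cube_roots 1. inverse s \<odot> (s \<odot> r) = r"
      using s by (auto simp: cube_roots_def smult_ops(3)[symmetric])
    show "\<forall>r\<in>cube_roots (s ^ 3). s \<odot> (inverse s \<odot> r) = r"
      using s by (auto simp: cube_roots_def smult_ops(3)[symmetric])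
    show "(\<odot>) s ` cube_roots 1 \<subseteq> cube_roots (s ^ 3)"
      by (auto simp: cube_roots_def cube)
    show "(\<odot>) (inverse s) ` cube_roots (s ^ 3) \<subseteq> cube_roots 1"
      using s by (auto simp: cube_roots_def cube smult_ops(3)[symmetric] power_mult_distrib[symmetric])
  qed
qed

text \<open>If \<open>n\<close> is a rational cube, then \<open>K\<close> contains as many cube roots of \<open>n\<close> as of \<open>1\<close>; the root \<open>1\<close> is counted by
  the factor \<open>\<rat>\<close> and the other ones by \<open>\<rat>(\<theta>)\<close>.\<close>

theorem card_alg_homs_cube_root_algebra:
  assumes \<theta>: "\<theta> ^ 3 = 1" "\<theta> \<noteq> 1" and n: "n \<noteq> 0" and \<gamma>: "\<gamma> ^ 3 = of_rat n" and fin: "finite (cube_roots n)"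
  shows "cubic_split rat_ring K (cube_root_algebra \<theta> n \<gamma>)"
    and "card (alg_homs rat_ring (cube_root_algebra \<theta> n \<gamma>) K) = card (cube_roots n)"
proof -
  have KA: "algebra rat_ring K" "Ring.field K"
    by unfold_locales
  have "cubic_split rat_ring K (cube_root_algebra \<theta> n \<gamma>) \<and>
      card (alg_homs rat_ring (cube_root_algebra \<theta> n \<gamma>) K) = card (cube_roots n)"
  proof (cases "\<exists>r. r ^ 3 = n")
    case True
    then obtain s where s: "s ^ 3 = n"
      by blast
    then have bij: "bij_betw (\<lambda>r. s \<odot> r) (cube_roots 1) (cube_roots n)"
      using cube_roots_scale[of s] n by auto
    then have fin1: "finite (cube_roots 1)"
      using fin bij_betw_finite by blast
    have one: "\<one> \<in> cube_roots 1"
      by (simp add: cube_roots_def)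
    have fin\<theta>: "finite (cubic_images \<theta> 1)" and fino: "finite (cubic_images 1 1)"
      using fin1 cubic_images_subset finite_subset by metis+
    have t3: "\<theta> ^ 3 = of_rat 1" and o3: "(1 :: complex) ^ 3 = of_rat 1"
      using \<theta> by simp_all
    note A\<theta> = cubic_split_rat_adjoin[OF rat_adjoin_primitive_root[OF \<theta>] t3 _ fin\<theta>]
    note Ao = cubic_split_rat_adjoin[OF rat_adjoin_empty o3 _ fino]
    have split: "cubic_split rat_ring K A" if "A \<in> set [rat_adjoin {\<theta>}, rat_adjoin {}]" for A
      using that A\<theta>(1) Ao(1) by auto
    have "card (alg_homs rat_ring (alg_prod [rat_adjoin {\<theta>}, rat_adjoin {}]) K) =
        card (cube_roots 1 - {\<one>}) + 1"
      using cubic_split_alg_prod(2)[OF KA, of "[rat_adjoin {\<theta>}, rat_adjoin {}]"] split A\<theta>(2) Ao(2)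
      by (simp add: cubic_images_one cubic_images_primitive_root[OF \<theta>])
    also have "\<dots> = card (cube_roots 1)"
      using card_Suc_Diff1[OF fin1 one] by simp
    also have "\<dots> = card (cube_roots n)"
      by (rule bij_betw_same_card[OF bij])
    finally show ?thesis
      using cubic_split_alg_prod(1)[OF KA, of "[rat_adjoin {\<theta>}, rat_adjoin {}]"] split True by (simp add: cube_root_algebra_def)
  next
    case False
    then have nc: "\<And>r. r ^ 3 \<noteq> n"
      by blast
    have fin\<gamma>: "finite (cubic_images \<gamma> n)"
      unfolding cubic_images_cube_root[OF \<gamma> nc] by (rule fin)
    note A\<gamma> = cubic_split_rat_adjoin[OF rat_adjoin_cube_root[OF \<gamma> nc] \<gamma> n fin\<gamma>]
    have split: "cubic_split rat_ring K A" if "A \<in> set [rat_adjoin {\<gamma>}]" for A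
      using that A\<gamma>(1) by auto
    have "card (alg_homs rat_ring (alg_prod [rat_adjoin {\<gamma>}]) K) = card (cube_roots n)"
      using cubic_split_alg_prod(2)[OF KA, of "[rat_adjoin {\<gamma>}]"] split A\<gamma>(2) by (simp add: cubic_images_cube_root[OF \<gamma> nc])
    then show ?thesis
      using cubic_split_alg_prod(1)[OF KA, of "[rat_adjoin {\<gamma>}]"] split False by (simp add: cube_root_algebra_def)
  qed
  then show "cubic_split rat_ring K (cube_root_algebra \<theta> n \<gamma>)"
    and "card (alg_homs rat_ring (cube_root_algebra \<theta> n \<gamma>) K) = card (cube_roots n)"
    by blast+
qed

end

section \<open>The field of p-adic numbers\<close>

locale padic =
  fixes p :: nat
  assumes p_prime: "Factorial_Ring.prime p"
begin

abbreviation "pabs \<equiv> padic_abs p"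
abbreviation "C \<equiv> padic_Cauchy_ring p"
abbreviation "N \<equiv> padic_null p"
abbreviation "Qp \<equiv> padic_field p"

lemma p_prime_int: "Factorial_Ring.prime (int p)"
  using p_prime by simp

lemma p_gt_1: "real p > 1"
  using prime_gt_1_nat[OF p_prime] by simp

lemma mult_mult:
  "a \<noteq> 0 \<Longrightarrow> b \<noteq> 0 \<Longrightarrow> multiplicity (int p) (a * b) = multiplicity (int p) a + multiplicity (int p) b"
  by (rule prime_elem_multiplicity_mult_distrib) (use p_prime_int in auto)

text \<open>The absolute value may be computed from any fraction, reduced or not.\<close>

lemma pabs_frac:
  assumes "a \<noteq> 0" "b \<noteq> 0"
  shows "pabs (of_int a / of_int b) = real p powi (int (multiplicity (int p) b) - int (multiplicity (int p) a))"
proof -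
  let ?x = "of_int a / of_int b :: rat"
  obtain c d where cd: "quotient_of ?x = (c, d)"
    by fastforce
  have d: "d > 0" "?x = of_int c / of_int d"
    using quotient_of_denom_pos[OF cd] quotient_of_div[OF cd] by auto
  have c: "c \<noteq> 0"
    using d assms by auto
  have "(of_int (a * d) :: rat) = of_int (c * b)"
    using d assms by (simp add: field_simps)
  then have "a * d = c * b"
    by (simp only: of_int_eq_iff)
  then have "multiplicity (int p) a + multiplicity (int p) d = multiplicity (int p) c + multiplicity (int p) b"
    using mult_mult[of a d] mult_mult[of c b] assms c d by simp
  then have "int (multiplicity (int p) d) - int (multiplicity (int p) c) =
      int (multiplicity (int p) b) - int (multiplicity (int p) a)"
    by linarith
  then show ?thesis
    using assms by (simp add: padic_abs_def cd)
qed

lemma rat_frac: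
  fixes x :: rat
  obtains a b :: int where "x = of_int a / of_int b" "b \<noteq> 0"
  by (cases "quotient_of x") (metis quotient_of_denom_pos quotient_of_div less_irrefl)

lemma pabs_zero [simp]: "pabs 0 = 0"
  by (simp add: padic_abs_def)

lemma pabs_pos: "x \<noteq> 0 \<Longrightarrow> pabs x > 0"
  using p_gt_1 by (auto simp: padic_abs_def)

lemma pabs_nonneg [simp]: "pabs x \<ge> 0"
  using pabs_pos[of x] by (cases "x = 0") auto

lemma pabs_mult: "pabs (x * y) = pabs x * pabs y"
proof (cases "x = 0 \<or> y = 0")
  case False
  obtain a b c d where ab: "x = of_int a / of_int b" "b \<noteq> 0" and cd: "y = of_int c / of_int d" "d \<noteq> 0"
    using rat_frac[of x] rat_frac[of y] by metis
  then have nz: "a \<noteq> 0" "c \<noteq> 0"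
    using False by auto
  have "pabs (x * y) = pabs (of_int (a * c) / of_int (b * d))"
    unfolding ab cd by simp
  also have "\<dots> = real p powi ((int (multiplicity (int p) b) - int (multiplicity (int p) a)) +
      (int (multiplicity (int p) d) - int (multiplicity (int p) c)))"
    using ab(2) cd(2) nz by (subst pabs_frac) (auto simp: mult_mult algebra_simps)
  also have "\<dots> = pabs x * pabs y"
    unfolding ab cd using ab(2) cd(2) nz p_gt_1 by (subst power_int_add) (auto simp: pabs_frac)
  finally show ?thesis .
qed auto

lemma pabs_one [simp]: "pabs 1 = 1"
  using pabs_frac[of 1 1] by simp

lemma pabs_minus: "pabs (- x) = pabs x"
proof -
  have "pabs (- 1) * pabs (- 1) = 1"
    using pabs_mult[of "- 1" "- 1"] by simp
  then have "pabs (- 1) = 1"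
    using pabs_nonneg[of "- 1"] by (metis abs_of_nonneg abs_square_eq_1 power2_eq_square)
  then show ?thesis
    using pabs_mult[of "- 1" x] by simp
qed

lemma pabs_inverse: "pabs (inverse x) = inverse (pabs x)"
proof (cases "x = 0")
  case False
  then have "pabs x * pabs (inverse x) = 1"
    using pabs_mult[of x "inverse x"] by simp
  then show ?thesis
    by (metis inverse_unique)
qed auto

lemma pabs_add: "pabs (x + y) \<le> max (pabs x) (pabs y)"
proof (cases "x = 0 \<or> y = 0 \<or> x + y = 0")
  case False
  obtain a b c d where ab: "x = of_int a / of_int b" "b \<noteq> 0" and cd: "y = of_int c / of_int d" "d \<noteq> 0"
    using rat_frac[of x] rat_frac[of y] by metis
  define e f g where "e = a * d" and "f = c * b" and "g = b * d"
  have x: "x = of_int e / of_int g" and y: "y = of_int f / of_int g"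
    using ab cd by (auto simp: e_def f_def g_def)
  have xy: "x + y = of_int (e + f) / of_int g"
    unfolding x y by (simp add: add_divide_distrib)
  have nz: "e \<noteq> 0" "f \<noteq> 0" "g \<noteq> 0" "e + f \<noteq> 0"
    using False x y xy ab cd by (auto simp: g_def)
  let ?m = "min (multiplicity (int p) e) (multiplicity (int p) f)"
  have "int p ^ ?m dvd e" "int p ^ ?m dvd f"
    by (simp_all add: multiplicity_dvd')
  then have "int p ^ ?m dvd e + f"
    by simp
  then have le: "?m \<le> multiplicity (int p) (e + f)"
    using nz p_prime_int by (intro multiplicity_geI) (auto simp: not_prime_unit)
  have "pabs (x + y) \<le> real p powi (int (multiplicity (int p) g) - int ?m)"
    unfolding xy pabs_frac[OF nz(4,3)] using le p_gt_1 by (intro power_int_increasing) auto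
  also have "\<dots> \<le> max (pabs x) (pabs y)"
    unfolding x y pabs_frac[OF nz(1,3)] pabs_frac[OF nz(2,3)] by (auto simp: min_def)
  finally show ?thesis .
qed (auto simp: max_def)

lemma pabs_diff: "pabs (x - y) \<le> max (pabs x) (pabs y)"
  using pabs_add[of x "- y"] by (simp add: pabs_minus)

lemma pabs_diff_commute: "pabs (x - y) = pabs (y - x)"
  using pabs_minus[of "x - y"] by simp

lemma pabs_diff_trans: "pabs (x - z) \<le> max (pabs (x - y)) (pabs (y - z))"
  using pabs_add[of "x - y" "y - z"] by simp

lemma pabs_int_dvd:
  assumes "int p ^ m dvd z" shows "pabs (of_int z) \<le> (1 / real p) ^ m"
proof (cases "z = 0")
  case False
  have "m \<le> multiplicity (int p) z"
    using assms False p_prime_int by (intro multiplicity_geI) (auto simp: not_prime_unit)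
  then have "real p powi (- int (multiplicity (int p) z)) \<le> real p powi (- int m)"
    using p_gt_1 by (intro power_int_increasing) auto
  then show ?thesis
    using pabs_frac[of z 1] False by (simp add: power_int_minus power_inverse divide_inverse)
qed (use p_gt_1 in auto)

lemma pabs_int_le: "pabs (of_int z) \<le> 1"
  using pabs_int_dvd[of 0 z] by simp

lemma pabs_int_lt_iff: "pabs (of_int z) < 1 \<longleftrightarrow> int p dvd z"
proof
  assume "int p dvd z"
  then have "pabs (of_int z) \<le> 1 / real p"
    using pabs_int_dvd[of 1 z] by simp
  also have "\<dots> < 1"
    using p_gt_1 by simp
  finally show "pabs (of_int z) < 1" .
next
  assume "pabs (of_int z) < 1"
  then show "int p dvd z"
    using pabs_frac[of z 1] not_dvd_imp_multiplicity_0[of "int p" z]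
    by (cases "z = 0"; cases "int p dvd z") auto
qed

lemma pabs_int_unit: "\<not> int p dvd z \<Longrightarrow> pabs (of_int z) = 1"
  using pabs_int_lt_iff[of z] pabs_int_le[of z] by linarith

subsection \<open>Cauchy sequences\<close>

lemma Cauchy_carrier:
  "x \<in> carrier C \<longleftrightarrow> (\<forall>\<epsilon>>0. \<exists>M. \<forall>m\<ge>M. \<forall>n\<ge>M. pabs (x m - x n) < \<epsilon>)"
  by (simp add: padic_Cauchy_ring_def)

lemma Cauchy_simps [simp]:
  "x \<otimes>\<^bsub>C\<^esub> y = (\<lambda>n. x n * y n)" "x \<oplus>\<^bsub>C\<^esub> y = (\<lambda>n. x n + y n)" "\<one>\<^bsub>C\<^esub> = (\<lambda>n. 1)" "\<zero>\<^bsub>C\<^esub> = (\<lambda>n. 0)"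
  by (simp_all add: padic_Cauchy_ring_def)

lemma null_iff: "x \<in> N \<longleftrightarrow> (\<forall>\<epsilon>>0. \<exists>M. \<forall>n\<ge>M. pabs (x n) < \<epsilon>)"
  by (simp add: padic_null_def LIMSEQ_iff)

lemma Cauchy_const: "(\<lambda>n. q) \<in> carrier C"
  by (simp add: Cauchy_carrier)

lemma Cauchy_bounded:
  assumes "x \<in> carrier C"
  obtains D M where "D > 0" "\<And>n. n \<ge> M \<Longrightarrow> pabs (x n) \<le> D"
proof -
  obtain M where M: "\<forall>m\<ge>M. \<forall>n\<ge>M. pabs (x m - x n) < 1"
    using assms unfolding Cauchy_carrier by (meson zero_less_one)
  have "pabs (x n) \<le> max 1 (pabs (x M))" if "n \<ge> M" for n
    using pabs_add[of "x n - x M" "x M"] M[rule_format, OF that order_refl] by auto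
  then show thesis
    using that[of "max 1 (pabs (x M))" M] by auto
qed

lemma null_imp_Cauchy: "x \<in> N \<Longrightarrow> x \<in> carrier C"
  unfolding null_iff Cauchy_carrier by (meson le_less_trans max_less_iff_conj pabs_diff)

lemma Cauchy_add:
  assumes "x \<in> carrier C" "y \<in> carrier C" shows "(\<lambda>n. x n + y n) \<in> carrier C"
  unfolding Cauchy_carrier
proof (intro allI impI)
  fix \<epsilon> :: real assume "\<epsilon> > 0"
  then obtain M M' where M: "\<forall>m\<ge>M. \<forall>n\<ge>M. pabs (x m - x n) < \<epsilon>" "\<forall>m\<ge>M'. \<forall>n\<ge>M'. pabs (y m - y n) < \<epsilon>"
    using assms unfolding Cauchy_carrier by meson
  have "pabs (x m + y m - (x n + y n)) < \<epsilon>" if "m \<ge> max M M'" "n \<ge> max M M'" for m n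
  proof -
    have "x m + y m - (x n + y n) = (x m - x n) + (y m - y n)"
      by simp
    then show ?thesis
      using pabs_add[of "x m - x n" "y m - y n"] M that by (metis le_less_trans max.bounded_iff max_less_iff_conj)
  qed
  then show "\<exists>M. \<forall>m\<ge>M. \<forall>n\<ge>M. pabs (x m + y m - (x n + y n)) < \<epsilon>"
    by blast
qed

lemma Cauchy_minus: "x \<in> carrier C \<Longrightarrow> (\<lambda>n. - x n) \<in> carrier C"
  unfolding Cauchy_carrier using pabs_diff_commute by simp

lemma Cauchy_mult:
  assumes "x \<in> carrier C" "y \<in> carrier C" shows "(\<lambda>n. x n * y n) \<in> carrier C"
  unfolding Cauchy_carrier
proof (intro allI impI)
  fix \<epsilon> :: real assume \<epsilon>: "\<epsilon> > 0"
  obtain D M1 where D: "D > 0" "\<And>n. n \<ge> M1 \<Longrightarrow> pabs (x n) \<le> D"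
    using Cauchy_bounded[OF assms(1)] by blast
  obtain D' M2 where D': "D' > 0" "\<And>n. n \<ge> M2 \<Longrightarrow> pabs (y n) \<le> D'"
    using Cauchy_bounded[OF assms(2)] by blast
  have "\<epsilon> / D' > 0" "\<epsilon> / D > 0"
    using \<epsilon> D D' by auto
  then obtain M M' where M: "\<forall>m\<ge>M. \<forall>n\<ge>M. pabs (x m - x n) < \<epsilon> / D'" "\<forall>m\<ge>M'. \<forall>n\<ge>M'. pabs (y m - y n) < \<epsilon> / D"
    using assms unfolding Cauchy_carrier by meson
  define M0 where "M0 = max (max M1 M2) (max M M')"
  have "pabs (x m * y m - x n * y n) < \<epsilon>" if "m \<ge> M0" "n \<ge> M0" for m n
  proof -
    have 1: "pabs (x m * (y m - y n)) < \<epsilon>"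
    proof -
      have "pabs (x m * (y m - y n)) \<le> D * pabs (y m - y n)"
        unfolding pabs_mult using that D by (intro mult_right_mono) (auto simp: M0_def)
      also have "\<dots> < \<epsilon>"
        using that M D by (auto simp: M0_def field_simps)
      finally show ?thesis .
    qed
    have 2: "pabs ((x m - x n) * y n) < \<epsilon>"
    proof -
      have "pabs ((x m - x n) * y n) \<le> pabs (x m - x n) * D'"
        unfolding pabs_mult using that D' by (intro mult_left_mono) (auto simp: M0_def)
      also have "\<dots> < \<epsilon>"
        using that M D' by (auto simp: M0_def field_simps)
      finally show ?thesis .
    qed
    have "x m * y m - x n * y n = x m * (y m - y n) + (x m - x n) * y n"
      by (simp add: algebra_simps)
    then show ?thesis
      using pabs_add[of "x m * (y m - y n)" "(x m - x n) * y n"] 1 2 by (metis le_less_trans max_less_iff_conj)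
  qed
  then show "\<exists>M. \<forall>m\<ge>M. \<forall>n\<ge>M. pabs (x m * y m - x n * y n) < \<epsilon>"
    by blast
qed

lemma Cauchy_cring: "cring C"
proof (intro cringI abelian_groupI comm_monoidI)
  show "\<exists>y\<in>carrier C. y \<oplus>\<^bsub>C\<^esub> x = \<zero>\<^bsub>C\<^esub>" if "x \<in> carrier C" for x
    using Cauchy_minus[OF that] by (intro bexI[of _ "\<lambda>n. - x n"]) auto
qed (auto simp: Cauchy_const Cauchy_add Cauchy_mult algebra_simps)

sublocale C: cring C
  by (rule Cauchy_cring)

lemma null_add:
  assumes "x \<in> N" "y \<in> N" shows "(\<lambda>n. x n + y n) \<in> N"
  unfolding null_iff
proof (intro allI impI)
  fix \<epsilon> :: real assume "\<epsilon> > 0"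
  then obtain M M' where M: "\<forall>n\<ge>M. pabs (x n) < \<epsilon>" "\<forall>n\<ge>M'. pabs (y n) < \<epsilon>"
    using assms unfolding null_iff by meson
  have "pabs (x n + y n) < \<epsilon>" if "n \<ge> max M M'" for n
    using pabs_add[of "x n" "y n"] M that by (metis le_less_trans max.bounded_iff max_less_iff_conj)
  then show "\<exists>M. \<forall>n\<ge>M. pabs (x n + y n) < \<epsilon>"
    by blast
qed

lemma null_mult:
  assumes "x \<in> carrier C" "y \<in> N" shows "(\<lambda>n. x n * y n) \<in> N"
  unfolding null_iff
proof (intro allI impI)
  fix \<epsilon> :: real assume \<epsilon>: "\<epsilon> > 0"
  obtain D M1 where D: "D > 0" "\<And>n. n \<ge> M1 \<Longrightarrow> pabs (x n) \<le> D"
    using Cauchy_bounded[OF assms(1)] by blast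
  then have "\<epsilon> / D > 0"
    using \<epsilon> by auto
  then obtain M where M: "\<forall>n\<ge>M. pabs (y n) < \<epsilon> / D"
    using assms unfolding null_iff by meson
  have "pabs (x n * y n) < \<epsilon>" if "n \<ge> max M M1" for n
  proof -
    have "pabs (x n * y n) \<le> D * pabs (y n)"
      unfolding pabs_mult using that D by (intro mult_right_mono) auto
    also have "\<dots> < \<epsilon>"
      using that M D by (auto simp: field_simps)
    finally show ?thesis .
  qed
  then show "\<exists>M. \<forall>n\<ge>M. pabs (x n * y n) < \<epsilon>"
    by blast
qed

lemma Cauchy_a_inv: "x \<in> carrier C \<Longrightarrow> \<ominus>\<^bsub>C\<^esub> x = (\<lambda>n. - x n)"
  by (rule C.minus_equality) (auto simp: Cauchy_minus)

lemma null_ideal: "ideal N C"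
proof (rule idealI)
  show "ring C" ..
  show "subgroup N (add_monoid C)"
  proof (rule C.add.subgroupI)
    show "N \<subseteq> carrier C"
      using null_imp_Cauchy by blast
    show "N \<noteq> {}"
      using null_iff[of "\<lambda>n. 0"] by auto
    show "\<ominus>\<^bsub>C\<^esub> x \<in> N" if "x \<in> N" for x
      using that null_imp_Cauchy[OF that] by (simp add: Cauchy_a_inv padic_null_def pabs_minus)
    show "x \<oplus>\<^bsub>C\<^esub> y \<in> N" if "x \<in> N" "y \<in> N" for x y
      using null_add[OF that] by simp
  qed
  show "y \<otimes>\<^bsub>C\<^esub> x \<in> N" "x \<otimes>\<^bsub>C\<^esub> y \<in> N" if "x \<in> N" "y \<in> carrier C" for x y
    using null_mult[OF that(2,1)] by (simp_all add: mult.commute)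
qed

sublocale N: ideal N C
  by (rule null_ideal)

text \<open>The p-adic number represented by a Cauchy sequence.\<close>

abbreviation cls :: "(nat \<Rightarrow> rat) \<Rightarrow> (nat \<Rightarrow> rat) set" where
  "cls x \<equiv> N +>\<^bsub>C\<^esub> x"

lemma cls_eq_iff:
  assumes "x \<in> carrier C" "y \<in> carrier C"
  shows "cls x = cls y \<longleftrightarrow> (\<lambda>n. x n - y n) \<in> N"
proof -
  have "x \<ominus>\<^bsub>C\<^esub> y = (\<lambda>n. x n - y n)"
    using assms by (simp add: a_minus_def Cauchy_a_inv)
  then show ?thesis
    using C.quotient_eq_iff_same_a_r_cos[OF null_ideal assms] by simp
qed

lemma padic_field_simps [simp]:
  "carrier Qp = carrier (padic_ring p)"
  "x \<otimes>\<^bsub>Qp\<^esub> y = x \<otimes>\<^bsub>padic_ring p\<^esub> y"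
  "x \<oplus>\<^bsub>Qp\<^esub> y = x \<oplus>\<^bsub>padic_ring p\<^esub> y"
  "\<one>\<^bsub>Qp\<^esub> = \<one>\<^bsub>padic_ring p\<^esub>"
  "\<zero>\<^bsub>Qp\<^esub> = \<zero>\<^bsub>padic_ring p\<^esub>"
  "q \<odot>\<^bsub>Qp\<^esub> x = cls (\<lambda>n. q) \<otimes>\<^bsub>padic_ring p\<^esub> x"
  by (simp_all add: padic_field_def ring.defs)

lemma cls_hom:
  shows cls_closed: "x \<in> carrier C \<Longrightarrow> cls x \<in> carrier (padic_ring p)"
    and cls_mult: "x \<in> carrier C \<Longrightarrow> y \<in> carrier C \<Longrightarrow> cls x \<otimes>\<^bsub>padic_ring p\<^esub> cls y = cls (\<lambda>n. x n * y n)"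
    and cls_add: "x \<in> carrier C \<Longrightarrow> y \<in> carrier C \<Longrightarrow> cls x \<oplus>\<^bsub>padic_ring p\<^esub> cls y = cls (\<lambda>n. x n + y n)"
    and cls_one: "\<one>\<^bsub>padic_ring p\<^esub> = cls (\<lambda>n. 1)"
  using ring_hom_closed[OF N.rcos_ring_hom] ring_hom_mult[OF N.rcos_ring_hom]
    ring_hom_add[OF N.rcos_ring_hom] ring_hom_one[OF N.rcos_ring_hom]
  by (simp_all add: padic_ring_def)

lemma cls_zero: "\<zero>\<^bsub>padic_ring p\<^esub> = cls (\<lambda>n. 0)"
  using C.a_rcos_zero[OF null_ideal N.zero_closed] by (simp add: padic_ring_def FactRing_def)

lemma cls_cases:
  assumes "r \<in> carrier (padic_ring p)"
  obtains x where "x \<in> carrier C" "r = cls x"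
  using assms by (auto simp: padic_ring_def FactRing_def A_RCOSETS_def')

text \<open>By the ultrametric inequality a Cauchy sequence that is not null is bounded away from zero.\<close>

lemma nonnull_bounded_below:
  assumes x: "x \<in> carrier C" "x \<notin> N"
  obtains \<epsilon> M where "\<epsilon> > 0" "\<And>n. n \<ge> M \<Longrightarrow> pabs (x n) \<ge> \<epsilon>"
proof -
  obtain \<epsilon> where \<epsilon>: "\<epsilon> > 0" "\<And>M. \<exists>n\<ge>M. pabs (x n) \<ge> \<epsilon>"
    using x(2) unfolding null_iff by (meson not_le)
  obtain M where M: "\<forall>m\<ge>M. \<forall>n\<ge>M. pabs (x m - x n) < \<epsilon>"
    using x(1) \<epsilon>(1) unfolding Cauchy_carrier by meson
  obtain k where k: "k \<ge> M" "pabs (x k) \<ge> \<epsilon>"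
    using \<epsilon>(2) by blast
  have "pabs (x n) \<ge> \<epsilon>" if "n \<ge> M" for n
    using pabs_add[of "x k - x n" "x n"] M[rule_format, OF k(1) that] k(2) by auto
  then show thesis
    using that \<epsilon>(1) by blast
qed

lemma Cauchy_inverse:
  assumes x: "x \<in> carrier C" "x \<notin> N"
  shows "(\<lambda>n. inverse (x n)) \<in> carrier C" "(\<lambda>n. x n * inverse (x n) - 1) \<in> N"
proof -
  obtain \<delta> M0 where \<delta>: "\<delta> > 0" "\<And>n. n \<ge> M0 \<Longrightarrow> pabs (x n) \<ge> \<delta>"
    using nonnull_bounded_below[OF x] by blast
  have nz: "x n \<noteq> 0" if "n \<ge> M0" for n
    using \<delta>(1) \<delta>(2)[OF that] by auto
  show "(\<lambda>n. inverse (x n)) \<in> carrier C"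
    unfolding Cauchy_carrier
  proof (intro allI impI)
    fix \<epsilon> :: real assume \<epsilon>: "\<epsilon> > 0"
    then have "\<epsilon> * (\<delta> * \<delta>) > 0"
      using \<delta> by simp
    then obtain M where M: "\<forall>m\<ge>M. \<forall>n\<ge>M. pabs (x m - x n) < \<epsilon> * (\<delta> * \<delta>)"
      using x(1) unfolding Cauchy_carrier by meson
    have "pabs (inverse (x m) - inverse (x n)) < \<epsilon>" if mn: "m \<ge> max M M0" "n \<ge> max M M0" for m n
    proof -
      have nzs: "x m \<noteq> 0" "x n \<noteq> 0"
        using nz mn by auto
      then have "x n - x m = (inverse (x m) - inverse (x n)) * (x m * x n)"
        by (simp add: field_simps)
      then have eq: "pabs (x n - x m) = pabs (inverse (x m) - inverse (x n)) * (pabs (x m) * pabs (x n))"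
        by (simp only: pabs_mult)
      have "\<delta> * \<delta> \<le> pabs (x m) * pabs (x n)"
        using \<delta> mn by (intro mult_mono) auto
      then have "pabs (inverse (x m) - inverse (x n)) * (\<delta> * \<delta>) \<le> pabs (x n - x m)"
        unfolding eq by (intro mult_left_mono) auto
      also have "\<dots> < \<epsilon> * (\<delta> * \<delta>)"
        using M mn by auto
      finally show ?thesis
        using \<delta>(1) by simp
    qed
    then show "\<exists>M. \<forall>m\<ge>M. \<forall>n\<ge>M. pabs (inverse (x m) - inverse (x n)) < \<epsilon>"
      by blast
  qed
  show "(\<lambda>n. x n * inverse (x n) - 1) \<in> N"
    unfolding null_iff using nz by (metis diff_self pabs_zero right_inverse)
qed

lemma padic_ring_cring: "cring (padic_ring p)"
  unfolding padic_ring_def by (rule N.quotient_is_cring[OF C.is_cring])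

lemma padic_field_field: "Ring.field Qp"
proof -
  interpret Q: cring Qp
    unfolding padic_field_def by (rule cring_extend[OF padic_ring_cring])
  show ?thesis
  proof (rule Q.cring_fieldI2)
    show "\<zero>\<^bsub>Qp\<^esub> \<noteq> \<one>\<^bsub>Qp\<^esub>"
    proof
      assume "\<zero>\<^bsub>Qp\<^esub> = \<one>\<^bsub>Qp\<^esub>"
      then have "(\<lambda>n. 0 - 1) \<in> N"
        using cls_eq_iff[OF Cauchy_const Cauchy_const, of 0 1] by (simp add: cls_zero cls_one)
      then show False
        unfolding null_iff by (auto simp: pabs_minus dest: spec[of _ 1])
    qed
    fix r assume r: "r \<in> carrier Qp" "r \<noteq> \<zero>\<^bsub>Qp\<^esub>"
    then obtain x where x: "x \<in> carrier C" "r = cls x"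
      using cls_cases[of r] by auto
    have "x \<notin> N"
      using r(2) cls_eq_iff[OF x(1) Cauchy_const, of 0] by (auto simp: cls_zero x(2))
    note inv = Cauchy_inverse[OF x(1) this]
    have "r \<otimes>\<^bsub>Qp\<^esub> cls (\<lambda>n. inverse (x n)) = cls (\<lambda>n. x n * inverse (x n))"
      by (simp add: x cls_mult inv del: right_inverse)
    also have "\<dots> = \<one>\<^bsub>Qp\<^esub>"
      using cls_eq_iff[OF Cauchy_mult[OF x(1) inv(1)] Cauchy_const, of 1] inv(2) by (simp add: cls_one)
    finally show "\<exists>b\<in>carrier Qp. r \<otimes>\<^bsub>Qp\<^esub> b = \<one>\<^bsub>Qp\<^esub>"
      using cls_closed[OF inv(1)] by auto
  qed
qed

lemma padic_field_algebra: "algebra rat_ring Qp"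
proof (rule algebraI)
  interpret Q: Ring.field Qp
    by (rule padic_field_field)
  interpret P: cring "padic_ring p"
    by (rule padic_ring_cring)
  show "cring rat_ring" ..
  show "cring Qp" ..
  fix q x assume x: "x \<in> carrier Qp"
  show "q \<odot>\<^bsub>Qp\<^esub> x \<in> carrier Qp"
    using x cls_closed[OF Cauchy_const] by simp
  show "\<one>\<^bsub>rat_ring\<^esub> \<odot>\<^bsub>Qp\<^esub> x = x"
    using x by (simp add: cls_one[symmetric])
  show "(q \<oplus>\<^bsub>rat_ring\<^esub> q') \<odot>\<^bsub>Qp\<^esub> x = q \<odot>\<^bsub>Qp\<^esub> x \<oplus>\<^bsub>Qp\<^esub> q' \<odot>\<^bsub>Qp\<^esub> x" for q'
    using x cls_closed[OF Cauchy_const] by (simp add: cls_add[OF Cauchy_const Cauchy_const, symmetric] P.l_distr)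
  show "(q \<otimes>\<^bsub>rat_ring\<^esub> q') \<odot>\<^bsub>Qp\<^esub> x = q \<odot>\<^bsub>Qp\<^esub> (q' \<odot>\<^bsub>Qp\<^esub> x)" for q'
    using x cls_closed[OF Cauchy_const] by (simp add: cls_mult[OF Cauchy_const Cauchy_const, symmetric] P.m_assoc)
  fix y assume y: "y \<in> carrier Qp"
  show "q \<odot>\<^bsub>Qp\<^esub> (x \<oplus>\<^bsub>Qp\<^esub> y) = q \<odot>\<^bsub>Qp\<^esub> x \<oplus>\<^bsub>Qp\<^esub> q \<odot>\<^bsub>Qp\<^esub> y"
    using x y cls_closed[OF Cauchy_const] by (simp add: P.r_distr)
  show "(q \<odot>\<^bsub>Qp\<^esub> x) \<otimes>\<^bsub>Qp\<^esub> y = q \<odot>\<^bsub>Qp\<^esub> (x \<otimes>\<^bsub>Qp\<^esub> y)"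
    using x y cls_closed[OF Cauchy_const] by (simp add: P.m_assoc)
qed

end

sublocale padic \<subseteq> Q: rat_field_algebra "padic_field p"
  by (intro rat_field_algebra.intro padic_field_algebra padic_field_field)

subsection \<open>Cube roots of a p-adic unit\<close>

text \<open>One step of Hensel lifting: \<open>z' = z + tp\<^sup>k\<^sup>+\<^sup>1\<close>, where \<open>t\<close> solves a linear congruence modulo \<open>p\<close> with leading
  coefficient the derivative \<open>3bz\<^sup>2\<close>.\<close>

lemma hensel_cube_step:
  fixes p a b y z :: int
  assumes p: "Factorial_Ring.prime p" "\<not> p dvd 3 * b * z"
    and root: "p ^ Suc k dvd b * z ^ 3 - a"
  shows "\<exists>z'. p ^ Suc (Suc k) dvd b * z' ^ 3 - a \<and> p ^ Suc k dvd z' - z"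
proof -
  let ?q = "p ^ Suc k"
  obtain c where c: "b * z ^ 3 - a = ?q * c"
    using root by (auto simp: dvd_def)
  have "coprime (3 * b * z ^ 2) p"
    using p by (metis coprime_commute coprime_mult_left_iff power2_eq_square prime_imp_coprime)
  then obtain s where "[3 * b * z ^ 2 * s = 1] (mod p)"
    using cong_solve_coprime_int by blast
  then obtain l where "3 * b * z ^ 2 * s - 1 = p * l"
    unfolding cong_iff_dvd_diff by (elim dvdE)
  then have l: "3 * b * z ^ 2 * s = 1 + p * l"
    by simp
  define t where "t = - c * s"
  have "3 * b * z ^ 2 * t = - c * (3 * b * z ^ 2 * s)"
    by (simp add: t_def algebra_simps)
  also have "\<dots> = - c - p * (c * l)"
    unfolding l by (simp add: algebra_simps)
  finally have t: "3 * b * z ^ 2 * t = - c - p * (c * l)" .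
  define z' where "z' = z + t * ?q"
  have "b * z' ^ 3 - a = (b * z ^ 3 - a) + (3 * b * z ^ 2 * t) * ?q + ?q * ?q * (3 * b * z * t ^ 2 + b * t ^ 3 * ?q)"
    unfolding z'_def by (simp add: algebra_simps power2_eq_square power3_eq_cube del: power_Suc)
  also have "\<dots> = ?q * p * (- c * l) + ?q * p * (p ^ k * (3 * b * z * t ^ 2 + b * t ^ 3 * ?q))"
    unfolding c t by (simp add: algebra_simps)
  finally have "p ^ Suc (Suc k) dvd b * z' ^ 3 - a"
    by (simp add: mult_ac)
  moreover have "?q dvd z' - z"
    by (simp add: z'_def)
  ultimately show ?thesis
    by blast
qed

text \<open>Hensel lifting of a root of \<open>b X\<^sup>3 - a\<close> modulo \<open>p\<close>.\<close>

lemma hensel_cube: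
  fixes p a b y :: int
  assumes p: "Factorial_Ring.prime p" "\<not> p dvd 3 * b * y" and root: "p dvd b * y ^ 3 - a"
  obtains h :: "nat \<Rightarrow> int" where "\<And>k. p dvd h k - y" "\<And>k. p ^ Suc k dvd b * h k ^ 3 - a"
    "\<And>k. p ^ Suc k dvd h (Suc k) - h k"
proof -
  let ?P = "\<lambda>k z. p ^ Suc k dvd b * z ^ 3 - a \<and> p dvd z - y"
  have "\<exists>h. \<forall>k. ?P k (h k) \<and> p ^ Suc k dvd h (Suc k) - h k"
  proof (rule dependent_nat_choice)
    show "\<exists>z. ?P 0 z"
      using root by (intro exI[of _ y]) simp
    fix z k assume z: "?P k z"
    have "\<not> p dvd 3 * b * z"
    proof
      assume "p dvd 3 * b * z"
      then have "p dvd 3 * b * z - 3 * b * (z - y)"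
        using z by (intro dvd_diff) auto
      then show False
        using p(2) by (simp add: algebra_simps)
    qed
    then obtain z' where z': "p ^ Suc (Suc k) dvd b * z' ^ 3 - a" "p ^ Suc k dvd z' - z"
      using hensel_cube_step[OF p(1)] z by blast
    have "p dvd z' - z"
      using z'(2) by (simp add: dvd_mult_left)
    then have "p dvd (z' - z) + (z - y)"
      using z by (intro dvd_add) auto
    then show "\<exists>z'. ?P (Suc k) z' \<and> p ^ Suc k dvd z' - z"
      using z' by auto
  qed
  then show thesis
    using that by blast
qed

context padic
begin

lemma dvd_chain:
  assumes "\<And>k. int p ^ Suc k dvd h (Suc k) - h k" and "k \<le> m"
  shows "int p ^ Suc k dvd h m - h k"
  using assms(2)
proof (induction m rule: dec_induct)
  case (step m)
  have "int p ^ Suc k dvd h (Suc m) - h m"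
    using assms(1)[of m] step le_imp_power_dvd[of "Suc k" "Suc m" "int p"] dvd_trans by auto
  then have "int p ^ Suc k dvd (h (Suc m) - h m) + (h m - h k)"
    using step by (intro dvd_add) auto
  then show ?case
    by simp
qed simp

lemma null_geometric:
  assumes "\<And>k. pabs (x k) \<le> (1 / real p) ^ Suc k" shows "x \<in> N"
  unfolding null_iff
proof (intro allI impI)
  fix \<epsilon> :: real assume "\<epsilon> > 0"
  then obtain M where M: "(1 / real p) ^ M < \<epsilon>"
    using real_arch_pow_inv[of \<epsilon> "1 / real p"] p_gt_1 by auto
  have "pabs (x n) < \<epsilon>" if "n \<ge> M" for n
  proof -
    have "pabs (x n) \<le> (1 / real p) ^ Suc n"
      by (rule assms)
    also have "\<dots> \<le> (1 / real p) ^ M"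
      using that p_gt_1 by (intro power_decreasing) auto
    finally show ?thesis
      using M by simp
  qed
  then show "\<exists>M. \<forall>n\<ge>M. pabs (x n) < \<epsilon>"
    by blast
qed

lemma Cauchy_chain:
  assumes "\<And>k. int p ^ Suc k dvd h (Suc k) - h k"
  shows "(\<lambda>k. of_int (h k)) \<in> carrier C"
  unfolding Cauchy_carrier
proof (intro allI impI)
  fix \<epsilon> :: real assume "\<epsilon> > 0"
  then obtain M where M: "(1 / real p) ^ M < \<epsilon>"
    using real_arch_pow_inv[of \<epsilon> "1 / real p"] p_gt_1 by auto
  have 1: "pabs (of_int (h m) - of_int (h M)) < \<epsilon>" if "m \<ge> M" for m
  proof -
    have "int p ^ M dvd h m - h M"
      using dvd_chain[OF assms that] le_imp_power_dvd[of M "Suc M" "int p"] dvd_trans by auto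
    then show ?thesis
      using pabs_int_dvd[of M "h m - h M"] M by simp
  qed
  have "pabs (of_int (h m) - of_int (h n)) < \<epsilon>" if "m \<ge> M" "n \<ge> M" for m n
    using pabs_diff_trans[of "of_int (h m)" "of_int (h n)" "of_int (h M)"] 1[OF that(1)] 1[OF that(2)]
    by (simp add: pabs_diff_commute[of "of_int (h M)"])
  then show "\<exists>M. \<forall>m\<ge>M. \<forall>n\<ge>M. pabs (of_int (h m) - of_int (h n)) < \<epsilon>"
    by blast
qed

lemma cls_cube_root_iff:
  assumes x: "x \<in> carrier C"
  shows "cls x \<in> Q.cube_roots n \<longleftrightarrow> (\<lambda>k. x k ^ 3 - n) \<in> N"
proof -
  have "n \<odot>\<^bsub>Qp\<^esub> \<one>\<^bsub>Qp\<^esub> = cls (\<lambda>k. n)"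
    by (simp add: cls_one cls_mult Cauchy_const)
  moreover have "cls x \<otimes>\<^bsub>Qp\<^esub> (cls x \<otimes>\<^bsub>Qp\<^esub> cls x) = cls (\<lambda>k. x k ^ 3)"
    using x by (simp add: cls_mult Cauchy_mult power3_eq_cube mult.assoc)
  moreover have "(\<lambda>k. x k ^ 3) \<in> carrier C"
    using x by (simp add: Cauchy_mult power3_eq_cube)
  ultimately show ?thesis
    using cls_closed[OF x] unfolding Q.cube_roots_def
    by (simp add: cls_eq_iff Cauchy_const del: padic_field_simps(2-6))
qed

text \<open>A rational number that is integral at \<open>p\<close> is congruent to an integer modulo \<open>p\<close>.\<close>

lemma residue_exists:
  assumes "pabs x \<le> 1"
  obtains y :: int where "pabs (x - of_int y) < 1"
proof (cases "x = 0")
  case True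
  then show thesis
    using that[of 0] by simp
next
  case False
  obtain c d where cd: "quotient_of x = (c, d)"
    by fastforce
  have d: "d > 0" "x = of_int c / of_int d" "coprime c d"
    using quotient_of_denom_pos[OF cd] quotient_of_div[OF cd] quotient_of_coprime[OF cd] by auto
  have c0: "c \<noteq> 0"
    using d False by auto
  have "\<not> int p dvd d"
  proof
    assume pd: "int p dvd d"
    then have "\<not> int p dvd c"
      using d(3) p_prime_int by (metis coprime_common_divisor not_prime_unit)
    then have "pabs (of_int c) = 1"
      by (rule pabs_int_unit)
    moreover have "pabs (of_int c) = pabs x * pabs (of_int d)"
      unfolding pabs_mult[symmetric] using d by simp
    moreover have "pabs x * pabs (of_int d) \<le> 1 * pabs (of_int d)"
      using assms by (intro mult_right_mono) auto
    ultimately show False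
      using pd pabs_int_lt_iff[of d] by simp
  qed
  then have cop: "coprime d (int p)"
    using p_prime_int by (metis coprime_commute prime_imp_coprime)
  then obtain s where "[d * s = 1] (mod int p)"
    using cong_solve_coprime_int by blast
  then have "int p dvd c * (d * s - 1)"
    by (simp add: cong_iff_dvd_diff)
  then have dvd: "int p dvd c - c * s * d"
    by (simp add: algebra_simps dvd_diff_commute)
  have "pabs (x - of_int (c * s)) * pabs (of_int d) = pabs (of_int (c - c * s * d))"
    unfolding pabs_mult[symmetric] using d by (simp add: algebra_simps)
  moreover have "pabs (of_int d) = 1"
    by (rule pabs_int_unit) fact
  moreover have "pabs (of_int (c - c * s * d)) < 1"
    using dvd by (simp only: pabs_int_lt_iff)
  ultimately have "pabs (x - of_int (c * s)) < 1"
    by (metis mult.right_neutral)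
  then show thesis
    by (rule that)
qed

lemma pabs_lt_1_mult: "pabs x < 1 \<Longrightarrow> pabs y \<le> 1 \<Longrightarrow> pabs (x * y) < 1"
  unfolding pabs_mult using mult_left_le[of "pabs y" "pabs x"] by simp

lemma pabs_le_1_add: "pabs x \<le> 1 \<Longrightarrow> pabs y \<le> 1 \<Longrightarrow> pabs (x + y) \<le> 1"
  using pabs_add[of x y] by simp

lemma pabs_le_1_mult: "pabs x \<le> 1 \<Longrightarrow> pabs y \<le> 1 \<Longrightarrow> pabs (x * y) \<le> 1"
  unfolding pabs_mult by (simp add: mult_le_one)

lemma pabs_add_lt: "pabs x < e \<Longrightarrow> pabs y < e \<Longrightarrow> pabs (x + y) < e"
  using pabs_add[of x y] by simp

text \<open>Near a unit \<open>y\<close>, cubing is an isometry when \<open>p \<noteq> 3\<close>.\<close>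

lemma pabs_cube_diff:
  assumes y: "\<not> int p dvd 3 * y" and x: "pabs (x - of_int y) < 1" and x': "pabs (x' - of_int y) < 1"
  shows "pabs (x ^ 3 - x' ^ 3) = pabs (x - x')"
proof -
  have le: "pabs x \<le> 1" if "pabs (x - of_int y) < 1" for x
    using pabs_le_1_add[of "x - of_int y" "of_int y"] that pabs_int_le[of y] by simp
  let ?y = "of_int y :: rat"
  define g where "g = x ^ 2 + x * x' + x' ^ 2"
  \<comment> \<open>\<open>g\<close> is congruent to \<open>3y\<^sup>2\<close>, a unit\<close>
  have "g - 3 * ?y ^ 2 = (x - ?y) * (x + x' + ?y) + (x' - ?y) * (x' + ?y + ?y)"
    by (simp add: g_def power2_eq_square algebra_simps)
  moreover have "pabs ((x - ?y) * (x + x' + ?y) + (x' - ?y) * (x' + ?y + ?y)) < 1"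
    using x x' le[OF x] le[OF x'] pabs_int_le[of y]
    by (intro pabs_add_lt pabs_lt_1_mult pabs_le_1_add) auto
  ultimately have lt: "pabs (g - 3 * ?y ^ 2) < 1"
    by simp
  have "\<not> int p dvd 3 * y ^ 2"
    using y p_prime_int by (metis dvd_mult prime_dvd_mult_iff prime_dvd_power)
  then have u: "pabs (3 * ?y ^ 2) = 1"
    using pabs_int_unit[of "3 * y ^ 2"] by simp
  have "pabs g = 1"
  proof (rule antisym)
    show "pabs g \<le> 1"
      using pabs_le_1_add[of "g - 3 * ?y ^ 2" "3 * ?y ^ 2"] lt u by simp
    show "1 \<le> pabs g"
      using pabs_add[of "3 * ?y ^ 2 - g" g] lt u by (simp add: pabs_diff_commute)
  qed
  moreover have "x ^ 3 - x' ^ 3 = (x - x') * g"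
    by (simp add: g_def power2_eq_square power3_eq_cube algebra_simps)
  ultimately show ?thesis
    by (simp add: pabs_mult)
qed

text \<open>Hensel lifting of residues gives all cube roots of \<open>a / b\<close>: such a root is a unit, so it has a residue, and
  it agrees with the lift of its residue because cubing is an isometry on residue classes of units.\<close>

theorem cube_roots_bij:
  assumes ab: "\<not> int p dvd 3 * a * b"
  shows "\<exists>f. bij_betw f {y \<in> {0..<int p}. int p dvd b * y ^ 3 - a} (Q.cube_roots (of_int a / of_int b))"
proof -
  let ?F = "{y \<in> {0..<int p}. int p dvd b * y ^ 3 - a}" and ?n = "of_int a / of_int b :: rat"
  have p3: "\<not> int p dvd 3" and pa: "\<not> int p dvd a" and pb: "\<not> int p dvd b"
    using ab by auto
  have b0: "b \<noteq> 0"
    using pb by auto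
  have b1: "pabs (of_int b) = 1" and a1: "pabs (of_int a) = 1"
    using pa pb by (auto intro: pabs_int_unit)
  have unit: "\<not> int p dvd 3 * b * y" and unit': "\<not> int p dvd 3 * y" if "int p dvd b * y ^ 3 - a" for y
  proof -
    have "\<not> int p dvd y"
    proof
      assume "int p dvd y"
      then have "int p dvd b * y ^ 3"
        by (simp add: power3_eq_cube)
      then have "int p dvd b * y ^ 3 - (b * y ^ 3 - a)"
        using that by (rule dvd_diff)
      then show False
        using pa by simp
    qed
    then show "\<not> int p dvd 3 * b * y" "\<not> int p dvd 3 * y"
      using p3 pb p_prime_int by (auto simp: prime_dvd_mult_iff)
  qed
  \<comment> \<open>a residue class has one representative in \<open>{0..<p}\<close>\<close>
  have res_unique: "y = y'" if "y \<in> {0..<int p}" "y' \<in> {0..<int p}" "int p dvd y - y'" for y y'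
    using that by (metis atLeastLessThan_iff mod_eq_dvd_iff mod_pos_pos_trivial)
  have scale: "pabs (of_int (b * z ^ 3 - a)) = pabs (of_int z ^ 3 - ?n)" for z
  proof -
    have "of_int (b * z ^ 3 - a) = of_int b * (of_int z ^ 3 - ?n)"
      using b0 by (simp add: algebra_simps)
    then show ?thesis
      using b1 by (simp only: pabs_mult mult_1)
  qed
  have lift: "\<exists>h. (\<forall>k. int p dvd h k - y) \<and> (\<lambda>k. of_int (h k)) \<in> carrier C \<and>
      (\<lambda>k. of_int (h k) ^ 3 - ?n) \<in> N" if y: "y \<in> ?F" for y
  proof -
    obtain h where h: "\<And>k. int p dvd h k - y" "\<And>k. int p ^ Suc k dvd b * h k ^ 3 - a"
      "\<And>k. int p ^ Suc k dvd h (Suc k) - h k"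
      using hensel_cube[OF p_prime_int unit, of y a] y by blast
    have "pabs (of_int (h k) ^ 3 - ?n) \<le> (1 / real p) ^ Suc k" for k
      using pabs_int_dvd[OF h(2)[of k]] unfolding scale .
    then have "(\<lambda>k. of_int (h k) ^ 3 - ?n) \<in> N"
      by (rule null_geometric)
    then show ?thesis
      using h(1) Cauchy_chain[OF h(3)] by blast
  qed
  then have "\<forall>y\<in>?F. \<exists>h. (\<forall>k. int p dvd h k - y) \<and> (\<lambda>k. of_int (h k)) \<in> carrier C \<and>
      (\<lambda>k. of_int (h k) ^ 3 - ?n) \<in> N"
    by blast
  from bchoice[OF this] obtain h where hF: "\<forall>y\<in>?F. (\<forall>k. int p dvd h y k - y) \<and>
      (\<lambda>k. of_int (h y k)) \<in> carrier C \<and> (\<lambda>k. of_int (h y k) ^ 3 - ?n) \<in> N"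
    by blast
  have h: "\<And>y k. y \<in> ?F \<Longrightarrow> int p dvd h y k - y"
    "\<And>y. y \<in> ?F \<Longrightarrow> (\<lambda>k. of_int (h y k)) \<in> carrier C"
    "\<And>y. y \<in> ?F \<Longrightarrow> (\<lambda>k. of_int (h y k) ^ 3 - ?n) \<in> N"
    using hF by blast+
  have h1: "pabs (of_int (h y k) - of_int y) < 1" if "y \<in> ?F" for y k
    using h(1)[OF that, of k] pabs_int_lt_iff[of "h y k - y"] by simp
  let ?f = "\<lambda>y. cls (\<lambda>k. of_int (h y k))"
  have "bij_betw ?f ?F (Q.cube_roots ?n)"
  proof (rule bij_betw_imageI)
    show "inj_on ?f ?F"
    proof (rule inj_onI)
      fix y y' assume y: "y \<in> ?F" "y' \<in> ?F" and eq: "?f y = ?f y'"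
      then have "(\<lambda>k. of_int (h y k) - of_int (h y' k)) \<in> N"
        using cls_eq_iff[OF h(2)[OF y(1)] h(2)[OF y(2)]] by simp
      then obtain k where k: "pabs (of_int (h y k) - of_int (h y' k)) < 1"
        unfolding null_iff by (meson order_refl zero_less_one)
      have "of_int (y - y') = (of_int y - of_int (h y k)) + ((of_int (h y k) - of_int (h y' k)) +
          (of_int (h y' k) - of_int y') :: rat)"
        by simp
      also have "pabs \<dots> < 1"
        using h1[OF y(1), of k] h1[OF y(2), of k] k
        by (intro pabs_add_lt) (simp_all add: pabs_diff_commute)
      finally have "int p dvd y - y'"
        by (simp only: pabs_int_lt_iff)
      then show "y = y'"
        using y res_unique by blast
    qed
    show "?f ` ?F = Q.cube_roots ?n"
    proof (intro equalityI subsetI)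
      fix r assume "r \<in> ?f ` ?F"
      then show "r \<in> Q.cube_roots ?n"
        using cls_cube_root_iff[OF h(2)] h(3) by blast
    next
      fix r assume r: "r \<in> Q.cube_roots ?n"
      then have "r \<in> carrier (padic_ring p)"
        by (simp add: Q.cube_roots_def)
      then obtain x where x: "x \<in> carrier C" "r = cls x"
        by (rule cls_cases)
      then have x3: "(\<lambda>k. x k ^ 3 - ?n) \<in> N"
        using r cls_cube_root_iff by blast
      obtain M1 where M1: "\<forall>k\<ge>M1. pabs (x k ^ 3 - ?n) < 1"
        using x3 unfolding null_iff by (meson zero_less_one)
      obtain M2 where M2: "\<forall>m\<ge>M2. \<forall>n\<ge>M2. pabs (x m - x n) < 1"
        using x(1) unfolding Cauchy_carrier by (meson zero_less_one)
      let ?M = "max M1 M2"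
      have n1: "pabs ?n = 1"
        using a1 b1 by (simp add: divide_inverse pabs_mult pabs_inverse)
      have x_le: "pabs (x k) \<le> 1" if "k \<ge> M1" for k
      proof -
        have "pabs (x k ^ 3) \<le> 1"
          using pabs_le_1_add[of "x k ^ 3 - ?n" ?n] M1 that n1 by (simp add: less_imp_le)
        then have "pabs (x k) ^ 3 \<le> 1"
          by (simp add: power3_eq_cube pabs_mult)
        then show ?thesis
          by (simp add: power_le_one_iff)
      qed
      obtain y0 where y0: "pabs (x ?M - of_int y0) < 1"
        using residue_exists[OF x_le[of ?M]] by auto
      define y where "y = y0 mod int p"
      have "int p dvd y0 - y"
        by (simp add: y_def minus_mod_eq_mult_div)
      then have "pabs (of_int y0 - of_int y) < 1"
        using pabs_int_lt_iff[of "y0 - y"] by simp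
      then have y1: "pabs (x ?M - of_int y) < 1"
        using pabs_add_lt[OF y0, of "of_int y0 - of_int y"] by simp
      have xy: "pabs (x k - of_int y) < 1" if "k \<ge> ?M" for k
        using pabs_add_lt[of "x k - x ?M" 1 "x ?M - of_int y"] y1 M2 that by auto
      have yrange: "y \<in> {0..<int p}"
        using p_gt_1 by (simp add: y_def)
      have "int p dvd b * y ^ 3 - a"
      proof -
        have "(of_int y ^ 3 - x ?M ^ 3 :: rat) = (of_int y - x ?M) * (of_int y ^ 2 + of_int y * x ?M + x ?M ^ 2)"
          by (simp add: power2_eq_square power3_eq_cube algebra_simps)
        also have "pabs \<dots> < 1"
          using y1 x_le[of ?M] pabs_int_le[of y]
          by (intro pabs_lt_1_mult pabs_le_1_add) (auto simp: power2_eq_square pabs_diff_commute intro: pabs_le_1_mult)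
        finally have "pabs ((of_int y ^ 3 - x ?M ^ 3) + (x ?M ^ 3 - ?n)) < 1"
          using M1 by (intro pabs_add_lt) auto
        then have "pabs (of_int y ^ 3 - ?n) < 1"
          by simp
        then show ?thesis
          unfolding scale[symmetric] by (simp only: pabs_int_lt_iff)
      qed
      then have yF: "y \<in> ?F"
        using yrange by simp
      have "(\<lambda>k. x k - of_int (h y k)) \<in> N"
        unfolding null_iff
      proof (intro allI impI)
        fix \<epsilon> :: real assume \<epsilon>: "\<epsilon> > 0"
        then obtain M3 M4 where M: "\<forall>k\<ge>M3. pabs (x k ^ 3 - ?n) < \<epsilon>" "\<forall>k\<ge>M4. pabs (of_int (h y k) ^ 3 - ?n) < \<epsilon>"
          using x3 h(3)[OF yF] unfolding null_iff by meson
        have "pabs (x k - of_int (h y k)) < \<epsilon>" if k: "k \<ge> max ?M (max M3 M4)" for k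
        proof -
          have "pabs (x k - of_int (h y k)) = pabs (x k ^ 3 - of_int (h y k) ^ 3)"
            using xy[of k] h1[OF yF, of k] unit' yF k by (intro pabs_cube_diff[symmetric, of y]) auto
          also have "\<dots> = pabs ((x k ^ 3 - ?n) + (?n - of_int (h y k) ^ 3))"
            by simp
          also have "\<dots> < \<epsilon>"
            using M k by (intro pabs_add_lt) (auto simp: pabs_diff_commute)
          finally show ?thesis .
        qed
        then show "\<exists>M. \<forall>k\<ge>M. pabs (x k - of_int (h y k)) < \<epsilon>"
          by blast
      qed
      then have "cls x = ?f y"
        using cls_eq_iff[OF x(1) h(2)[OF yF]] by simp
      then show "r \<in> ?f ` ?F"
        using x(2) yF by blast
    qed
  qed
  then show ?thesis
    by blast
qed

corollary card_cube_roots: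
  assumes ab: "\<not> int p dvd 3 * a * b"
  shows "finite (Q.cube_roots (of_int a / of_int b))"
    and "card (Q.cube_roots (of_int a / of_int b)) = card {y \<in> {0..<int p}. int p dvd b * y ^ 3 - a}"
proof -
  obtain f where bij: "bij_betw f {y \<in> {0..<int p}. int p dvd b * y ^ 3 - a} (Q.cube_roots (of_int a / of_int b))"
    using cube_roots_bij[OF ab] by blast
  show "finite (Q.cube_roots (of_int a / of_int b))"
    using bij_betw_finite[OF bij] finite_subset[of "{y \<in> {0..<int p}. int p dvd b * y ^ 3 - a}" "{0..<int p}"]
    by blast
  show "card (Q.cube_roots (of_int a / of_int b)) = card {y \<in> {0..<int p}. int p dvd b * y ^ 3 - a}"
    using bij_betw_same_card[OF bij] by simp
qed

end

section \<open>Diagonal cubic equations over a finite field\<close>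

text \<open>Counting pairs by the value \<open>v\<close> of a function of the first component; \<open>D v\<close> is the condition that this
  imposes on the second component.\<close>

lemma card_pairs_fibre:
  assumes "finite S" "finite T" "finite V" and A: "A ` S \<subseteq> V"
    and B: "\<And>x y. x \<in> S \<Longrightarrow> y \<in> T \<Longrightarrow> P x y \<longleftrightarrow> y \<in> D (A x)"
  shows "card {(x, y) \<in> S \<times> T. P x y} = (\<Sum>v\<in>V. card {x \<in> S. A x = v} * card {y \<in> T. y \<in> D v})"
proof -
  have "{(x, y) \<in> S \<times> T. P x y} = (\<Union>v\<in>V. {x \<in> S. A x = v} \<times> {y \<in> T. y \<in> D v})"
    using A B by auto
  also have "card \<dots> = (\<Sum>v\<in>V. card ({x \<in> S. A x = v} \<times> {y \<in> T. y \<in> D v}))"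
    using assms by (intro card_UN_disjoint) auto
  finally show ?thesis
    by (simp add: card_cartesian_product)
qed

locale finite_field = Ring.field R for R (structure) +
  assumes finite_carrier: "finite (carrier R)"
begin

abbreviation "U \<equiv> carrier R"
abbreviation "q \<equiv> card (carrier R)"

lemma sum_reflect: "s \<in> U \<Longrightarrow> (\<Sum>v\<in>U. F (s \<ominus> v)) = (\<Sum>v\<in>U. F v)"
  by (rule sum.reindex_bij_witness[where i = "\<lambda>v. s \<ominus> v" and j = "\<lambda>v. s \<ominus> v"])
    (auto simp: minus_eq minus_add a_assoc[symmetric] r_neg)

lemma sum_uminus: "(\<Sum>v\<in>U. F (\<ominus> v)) = (\<Sum>v\<in>U. F v)"
  by (rule sum.reindex_bij_witness[where i = "\<lambda>v. \<ominus> v" and j = "\<lambda>v. \<ominus> v"]) auto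

lemma sum_translate: "s \<in> U \<Longrightarrow> (\<Sum>v\<in>U. F (s \<oplus> v)) = (\<Sum>v\<in>U. F v)"
  by (rule sum.reindex_bij_witness[where i = "\<lambda>v. \<ominus> s \<oplus> v" and j = "\<lambda>v. s \<oplus> v"])
    (auto simp: a_assoc[symmetric] r_neg l_neg)

lemma nonzero_inv:
  assumes "l \<in> U" "l \<noteq> \<zero>"
  shows "inv l \<in> U" "inv l \<otimes> l = \<one>" "l \<otimes> inv l = \<one>" "inv l \<noteq> \<zero>"
proof -
  have u: "l \<in> Units R"
    using assms field_Units by blast
  show "inv l \<in> U" "inv l \<otimes> l = \<one>" "l \<otimes> inv l = \<one>"
    using u by auto
  then show "inv l \<noteq> \<zero>"
    using assms by auto
qed

lemma sum_scale:
  assumes l: "l \<in> U" "l \<noteq> \<zero>" shows "(\<Sum>v\<in>U. F (l \<otimes> v)) = (\<Sum>v\<in>U. F v)"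
  by (rule sum.reindex_bij_witness[where i = "\<lambda>v. inv l \<otimes> v" and j = "\<lambda>v. l \<otimes> v"])
    (use nonzero_inv[OF l] l in \<open>auto simp: m_assoc[symmetric]\<close>)

text \<open>Additive convolution of complex functions on the field, and the value at zero of a convolution.\<close>

definition conv :: "('a \<Rightarrow> complex) \<Rightarrow> ('a \<Rightarrow> complex) \<Rightarrow> 'a \<Rightarrow> complex" where
  "conv F G s = (\<Sum>v\<in>U. F v * G (s \<ominus> v))"

definition pairing :: "('a \<Rightarrow> complex) \<Rightarrow> ('a \<Rightarrow> complex) \<Rightarrow> complex" where
  "pairing F G = (\<Sum>s\<in>U. F s * G (\<ominus> s))"

lemma conv_commute: "s \<in> U \<Longrightarrow> conv F G s = conv G F s"
proof -
  assume s: "s \<in> U"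
  have "conv F G s = (\<Sum>v\<in>U. F (s \<ominus> v) * G (s \<ominus> (s \<ominus> v)))"
    unfolding conv_def by (rule sum_reflect[OF s, symmetric])
  also have "\<dots> = conv G F s"
    unfolding conv_def using s
    by (intro sum.cong refl) (auto simp: minus_eq minus_add a_assoc[symmetric] r_neg)
  finally show ?thesis .
qed

lemma sum_conv: "(\<Sum>s\<in>U. conv F G s) = (\<Sum>v\<in>U. F v) * (\<Sum>v\<in>U. G v)"
proof -
  have "(\<Sum>s\<in>U. conv F G s) = (\<Sum>v\<in>U. \<Sum>s\<in>U. F v * G (s \<ominus> v))"
    unfolding conv_def by (rule sum.swap)
  also have "\<dots> = (\<Sum>v\<in>U. F v * (\<Sum>s\<in>U. G s))"
  proof (intro sum.cong refl)
    fix v assume v: "v \<in> U"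
    have "(\<Sum>s\<in>U. F v * G (s \<ominus> v)) = F v * (\<Sum>s\<in>U. G (\<ominus> v \<oplus> s))"
      unfolding sum_distrib_left using v by (intro sum.cong refl) (auto simp: minus_eq a_comm)
    then show "(\<Sum>s\<in>U. F v * G (s \<ominus> v)) = F v * (\<Sum>s\<in>U. G s)"
      using sum_translate[of "\<ominus> v" G] v by simp
  qed
  finally show ?thesis
    by (simp add: sum_distrib_right)
qed

text \<open>The sum of \<open>F\<^sub>1(v\<^sub>1)F\<^sub>2(v\<^sub>2)F\<^sub>3(v\<^sub>3)F\<^sub>4(v\<^sub>4)\<close> over all \<open>v\<^sub>1 + v\<^sub>2 + v\<^sub>3 + v\<^sub>4 = 0\<close>.\<close>

definition quad_sum :: "('a \<Rightarrow> complex) \<Rightarrow> ('a \<Rightarrow> complex) \<Rightarrow> ('a \<Rightarrow> complex) \<Rightarrow> ('a \<Rightarrow> complex) \<Rightarrow> complex" where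
  "quad_sum F1 F2 F3 F4 = (\<Sum>v\<in>U. \<Sum>x\<in>U. \<Sum>w\<in>U. F1 v * F2 x * F3 w * F4 (\<ominus> (v \<oplus> x \<oplus> w)))"

lemma pairing_conv: "pairing (conv F1 F2) (conv F3 F4) = quad_sum F1 F2 F3 F4"
proof -
  have "pairing (conv F1 F2) (conv F3 F4) =
      (\<Sum>s\<in>U. \<Sum>v\<in>U. \<Sum>w\<in>U. F1 v * F2 (s \<ominus> v) * (F3 w * F4 (\<ominus> s \<ominus> w)))"
    by (simp add: pairing_def conv_def sum_product)
  also have "\<dots> = (\<Sum>v\<in>U. \<Sum>s\<in>U. \<Sum>w\<in>U. F1 v * F2 (s \<ominus> v) * (F3 w * F4 (\<ominus> s \<ominus> w)))"
    by (rule sum.swap)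
  also have "\<dots> = quad_sum F1 F2 F3 F4"
    unfolding quad_sum_def
  proof (rule sum.cong[OF refl])
    fix v assume v: "v \<in> U"
    have "(\<Sum>s\<in>U. \<Sum>w\<in>U. F1 v * F2 (s \<ominus> v) * (F3 w * F4 (\<ominus> s \<ominus> w))) =
        (\<Sum>x\<in>U. \<Sum>w\<in>U. F1 v * F2 ((v \<oplus> x) \<ominus> v) * (F3 w * F4 (\<ominus> (v \<oplus> x) \<ominus> w)))"
      by (rule sum_translate[OF v, symmetric])
    also have "\<dots> = (\<Sum>x\<in>U. \<Sum>w\<in>U. F1 v * F2 x * F3 w * F4 (\<ominus> (v \<oplus> x \<oplus> w)))"
    proof (intro sum.cong refl)
      fix x w assume xw: "x \<in> U" "w \<in> U"
      have "(v \<oplus> x) \<ominus> v = x"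
        using v xw by (simp add: minus_eq a_comm[of v x] a_assoc r_neg)
      moreover have "\<ominus> (v \<oplus> x) \<ominus> w = \<ominus> (v \<oplus> x \<oplus> w)"
        using v xw by (simp add: minus_eq minus_add)
      ultimately show "F1 v * F2 ((v \<oplus> x) \<ominus> v) * (F3 w * F4 (\<ominus> (v \<oplus> x) \<ominus> w)) =
          F1 v * F2 x * F3 w * F4 (\<ominus> (v \<oplus> x \<oplus> w))"
        by (simp add: mult.assoc)
    qed
    finally show "(\<Sum>s\<in>U. \<Sum>w\<in>U. F1 v * F2 (s \<ominus> v) * (F3 w * F4 (\<ominus> s \<ominus> w))) =
        (\<Sum>x\<in>U. \<Sum>w\<in>U. F1 v * F2 x * F3 w * F4 (\<ominus> (v \<oplus> x \<oplus> w)))" .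
  qed
  finally show ?thesis .
qed

lemma quad_sum_swap: "quad_sum F1 F2 F3 F4 = quad_sum F1 F3 F2 F4"
  unfolding quad_sum_def
proof (rule sum.cong[OF refl])
  fix v assume v: "v \<in> U"
  have "(\<Sum>x\<in>U. \<Sum>w\<in>U. F1 v * F2 x * F3 w * F4 (\<ominus> (v \<oplus> x \<oplus> w))) =
      (\<Sum>w\<in>U. \<Sum>x\<in>U. F1 v * F2 x * F3 w * F4 (\<ominus> (v \<oplus> x \<oplus> w)))"
    by (rule sum.swap)
  also have "\<dots> = (\<Sum>w\<in>U. \<Sum>x\<in>U. F1 v * F3 w * F2 x * F4 (\<ominus> (v \<oplus> w \<oplus> x)))"
  proof (intro sum.cong refl)
    fix w x assume "w \<in> U" "x \<in> U"
    then have "v \<oplus> x \<oplus> w = v \<oplus> w \<oplus> x"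
      using v by (simp add: a_ac)
    then show "F1 v * F2 x * F3 w * F4 (\<ominus> (v \<oplus> x \<oplus> w)) = F1 v * F3 w * F2 x * F4 (\<ominus> (v \<oplus> w \<oplus> x))"
      by simp
  qed
  finally show "(\<Sum>x\<in>U. \<Sum>w\<in>U. F1 v * F2 x * F3 w * F4 (\<ominus> (v \<oplus> x \<oplus> w))) =
      (\<Sum>w\<in>U. \<Sum>x\<in>U. F1 v * F3 w * F2 x * F4 (\<ominus> (v \<oplus> w \<oplus> x)))" .
qed

lemma quad_sum_scale:
  assumes l: "l \<in> U" "l \<noteq> \<zero>"
    and "\<And>v. v \<in> U \<Longrightarrow> F1 (l \<otimes> v) = k1 * F1 v" "\<And>v. v \<in> U \<Longrightarrow> F2 (l \<otimes> v) = k2 * F2 v"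
    and "\<And>v. v \<in> U \<Longrightarrow> F3 (l \<otimes> v) = k3 * F3 v" "\<And>v. v \<in> U \<Longrightarrow> F4 (l \<otimes> v) = k4 * F4 v"
  shows "quad_sum F1 F2 F3 F4 = k1 * k2 * k3 * k4 * quad_sum F1 F2 F3 F4"
proof -
  let ?t = "\<lambda>v x w. F1 v * F2 x * F3 w * F4 (\<ominus> (v \<oplus> x \<oplus> w))"
  have "quad_sum F1 F2 F3 F4 = (\<Sum>v\<in>U. \<Sum>x\<in>U. \<Sum>w\<in>U. ?t (l \<otimes> v) x w)"
    unfolding quad_sum_def by (rule sum_scale[OF l, symmetric])
  also have "\<dots> = (\<Sum>v\<in>U. \<Sum>x\<in>U. \<Sum>w\<in>U. ?t (l \<otimes> v) (l \<otimes> x) w)"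
    by (rule sum.cong[OF refl], rule sum_scale[OF l, symmetric])
  also have "\<dots> = (\<Sum>v\<in>U. \<Sum>x\<in>U. \<Sum>w\<in>U. ?t (l \<otimes> v) (l \<otimes> x) (l \<otimes> w))"
    by (rule sum.cong[OF refl], rule sum.cong[OF refl], rule sum_scale[OF l, symmetric])
  also have "\<dots> = (\<Sum>v\<in>U. \<Sum>x\<in>U. \<Sum>w\<in>U. k1 * k2 * k3 * k4 * ?t v x w)"
  proof (rule sum.cong[OF refl], rule sum.cong[OF refl], rule sum.cong[OF refl])
    fix v x w assume vxw: "v \<in> U" "x \<in> U" "w \<in> U"
    have "\<ominus> (l \<otimes> v \<oplus> l \<otimes> x \<oplus> l \<otimes> w) = l \<otimes> (\<ominus> (v \<oplus> x \<oplus> w))"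
      using vxw l by (simp add: r_distr r_minus)
    then show "?t (l \<otimes> v) (l \<otimes> x) (l \<otimes> w) = k1 * k2 * k3 * k4 * ?t v x w"
      using vxw assms(3-6) by simp
  qed
  also have "\<dots> = k1 * k2 * k3 * k4 * quad_sum F1 F2 F3 F4"
    by (simp only: quad_sum_def sum_distrib_left)
  finally show ?thesis .
qed

end

text \<open>A cubic character, extended by zero, and an element \<open>g\<close> at which it is nontrivial. Its square is written \<open>\<psi>\<close>;
  it is also its complex conjugate.\<close>

locale cubic_character = finite_field R for R (structure) +
  fixes \<chi> :: "'a \<Rightarrow> complex" and g
  assumes chi_zero: "\<chi> \<zero> = 0" and chi_mult: "x \<in> carrier R \<Longrightarrow> y \<in> carrier R \<Longrightarrow> \<chi> (x \<otimes> y) = \<chi> x * \<chi> y"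
    and chi_cube: "x \<in> carrier R \<Longrightarrow> x \<noteq> \<zero> \<Longrightarrow> \<chi> x ^ 3 = 1"
    and g: "g \<in> carrier R" "g \<noteq> \<zero>" "\<chi> g \<noteq> 1"
begin

abbreviation "\<psi> x \<equiv> \<chi> x ^ 2"

lemma chi_one: "\<chi> \<one> = 1"
proof -
  have "\<chi> \<one> * \<chi> \<one> = \<chi> \<one>"
    using chi_mult[of \<one> \<one>] by simp
  moreover have "\<chi> \<one> \<noteq> 0"
    using chi_cube[of \<one>] by auto
  ultimately show ?thesis
    by simp
qed

lemma psi_mult: "x \<in> U \<Longrightarrow> y \<in> U \<Longrightarrow> \<psi> (x \<otimes> y) = \<psi> x * \<psi> y"
  by (simp add: chi_mult power_mult_distrib)

lemma chi_psi: "x \<in> U \<Longrightarrow> x \<noteq> \<zero> \<Longrightarrow> \<chi> x * \<psi> x = 1"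
  using chi_cube[of x] by (simp add: power3_eq_cube power2_eq_square mult.assoc)

lemma chi_neg: "x \<in> U \<Longrightarrow> \<chi> (\<ominus> x) = \<chi> x"
proof -
  assume x: "x \<in> U"
  have nz: "\<ominus> \<one> \<noteq> \<zero>"
    using one_not_zero by (metis minus_minus minus_zero one_closed)
  have "\<chi> (\<ominus> \<one>) * \<chi> (\<ominus> \<one>) = 1"
    using chi_mult[of "\<ominus> \<one>" "\<ominus> \<one>"] chi_one by (simp add: l_minus)
  then have "\<chi> (\<ominus> \<one>) = 1"
    using chi_cube[OF _ nz] by (simp add: power3_eq_cube)
  then show ?thesis
    using chi_mult[of "\<ominus> \<one>" x] x by (simp add: l_minus)
qed

lemma sum_chi: "(\<Sum>v\<in>U. \<chi> v) = 0"
proof -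
  have "(\<Sum>v\<in>U. \<chi> v) = (\<Sum>v\<in>U. \<chi> (g \<otimes> v))"
    by (rule sum_scale[OF g(1,2), symmetric])
  also have "\<dots> = \<chi> g * (\<Sum>v\<in>U. \<chi> v)"
    using g by (simp add: chi_mult sum_distrib_left)
  finally show ?thesis
    using g(3) by simp
qed

lemma psi_g: "\<psi> g \<noteq> 1"
  using chi_psi[OF g(1,2)] g(3) by auto

lemma sum_psi: "(\<Sum>v\<in>U. \<psi> v) = 0"
proof -
  have "(\<Sum>v\<in>U. \<psi> v) = (\<Sum>v\<in>U. \<psi> (g \<otimes> v))"
    by (rule sum_scale[OF g(1,2), symmetric])
  also have "\<dots> = \<psi> g * (\<Sum>v\<in>U. \<psi> v)"
    using g by (simp add: psi_mult sum_distrib_left)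
  finally show ?thesis
    using psi_g by simp
qed

lemma q_pos: "q > 0"
  using finite_carrier zero_closed by (auto simp: card_gt_0_iff)

lemma sum_nonzero: "(\<Sum>v\<in>U - {\<zero>}. (1 :: complex)) = of_nat q - 1"
  using finite_carrier q_pos by (simp add: card_Diff_singleton of_nat_diff)

lemma conv_chi_psi_zero: "conv \<chi> (\<lambda>x. \<psi> x) \<zero> = of_nat q - 1"
proof -
  have "conv \<chi> (\<lambda>x. \<psi> x) \<zero> = (\<Sum>v\<in>U. \<chi> v * \<psi> v)"
    unfolding conv_def by (intro sum.cong refl) (simp add: minus_eq chi_neg)
  also have "\<dots> = (\<Sum>v\<in>U - {\<zero>}. \<chi> v * \<psi> v)"
    using finite_carrier by (intro sum.mono_neutral_right) (auto simp: chi_zero)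
  also have "\<dots> = (\<Sum>v\<in>U - {\<zero>}. 1)"
    by (intro sum.cong refl) (auto simp: chi_psi)
  finally show ?thesis
    using sum_nonzero by simp
qed

lemma conv_chi_psi_const:
  assumes s: "s \<in> U" "s \<noteq> \<zero>" shows "conv \<chi> (\<lambda>x. \<psi> x) s = conv \<chi> (\<lambda>x. \<psi> x) \<one>"
proof -
  have "conv \<chi> (\<lambda>x. \<psi> x) s = (\<Sum>v\<in>U. \<chi> (s \<otimes> v) * \<psi> (s \<ominus> s \<otimes> v))"
    unfolding conv_def by (rule sum_scale[OF s, symmetric])
  also have "\<dots> = conv \<chi> (\<lambda>x. \<psi> x) \<one>"
    unfolding conv_def
  proof (intro sum.cong refl)
    fix v assume v: "v \<in> U"
    have "s \<ominus> s \<otimes> v = s \<otimes> (\<one> \<ominus> v)"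
      using s v by (simp add: minus_eq r_distr r_minus)
    then have "\<chi> (s \<otimes> v) * \<psi> (s \<ominus> s \<otimes> v) = (\<chi> s * \<psi> s) * (\<chi> v * \<psi> (\<one> \<ominus> v))"
      using s v by (simp add: chi_mult psi_mult algebra_simps power2_eq_square)
    then show "\<chi> (s \<otimes> v) * \<psi> (s \<ominus> s \<otimes> v) = \<chi> v * \<psi> (\<one> \<ominus> v)"
      using chi_psi[OF s] by simp
  qed
  finally show ?thesis .
qed

lemma q_gt_1: "q > 1"
proof -
  have "card {\<zero>, \<one>} \<le> q"
    using finite_carrier by (intro card_mono) auto
  then show ?thesis
    using one_not_zero by (simp add: card_insert_if split: if_splits)
qed

lemma conv_chi_psi:
  assumes s: "s \<in> U" "s \<noteq> \<zero>" shows "conv \<chi> (\<lambda>x. \<psi> x) s = - 1"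
proof -
  have "0 = (\<Sum>s\<in>U. conv \<chi> (\<lambda>x. \<psi> x) s)"
    by (simp add: sum_conv sum_chi)
  also have "\<dots> = conv \<chi> (\<lambda>x. \<psi> x) \<zero> + (\<Sum>s\<in>U - {\<zero>}. conv \<chi> (\<lambda>x. \<psi> x) s)"
    by (rule sum.remove[OF finite_carrier zero_closed])
  also have "(\<Sum>s\<in>U - {\<zero>}. conv \<chi> (\<lambda>x. \<psi> x) s) = (\<Sum>s\<in>U - {\<zero>}. 1 * conv \<chi> (\<lambda>x. \<psi> x) \<one>)"
  proof (intro sum.cong refl)
    fix s assume "s \<in> U - {\<zero>}"
    then show "conv \<chi> (\<lambda>x. \<psi> x) s = 1 * conv \<chi> (\<lambda>x. \<psi> x) \<one>"
      using conv_chi_psi_const[of s] by simp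
  qed
  also have "\<dots> = (of_nat q - 1) * conv \<chi> (\<lambda>x. \<psi> x) \<one>"
    unfolding sum_distrib_right[symmetric] sum_nonzero ..
  finally have "0 = (of_nat q - 1 :: complex) + (of_nat q - 1) * conv \<chi> (\<lambda>x. \<psi> x) \<one>"
    unfolding conv_chi_psi_zero .
  then have "(of_nat q - 1 :: complex) * (1 + conv \<chi> (\<lambda>x. \<psi> x) \<one>) = 0"
    by (simp only: distrib_left mult_1_right)
  moreover have "(of_nat q - 1 :: complex) \<noteq> 0"
    using q_gt_1 by (metis eq_iff_diff_eq_0 less_irrefl of_nat_1 of_nat_eq_iff)
  ultimately have "1 + conv \<chi> (\<lambda>x. \<psi> x) \<one> = 0"
    by simp
  then show ?thesis
    using conv_chi_psi_const[OF s] by (simp add: add_eq_0_iff)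
qed

text \<open>The value of the main character sum. In terms of the Gauss sum \<open>G\<close> of \<open>\<chi>\<close> it is \<open>|G|\<^sup>4 (q - 1) / q\<close>, but
  pairing \<open>\<chi>\<close> with its conjugate avoids Gauss sums.\<close>

lemma quad_sum_mixed: "quad_sum \<chi> (\<lambda>x. \<psi> x) \<chi> (\<lambda>x. \<psi> x) = of_nat q * (of_nat q - 1)"
proof -
  let ?B = "conv \<chi> (\<lambda>x. \<psi> x)"
  have "quad_sum \<chi> (\<lambda>x. \<psi> x) \<chi> (\<lambda>x. \<psi> x) = (\<Sum>s\<in>U. ?B s * ?B (\<ominus> s))"
    by (simp add: pairing_conv[symmetric] pairing_def)
  also have "\<dots> = ?B \<zero> * ?B (\<ominus> \<zero>) + (\<Sum>s\<in>U - {\<zero>}. ?B s * ?B (\<ominus> s))"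
    by (rule sum.remove[OF finite_carrier zero_closed])
  also have "(\<Sum>s\<in>U - {\<zero>}. ?B s * ?B (\<ominus> s)) = (\<Sum>s\<in>U - {\<zero>}. 1)"
  proof (intro sum.cong refl)
    fix s assume s: "s \<in> U - {\<zero>}"
    then have "\<ominus> s \<in> U"
      by simp
    moreover have "\<ominus> s \<noteq> \<zero>"
      using s minus_minus[of s] minus_zero by auto
    ultimately show "?B s * ?B (\<ominus> s) = 1"
      using s by (simp add: conv_chi_psi)
  qed
  finally show ?thesis
    unfolding sum_nonzero by (simp add: conv_chi_psi_zero algebra_simps)
qed

text \<open>Scaling by \<open>g\<close> multiplies the sum by \<open>\<chi>(g)\<close> to the total exponent, which is not \<open>1\<close>.\<close>

lemma quad_sum_zero:
  assumes "(e1 + e2 + e3 + e4) mod 3 \<noteq> 0"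
  shows "quad_sum (\<lambda>x. \<chi> x ^ e1) (\<lambda>x. \<chi> x ^ e2) (\<lambda>x. \<chi> x ^ e3) (\<lambda>x. \<chi> x ^ e4) = 0"
proof -
  let ?Q = "quad_sum (\<lambda>x. \<chi> x ^ e1) (\<lambda>x. \<chi> x ^ e2) (\<lambda>x. \<chi> x ^ e3) (\<lambda>x. \<chi> x ^ e4)"
  let ?e = "e1 + e2 + e3 + e4"
  have "?Q = \<chi> g ^ e1 * \<chi> g ^ e2 * \<chi> g ^ e3 * \<chi> g ^ e4 * ?Q"
    using g by (intro quad_sum_scale) (auto simp: chi_mult power_mult_distrib)
  then have eq: "?Q = \<chi> g ^ ?e * ?Q"
    by (simp add: power_add)
  have "\<chi> g ^ ?e = \<chi> g ^ (?e mod 3)"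
  proof -
    have "\<chi> g ^ ?e = \<chi> g ^ (3 * (?e div 3) + ?e mod 3)"
      by simp
    also have "\<dots> = (\<chi> g ^ 3) ^ (?e div 3) * \<chi> g ^ (?e mod 3)"
      by (simp only: power_add power_mult)
    finally show ?thesis
      using chi_cube[OF g(1,2)] by simp
  qed
  moreover have "?e mod 3 = 1 \<or> ?e mod 3 = 2"
    using assms by linarith
  ultimately have "\<chi> g ^ ?e \<noteq> 1"
    using g(3) psi_g by auto
  then show ?thesis
    using eq by simp
qed

text \<open>The nontrivial part of the number of \<open>x\<close> with \<open>ax\<^sup>3 = v\<close>. Here \<open>\<psi>(a) = \<chi>(a)\<^sup>2\<close> is the value of \<open>\<chi>\<close> at the
  inverse of \<open>a\<close>.\<close>

definition hfun :: "'a \<Rightarrow> 'a \<Rightarrow> complex" where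
  "hfun a v = \<psi> a * \<chi> v + \<chi> a * \<psi> v"

lemma sum_hfun: "(\<Sum>v\<in>U. hfun a v) = 0"
  by (simp add: hfun_def sum.distrib sum_distrib_left[symmetric] sum_chi sum_psi)

lemma conv_hfun:
  assumes "s \<in> U"
  shows "conv (hfun a) (hfun b) s = \<psi> a * \<psi> b * conv \<chi> \<chi> s + \<chi> a * \<chi> b * conv (\<lambda>x. \<psi> x) (\<lambda>x. \<psi> x) s +
    (\<psi> a * \<chi> b + \<chi> a * \<psi> b) * conv \<chi> (\<lambda>x. \<psi> x) s"
proof -
  have "conv (hfun a) (hfun b) s = \<psi> a * \<psi> b * conv \<chi> \<chi> s + \<psi> a * \<chi> b * conv \<chi> (\<lambda>x. \<psi> x) s +
      (\<chi> a * \<psi> b * conv (\<lambda>x. \<psi> x) \<chi> s + \<chi> a * \<chi> b * conv (\<lambda>x. \<psi> x) (\<lambda>x. \<psi> x) s)"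
    unfolding conv_def hfun_def sum_distrib_left sum.distrib[symmetric]
    by (intro sum.cong refl) (simp add: algebra_simps)
  then show ?thesis
    using conv_commute[OF assms, of "\<lambda>x. \<psi> x" \<chi>] by (simp add: algebra_simps)
qed

lemma pairing_linear:
  "pairing (\<lambda>s. \<alpha> * F1 s + \<beta> * F2 s + \<gamma> * F3 s) (\<lambda>s. \<alpha>' * F1 s + \<beta>' * F2 s + \<gamma>' * F3 s) =
    \<alpha> * \<alpha>' * pairing F1 F1 + \<alpha> * \<beta>' * pairing F1 F2 + \<alpha> * \<gamma>' * pairing F1 F3 +
    (\<beta> * \<alpha>' * pairing F2 F1 + \<beta> * \<beta>' * pairing F2 F2 + \<beta> * \<gamma>' * pairing F2 F3) +
    (\<gamma> * \<alpha>' * pairing F3 F1 + \<gamma> * \<beta>' * pairing F3 F2 + \<gamma> * \<gamma>' * pairing F3 F3)"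
  unfolding pairing_def sum_distrib_left sum.distrib[symmetric]
  by (intro sum.cong refl) (simp add: algebra_simps)

lemma pairing_hfun:
  "pairing (conv (hfun a) (hfun b)) (conv (hfun c) (hfun d)) = of_nat q * (of_nat q - 1) *
    (\<psi> a * \<psi> b * \<chi> c * \<chi> d + \<chi> a * \<chi> b * \<psi> c * \<psi> d +
     (\<psi> a * \<chi> b + \<chi> a * \<psi> b) * (\<psi> c * \<chi> d + \<chi> c * \<psi> d))"
proof -
  let ?P = "conv \<chi> \<chi>" and ?P' = "conv (\<lambda>x. \<psi> x) (\<lambda>x. \<psi> x)" and ?B = "conv \<chi> (\<lambda>x. \<psi> x)"
  let ?M = "of_nat q * (of_nat q - 1) :: complex"
  have cc: "pairing (conv (hfun a) (hfun b)) (conv (hfun c) (hfun d)) =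
      pairing (\<lambda>s. \<psi> a * \<psi> b * ?P s + \<chi> a * \<chi> b * ?P' s + (\<psi> a * \<chi> b + \<chi> a * \<psi> b) * ?B s)
        (\<lambda>s. \<psi> c * \<psi> d * ?P s + \<chi> c * \<chi> d * ?P' s + (\<psi> c * \<chi> d + \<chi> c * \<psi> d) * ?B s)"
    unfolding pairing_def by (intro sum.cong refl) (simp add: conv_hfun)
  have z: "pairing ?P ?P = 0" "pairing ?P' ?P' = 0" "pairing ?P ?B = 0" "pairing ?B ?P = 0"
    "pairing ?P' ?B = 0" "pairing ?B ?P' = 0"
    using quad_sum_zero[of 1 1 1 1] quad_sum_zero[of 2 2 2 2] quad_sum_zero[of 1 1 1 2]
      quad_sum_zero[of 1 2 1 1] quad_sum_zero[of 2 2 1 2] quad_sum_zero[of 1 2 2 2]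
    by (simp_all add: pairing_conv)
  have BB: "pairing ?B ?B = ?M"
    by (simp add: pairing_conv quad_sum_mixed)
  \<comment> \<open>exchanging the two middle variables turns \<open>\<chi>, \<chi>, \<psi>, \<psi>\<close> into \<open>\<chi>, \<psi>, \<chi>, \<psi>\<close>\<close>
  have PP': "pairing ?P ?P' = ?M"
    using quad_sum_mixed by (simp add: pairing_conv quad_sum_swap[of \<chi> \<chi>])
  have "pairing ?P' ?P = pairing ?P ?P'"
  proof -
    have "(\<Sum>s\<in>U. ?P' s * ?P (\<ominus> s)) = (\<Sum>s\<in>U. ?P' (\<ominus> s) * ?P (\<ominus> (\<ominus> s)))"
      by (rule sum_uminus[symmetric])
    also have "\<dots> = (\<Sum>s\<in>U. ?P s * ?P' (\<ominus> s))"
      by (intro sum.cong refl) (simp add: mult.commute)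
    finally show ?thesis
      by (simp only: pairing_def)
  qed
  then have P'P: "pairing ?P' ?P = ?M"
    using PP' by simp
  show ?thesis
    unfolding cc pairing_linear z BB PP' P'P by (simp add: algebra_simps)
qed

end

subsection \<open>Existence of a cubic character\<close>

lemma cube_root_unity_power_mod:
  fixes \<theta> :: complex
  assumes \<theta>: "\<theta> ^ 3 = 1" shows "\<theta> ^ k = \<theta> ^ (k mod 3)"
proof -
  have "\<theta> ^ k = \<theta> ^ (3 * (k div 3) + k mod 3)"
    by simp
  also have "\<dots> = (\<theta> ^ 3) ^ (k div 3) * \<theta> ^ (k mod 3)"
    by (simp only: power_add power_mult)
  finally show ?thesis
    using \<theta> by simp
qed

lemma cube_root_unity_sum:
  fixes x :: complex
  assumes "x ^ 3 = 1" "x \<noteq> 1" shows "1 + x + x ^ 2 = 0"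
proof -
  have "(x - 1) * (1 + x + x ^ 2) = x ^ 3 - 1"
    by (simp add: algebra_simps power2_eq_square power3_eq_cube)
  then show ?thesis
    using assms by simp
qed

context finite_field
begin

lemma pow3: "x \<in> U \<Longrightarrow> x [^] (3 :: nat) = x \<otimes> x \<otimes> x"
  by (simp add: numeral_3_eq_3)

lemma pow3_mult: "x \<in> U \<Longrightarrow> y \<in> U \<Longrightarrow> (x \<otimes> y) [^] (3 :: nat) = x [^] (3 :: nat) \<otimes> y [^] (3 :: nat)"
  by (rule nat_pow_distrib)

lemma pow3_zero_iff: "x \<in> U \<Longrightarrow> x [^] (3 :: nat) = \<zero> \<longleftrightarrow> x = \<zero>"
  by (auto simp: pow3 integral_iff)

lemma card_cube_fibre:
  assumes x0: "x0 \<in> U" "x0 \<noteq> \<zero>"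
  shows "card {x \<in> U. x [^] (3 :: nat) = x0 [^] (3 :: nat)} = card {x \<in> U. x [^] (3 :: nat) = \<one>}"
proof (rule bij_betw_same_card[symmetric, of "\<lambda>w. x0 \<otimes> w"],
    rule bij_betw_byWitness[where f' = "\<lambda>x. inv x0 \<otimes> x"])
  note i = nonzero_inv[OF x0]
  show "\<forall>w\<in>{x \<in> U. x [^] (3 :: nat) = \<one>}. inv x0 \<otimes> (x0 \<otimes> w) = w"
    using i x0 by (auto simp: m_assoc[symmetric])
  show "\<forall>w\<in>{x \<in> U. x [^] (3 :: nat) = x0 [^] (3 :: nat)}. x0 \<otimes> (inv x0 \<otimes> w) = w"
    using i x0 by (auto simp: m_assoc[symmetric])
  show "(\<otimes>) x0 ` {x \<in> U. x [^] (3 :: nat) = \<one>} \<subseteq> {x \<in> U. x [^] (3 :: nat) = x0 [^] (3 :: nat)}"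
    using x0 by (auto simp: pow3_mult)
  have "inv x0 [^] (3 :: nat) \<otimes> x0 [^] (3 :: nat) = \<one>"
    using i x0 pow3_mult[of "inv x0" x0] by simp
  then show "(\<otimes>) (inv x0) ` {x \<in> U. x [^] (3 :: nat) = x0 [^] (3 :: nat)} \<subseteq> {x \<in> U. x [^] (3 :: nat) = \<one>}"
    using i x0 by (auto simp: pow3_mult)
qed

lemma card_cube_roots_of_unity:
  assumes w: "w \<in> U" "w [^] (3 :: nat) = \<one>" "w \<noteq> \<one>"
  shows "card {x \<in> U. x [^] (3 :: nat) = \<one>} = 3"
proof (rule antisym)
  show "card {x \<in> U. x [^] (3 :: nat) = \<one>} \<le> 3"
    by (rule num_roots_le_deg[OF finite_carrier]) simp
  have w3: "w \<otimes> w \<otimes> w = \<one>"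
    using w by (simp add: pow3)
  have w0: "w \<noteq> \<zero>"
    using w3 by auto
  have "w \<otimes> w \<noteq> \<one>"
  proof
    assume "w \<otimes> w = \<one>"
    then show False
      using w3 w by simp
  qed
  moreover have "w \<otimes> w \<noteq> w"
  proof
    assume "w \<otimes> w = w"
    then have "w \<otimes> w = w \<otimes> \<one>"
      using w by simp
    then show False
      using m_lcancel[OF w0 w(1) w(1) one_closed] w(3) by simp
  qed
  ultimately have "card {\<one>, w, w \<otimes> w} = 3"
    using w by (simp add: card_insert_if)
  moreover have "{\<one>, w, w \<otimes> w} \<subseteq> {x \<in> U. x [^] (3 :: nat) = \<one>}"
    using w by (auto simp: pow3_mult)
  ultimately show "3 \<le> card {x \<in> U. x [^] (3 :: nat) = \<one>}"
    using finite_carrier card_mono[of "{x \<in> U. x [^] (3 :: nat) = \<one>}" "{\<one>, w, w \<otimes> w}"] by simp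
qed

text \<open>On the powers of a generator \<open>g\<close> of the multiplicative group, \<open>\<chi>(g\<^sup>k) = \<theta>\<^sup>k\<close>. This is well defined because the
  order of \<open>g\<close> is divisible by \<open>3\<close>, by the existence of \<open>w\<close>.\<close>

lemma cubic_character_exists:
  fixes \<theta> :: complex
  assumes w: "w \<in> U" "w [^] (3 :: nat) = \<one>" "w \<noteq> \<one>" and \<theta>: "\<theta> ^ 3 = 1" "\<theta> \<noteq> 1"
  obtains \<chi> g where "cubic_character R \<chi> g"
    and "\<forall>u\<in>U. of_nat (card {x \<in> U. x [^] (3 :: nat) = u}) = 1 + \<chi> u + \<chi> u ^ 2"
proof -
  interpret G: group "Multiplicative_Group.mult_of R"
    by (rule field_mult_group)
  obtain g where g: "g \<in> carrier (Multiplicative_Group.mult_of R)" "carrier (Multiplicative_Group.mult_of R) = {g [^] i | i :: nat. i \<in> UNIV}"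
    using finite_field_mult_group_has_gen[OF finite_carrier] by blast
  have gU: "g \<in> U" "g \<noteq> \<zero>"
    using g(1) by auto
  have gen: "\<exists>k :: nat. u = g [^] k" if "u \<in> U" "u \<noteq> \<zero>" for u
    using that g(2) by auto
  have gpow: "g [^] k \<in> U" "g [^] k \<noteq> \<zero>" for k :: nat
    using g(2) by auto
  define n where "n = G.ord g"
  have id: "g [^] k = \<one> \<longleftrightarrow> n dvd k" for k :: nat
    using G.pow_eq_id[OF g(1), of k] by (simp add: n_def Multiplicative_Group.nat_pow_mult_of)
  have "3 dvd n"
  proof (rule ccontr)
    assume "\<not> 3 dvd n"
    then have cop: "coprime n 3"
      using prime_imp_coprime[of 3 n] by (simp add: coprime_commute)
    have "w \<noteq> \<zero>"
      using w pow3_zero_iff[of w] by auto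
    then obtain k :: nat where k: "w = g [^] k"
      using gen w by blast
    then have "g [^] (k * 3) = \<one>"
      using w(2) gU by (simp add: nat_pow_pow)
    then have "n dvd k * 3"
      using id by blast
    then have "n dvd k"
      using cop by (simp add: coprime_dvd_mult_left_iff)
    then show False
      using id k w(3) by blast
  qed
  have \<theta>_eq: "\<theta> ^ i = \<theta> ^ j" if eq: "g [^] i = g [^] j" for i j :: nat
    using eq
  proof (induction i j rule: linorder_wlog)
    case (le i j)
    have "g [^] i \<otimes> g [^] (j - i) = g [^] (i + (j - i))"
      by (rule nat_pow_mult[OF gU(1)])
    also have "\<dots> = g [^] i \<otimes> \<one>"
      using le(1) le(2)[symmetric] r_one[OF gpow(1)] by simp
    finally have "g [^] i \<otimes> g [^] (j - i) = g [^] i \<otimes> \<one>" .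
    then have "g [^] (j - i) = \<one>"
      using m_lcancel[OF gpow(2) gpow(1) gpow(1) one_closed] by blast
    then have "3 dvd j - i"
      using id \<open>3 dvd n\<close> dvd_trans by blast
    then obtain l where "j - i = 3 * l"
      by (rule dvdE)
    then have "j = i + 3 * l"
      using le(1) by simp
    then have "\<theta> ^ j = \<theta> ^ i * (\<theta> ^ 3) ^ l"
      by (simp only: power_add power_mult)
    then show ?case
      using \<theta> by simp
  qed simp
  define \<chi> where "\<chi> u = (if u = \<zero> then 0 else \<theta> ^ (SOME k :: nat. u = g [^] k))" for u
  have chi_pow: "\<chi> (g [^] k) = \<theta> ^ k" for k :: nat
  proof -
    have "g [^] k = g [^] (SOME l :: nat. g [^] k = g [^] l)"
      by (rule someI[of "\<lambda>l. g [^] k = g [^] l" k]) simp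
    then show ?thesis
      using \<theta>_eq[of k "SOME l. g [^] k = g [^] l"] gpow by (simp add: \<chi>_def)
  qed
  interpret X: cubic_character R \<chi> g
  proof
    show "\<chi> \<zero> = 0"
      by (simp add: \<chi>_def)
    fix x y assume xy: "x \<in> U" "y \<in> U"
    show "\<chi> (x \<otimes> y) = \<chi> x * \<chi> y"
    proof (cases "x = \<zero> \<or> y = \<zero>")
      case False
      then obtain k l :: nat where "x = g [^] k" "y = g [^] l"
        using gen xy by metis
      then show ?thesis
        using gU by (simp add: nat_pow_mult chi_pow power_add)
    qed (use xy in \<open>auto simp: \<chi>_def\<close>)
  next
    fix x assume "x \<in> U" "x \<noteq> \<zero>"
    then obtain k :: nat where "x = g [^] k"
      using gen by metis
    then have "\<chi> x ^ 3 = (\<theta> ^ 3) ^ k"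
      by (simp add: chi_pow power_mult[symmetric] mult.commute)
    then show "\<chi> x ^ 3 = 1"
      using \<theta> by simp
  next
    show "\<chi> g \<noteq> 1"
      using chi_pow[of 1] gU \<theta> by simp
  qed (use gU in auto)
  have "of_nat (card {x \<in> U. x [^] (3 :: nat) = u}) = 1 + \<chi> u + \<chi> u ^ 2" if u: "u \<in> U" for u
  proof (cases "u = \<zero>")
    case True
    then have "{x \<in> U. x [^] (3 :: nat) = u} = {\<zero>}"
      using pow3_zero_iff by auto
    then show ?thesis
      using True X.chi_zero by simp
  next
    case u0: False
    show ?thesis
    proof (cases "\<exists>x0\<in>U. x0 [^] (3 :: nat) = u")
      case True
      then obtain x0 where x0: "x0 \<in> U" "u = x0 [^] (3 :: nat)"
        by blast
      then have nz: "x0 \<noteq> \<zero>"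
        using u0 pow3_zero_iff by blast
      have "\<chi> u = \<chi> x0 ^ 3"
        unfolding x0(2) pow3[OF x0(1)] using x0(1) by (simp add: X.chi_mult power3_eq_cube)
      then have "\<chi> u = 1"
        using X.chi_cube[OF x0(1) nz] by simp
      then show ?thesis
        using card_cube_fibre[OF x0(1) nz] card_cube_roots_of_unity[OF w] x0(2) by simp
    next
      case False
      have "\<chi> u \<noteq> 1"
      proof
        assume 1: "\<chi> u = 1"
        obtain k :: nat where k: "u = g [^] k"
          using gen u u0 by blast
        have "\<theta> ^ (k mod 3) = 1"
          using 1 k chi_pow cube_root_unity_power_mod[OF \<theta>(1), of k] by simp
        moreover have "k mod 3 = 0 \<or> k mod 3 = 1 \<or> k mod 3 = 2"
          by linarith
        moreover have "\<theta> ^ 2 \<noteq> 1"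
          using \<theta> by (auto simp: power2_eq_square power3_eq_cube)
        ultimately have "k mod 3 = 0"
          using \<theta>(2) by auto
        then obtain l where "k = l * 3"
          by (metis dvdE dvd_eq_mod_eq_0 mult.commute)
        then have "u = (g [^] l) [^] (3 :: nat)"
          unfolding k using gU by (simp add: nat_pow_pow)
        then show False
          using False gpow by blast
      qed
      then have "1 + \<chi> u + \<chi> u ^ 2 = 0"
        by (rule cube_root_unity_sum[OF X.chi_cube[OF u u0]])
      moreover have empty: "{x \<in> U. x [^] (3 :: nat) = u} = {}"
        using False by blast
      ultimately show ?thesis
        unfolding empty by simp
    qed
  qed
  then show thesis
    using that X.cubic_character_axioms by blast
qed

subsection \<open>Counting solutions\<close>

text \<open>Solutions of \<open>ax\<^sup>3 = v\<close> (their number), of \<open>ax\<^sup>3 + by\<^sup>3 = s\<close> and of \<open>ax\<^sup>3 + by\<^sup>3 + cz\<^sup>3 + dt\<^sup>3 = 0\<close>.\<close>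

definition fibre :: "'a \<Rightarrow> 'a \<Rightarrow> nat" where
  "fibre a v = card {x \<in> U. a \<otimes> x [^] (3 :: nat) = v}"

definition diag2 :: "'a \<Rightarrow> 'a \<Rightarrow> 'a \<Rightarrow> ('a \<times> 'a) set" where
  "diag2 a b s = {(x, y) \<in> U \<times> U. a \<otimes> x [^] (3 :: nat) \<oplus> b \<otimes> y [^] (3 :: nat) = s}"

definition diag4 :: "'a \<Rightarrow> 'a \<Rightarrow> 'a \<Rightarrow> 'a \<Rightarrow> ('a \<times> 'a \<times> 'a \<times> 'a) set" where
  "diag4 a b c d = {(x, y, z, t) \<in> U \<times> U \<times> U \<times> U. a \<otimes> x [^] (3 :: nat) \<oplus> b \<otimes> y [^] (3 :: nat) \<oplus>
     c \<otimes> z [^] (3 :: nat) \<oplus> d \<otimes> t [^] (3 :: nat) = \<zero>}"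

lemma card_diag2:
  assumes "a \<in> U" "b \<in> U" "s \<in> U"
  shows "card (diag2 a b s) = (\<Sum>v\<in>U. fibre a v * fibre b (s \<ominus> v))"
proof -
  have "card (diag2 a b s) = (\<Sum>v\<in>U. card {x \<in> U. a \<otimes> x [^] (3 :: nat) = v} *
      card {y \<in> U. y \<in> {y. b \<otimes> y [^] (3 :: nat) = s \<ominus> v}})"
    unfolding diag2_def
  proof (rule card_pairs_fibre[OF finite_carrier finite_carrier finite_carrier])
    show "(\<lambda>x. a \<otimes> x [^] (3 :: nat)) ` U \<subseteq> U"
      using assms by auto
    fix x y assume "x \<in> U" "y \<in> U"
    then have c: "a \<otimes> x [^] (3 :: nat) \<in> U" "b \<otimes> y [^] (3 :: nat) \<in> U"
      using assms by auto
    have "u \<oplus> w = s \<longleftrightarrow> w = s \<ominus> u" if uw: "u \<in> U" "w \<in> U" for u w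
    proof
      assume "u \<oplus> w = s"
      then have "s \<ominus> u = w \<oplus> u \<ominus> u"
        using uw by (simp add: a_comm)
      then show "w = s \<ominus> u"
        using uw by (simp add: minus_eq a_assoc r_neg)
    next
      assume "w = s \<ominus> u"
      then show "u \<oplus> w = s"
        using uw assms(3) by (simp add: minus_eq a_comm[of u] a_assoc l_neg)
    qed
    then show "a \<otimes> x [^] (3 :: nat) \<oplus> b \<otimes> y [^] (3 :: nat) = s \<longleftrightarrow>
        y \<in> {y. b \<otimes> y [^] (3 :: nat) = s \<ominus> a \<otimes> x [^] (3 :: nat)}"
      using c by simp
  qed
  then show ?thesis
    by (simp add: fibre_def)
qed

lemma card_diag4:
  assumes "a \<in> U" "b \<in> U" "c \<in> U" "d \<in> U"
  shows "card (diag4 a b c d) = (\<Sum>s\<in>U. card (diag2 a b s) * card (diag2 c d (\<ominus> s)))"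
proof -
  define A where "A = (\<lambda>(x, y). a \<otimes> x [^] (3 :: nat) \<oplus> b \<otimes> y [^] (3 :: nat))"
  define B where "B = (\<lambda>(x, y). c \<otimes> x [^] (3 :: nat) \<oplus> d \<otimes> y [^] (3 :: nat))"
  have AB: "A u \<in> U" "B u \<in> U" if "u \<in> U \<times> U" for u
    using that assms by (auto simp: A_def B_def)
  have "bij_betw (\<lambda>((x, y), (z, t)). (x, y, z, t)) {(u, v) \<in> (U \<times> U) \<times> (U \<times> U). A u \<oplus> B v = \<zero>} (diag4 a b c d)"
    by (rule bij_betw_byWitness[where f' = "\<lambda>(x, y, z, t). ((x, y), (z, t))"])
      (use assms in \<open>auto simp: A_def B_def diag4_def a_assoc\<close>)
  then have "card (diag4 a b c d) = card {(u, v) \<in> (U \<times> U) \<times> (U \<times> U). A u \<oplus> B v = \<zero>}"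
    by (rule bij_betw_same_card[symmetric])
  also have "\<dots> = (\<Sum>s\<in>U. card {u \<in> U \<times> U. A u = s} * card {v \<in> U \<times> U. v \<in> {v. B v = \<ominus> s}})"
  proof (rule card_pairs_fibre)
    fix u v assume uv: "u \<in> U \<times> U" "v \<in> U \<times> U"
    have "e \<oplus> f = \<zero> \<longleftrightarrow> f = \<ominus> e" if "e \<in> U" "f \<in> U" for e f
      using that minus_equality[of f e] by (auto simp: a_comm r_neg)
    then show "A u \<oplus> B v = \<zero> \<longleftrightarrow> v \<in> {v. B v = \<ominus> A u}"
      using AB uv by simp
  qed (use finite_carrier AB in auto)
  also have "\<dots> = (\<Sum>s\<in>U. card (diag2 a b s) * card (diag2 c d (\<ominus> s)))"
  proof (intro sum.cong refl)
    fix s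
    have "{u \<in> U \<times> U. A u = s} = diag2 a b s" "{v \<in> U \<times> U. v \<in> {v. B v = \<ominus> s}} = diag2 c d (\<ominus> s)"
      by (auto simp: diag2_def A_def B_def)
    then show "card {u \<in> U \<times> U. A u = s} * card {v \<in> U \<times> U. v \<in> {v. B v = \<ominus> s}} =
        card (diag2 a b s) * card (diag2 c d (\<ominus> s))"
      by simp
  qed
  finally show ?thesis .
qed

text \<open>Without a primitive cube root of unity, cubing is a bijection.\<close>

lemma card_diag4_bijective:
  assumes abcd: "a \<in> U - {\<zero>}" "b \<in> U - {\<zero>}" "c \<in> U - {\<zero>}" "d \<in> U - {\<zero>}"
    and triv: "\<forall>w\<in>U. w [^] (3 :: nat) = \<one> \<longrightarrow> w = \<one>"
  shows "card (diag4 a b c d) = q ^ 3" "e \<in> U - {\<zero>} \<Longrightarrow> v \<in> U \<Longrightarrow> fibre e v = 1"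
proof -
  have inj: "inj_on (\<lambda>x. x [^] (3 :: nat)) U"
  proof (rule inj_onI)
    fix x y assume xy: "x \<in> U" "y \<in> U" "x [^] (3 :: nat) = y [^] (3 :: nat)"
    show "x = y"
    proof (cases "y = \<zero>")
      case True
      then show ?thesis
        using xy pow3_zero_iff[of x] pow3_zero_iff[of y] by simp
    next
      case False
      note i = nonzero_inv[OF xy(2) False]
      have "(inv y \<otimes> x) [^] (3 :: nat) = (inv y \<otimes> y) [^] (3 :: nat)"
        by (simp only: pow3_mult xy i(1))
      then have "inv y \<otimes> x = \<one>"
        using triv i xy by simp
      then have "y \<otimes> (inv y \<otimes> x) = y \<otimes> \<one>"
        by simp
      then show ?thesis
        using xy i by (simp add: m_assoc[symmetric])
    qed
  qed
  then have surj: "(\<lambda>x. x [^] (3 :: nat)) ` U = U"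
    using finite_carrier by (intro endo_inj_surj) auto
  have fibre: "fibre e v = 1" if e: "e \<in> U - {\<zero>}" and v: "v \<in> U" for e v
  proof -
    have ee: "e \<in> U" "e \<noteq> \<zero>"
      using e by auto
    note i = nonzero_inv[OF ee]
    obtain x where x: "x \<in> U" "x [^] (3 :: nat) = inv e \<otimes> v"
      using surj i v by (metis (no_types, lifting) imageE m_closed)
    have "{y \<in> U. e \<otimes> y [^] (3 :: nat) = v} = {x}"
    proof (intro equalityI subsetI)
      fix y assume "y \<in> {y \<in> U. e \<otimes> y [^] (3 :: nat) = v}"
      then have y: "y \<in> U" "v = e \<otimes> y [^] (3 :: nat)"
        by auto
      have "x [^] (3 :: nat) = y [^] (3 :: nat)"
        unfolding x(2) y(2) using i ee y(1) by (simp add: m_assoc[symmetric])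
      then show "y \<in> {x}"
        using inj x(1) y(1) by (simp add: inj_on_def)
    next
      fix y assume "y \<in> {x}"
      then show "y \<in> {y \<in> U. e \<otimes> y [^] (3 :: nat) = v}"
        using x i ee v by (simp add: m_assoc[symmetric])
    qed
    then show ?thesis
      by (simp add: fibre_def)
  qed
  then show "e \<in> U - {\<zero>} \<Longrightarrow> v \<in> U \<Longrightarrow> fibre e v = 1"
    by blast
  have "card (diag2 a b s) = q" "card (diag2 c d s) = q" if "s \<in> U" for s
    using that abcd fibre by (auto simp: card_diag2)
  then show "card (diag4 a b c d) = q ^ 3"
    using abcd by (simp add: card_diag4 power3_eq_cube)
qed

end

context cubic_character
begin

lemma fibre_hfun:
  assumes count: "\<forall>u\<in>U. of_nat (card {x \<in> U. x [^] (3 :: nat) = u}) = 1 + \<chi> u + \<chi> u ^ 2"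
    and a: "a \<in> U - {\<zero>}" and v: "v \<in> U"
  shows "of_nat (fibre a v) = 1 + hfun a v"
proof -
  have aa: "a \<in> U" "a \<noteq> \<zero>"
    using a by auto
  note i = nonzero_inv[OF aa]
  have "a \<otimes> x [^] (3 :: nat) = v \<longleftrightarrow> x [^] (3 :: nat) = inv a \<otimes> v" if "x \<in> U" for x
  proof
    assume "a \<otimes> x [^] (3 :: nat) = v"
    then have "inv a \<otimes> v = inv a \<otimes> (a \<otimes> x [^] (3 :: nat))"
      by simp
    then show "x [^] (3 :: nat) = inv a \<otimes> v"
      using i aa that by (simp add: m_assoc[symmetric])
  next
    assume "x [^] (3 :: nat) = inv a \<otimes> v"
    then show "a \<otimes> x [^] (3 :: nat) = v"
      using i aa v by (simp add: m_assoc[symmetric])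
  qed
  then have "{x \<in> U. a \<otimes> x [^] (3 :: nat) = v} = {x \<in> U. x [^] (3 :: nat) = inv a \<otimes> v}"
    by blast
  then have "of_nat (fibre a v) = 1 + \<chi> (inv a) * \<chi> v + (\<chi> (inv a) * \<chi> v) ^ 2"
    using count[rule_format, of "inv a \<otimes> v"] i v by (simp add: fibre_def chi_mult)
  moreover have "\<chi> (inv a) = \<psi> a"
  proof -
    have "\<chi> (inv a) * \<chi> a = 1"
      using chi_mult[of "inv a" a] i aa chi_one by simp
    then have "\<chi> (inv a) * (\<chi> a * \<psi> a) = \<psi> a"
      by (simp add: mult.assoc[symmetric])
    then show ?thesis
      using chi_psi[OF aa] by simp
  qed
  moreover have "(\<psi> a) ^ 2 = \<chi> a"
  proof -
    have "(\<psi> a) ^ 2 = \<chi> a ^ 3 * \<chi> a"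
      by (simp add: power2_eq_square power3_eq_cube)
    then show ?thesis
      using chi_cube[OF aa] by simp
  qed
  ultimately show ?thesis
    by (simp add: hfun_def power_mult_distrib)
qed

lemma card_diag4_character:
  assumes count: "\<forall>u\<in>U. of_nat (card {x \<in> U. x [^] (3 :: nat) = u}) = 1 + \<chi> u + \<chi> u ^ 2"
    and abcd: "a \<in> U - {\<zero>}" "b \<in> U - {\<zero>}" "c \<in> U - {\<zero>}" "d \<in> U - {\<zero>}"
  shows "(of_nat (card (diag4 a b c d)) :: complex) = of_nat q ^ 3 + of_nat q * (of_nat q - 1) *
    (of_nat (fibre (b \<otimes> c) (a \<otimes> d)) + of_nat (fibre (c \<otimes> d) (a \<otimes> b)) + of_nat (fibre (b \<otimes> d) (a \<otimes> c)) - 3)"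
proof -
  note fh = fibre_hfun[OF count]
  have d2: "(of_nat (card (diag2 a b s)) :: complex) = of_nat q + conv (hfun a) (hfun b) s"
    if ab: "a \<in> U - {\<zero>}" "b \<in> U - {\<zero>}" and s: "s \<in> U" for a b s
  proof -
    have "(of_nat (card (diag2 a b s)) :: complex) = (\<Sum>v\<in>U. (1 + hfun a v) * (1 + hfun b (s \<ominus> v)))"
      using ab s by (simp add: card_diag2 fh)
    also have "\<dots> = (\<Sum>v\<in>U. 1 + hfun a v + hfun b (s \<ominus> v) + hfun a v * hfun b (s \<ominus> v))"
      by (intro sum.cong refl) (simp add: algebra_simps)
    also have "\<dots> = of_nat q + (\<Sum>v\<in>U. hfun a v) + (\<Sum>v\<in>U. hfun b (s \<ominus> v)) + conv (hfun a) (hfun b) s"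
      by (simp add: sum.distrib conv_def)
    also have "(\<Sum>v\<in>U. hfun b (s \<ominus> v)) = (\<Sum>v\<in>U. hfun b v)"
      by (rule sum_reflect[OF s])
    finally show ?thesis
      by (simp add: sum_hfun)
  qed
  let ?H = "conv (hfun a) (hfun b)" and ?H' = "conv (hfun c) (hfun d)"
  have "(of_nat (card (diag4 a b c d)) :: complex) = (\<Sum>s\<in>U. (of_nat q + ?H s) * (of_nat q + ?H' (\<ominus> s)))"
    using abcd by (simp add: card_diag4 d2)
  also have "\<dots> = (\<Sum>s\<in>U. of_nat q * of_nat q + of_nat q * ?H s + of_nat q * ?H' (\<ominus> s) + ?H s * ?H' (\<ominus> s))"
    by (intro sum.cong refl) (simp add: algebra_simps)
  also have "\<dots> = of_nat q ^ 3 + of_nat q * (\<Sum>s\<in>U. ?H s) + of_nat q * (\<Sum>s\<in>U. ?H' (\<ominus> s)) + pairing ?H ?H'"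
    by (simp add: sum.distrib pairing_def sum_distrib_left[symmetric] power3_eq_cube)
  also have "(\<Sum>s\<in>U. ?H' (\<ominus> s)) = (\<Sum>s\<in>U. ?H' s)"
    by (rule sum_uminus)
  also have "of_nat q ^ 3 + of_nat q * (\<Sum>s\<in>U. ?H s) + of_nat q * (\<Sum>s\<in>U. ?H' s) + pairing ?H ?H' =
      of_nat q ^ 3 + pairing ?H ?H'"
    by (simp add: sum_conv sum_hfun)
  finally have N: "(of_nat (card (diag4 a b c d)) :: complex) = of_nat q ^ 3 + pairing ?H ?H'" .
  have nz: "b \<otimes> c \<in> U - {\<zero>}" "c \<otimes> d \<in> U - {\<zero>}" "b \<otimes> d \<in> U - {\<zero>}" "a \<otimes> d \<in> U" "a \<otimes> b \<in> U" "a \<otimes> c \<in> U"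
    using abcd by (auto simp: integral_iff)
  \<comment> \<open>the six products of characters that remain, grouped in conjugate pairs\<close>
  have mults: "hfun (b \<otimes> c) (a \<otimes> d) = \<psi> b * \<psi> c * \<chi> a * \<chi> d + \<chi> b * \<chi> c * \<psi> a * \<psi> d"
    "hfun (c \<otimes> d) (a \<otimes> b) = \<psi> c * \<psi> d * \<chi> a * \<chi> b + \<chi> c * \<chi> d * \<psi> a * \<psi> b"
    "hfun (b \<otimes> d) (a \<otimes> c) = \<psi> b * \<psi> d * \<chi> a * \<chi> c + \<chi> b * \<chi> d * \<psi> a * \<psi> c"
    using abcd by (simp_all add: hfun_def chi_mult power_mult_distrib mult.assoc)
  show ?thesis
    unfolding N pairing_hfun fh[OF nz(1,4)] fh[OF nz(2,5)] fh[OF nz(3,6)] mults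
    by (simp add: algebra_simps)
qed

end

text \<open>The complex number \<open>\<theta>\<close> only serves to construct the character.\<close>

theorem (in finite_field) card_diag4_formula:
  assumes abcd: "a \<in> U - {\<zero>}" "b \<in> U - {\<zero>}" "c \<in> U - {\<zero>}" "d \<in> U - {\<zero>}" and \<theta>: "\<theta> ^ 3 = 1" "\<theta> \<noteq> (1 :: complex)"
  shows "int (card (diag4 a b c d)) = int q ^ 3 + int q * (int q - 1) *
    (int (fibre (b \<otimes> c) (a \<otimes> d)) + int (fibre (c \<otimes> d) (a \<otimes> b)) + int (fibre (b \<otimes> d) (a \<otimes> c)) - 3)"
proof (cases "\<exists>w\<in>U. w [^] (3 :: nat) = \<one> \<and> w \<noteq> \<one>")
  case True
  then obtain w where w: "w \<in> U" "w [^] (3 :: nat) = \<one>" "w \<noteq> \<one>"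
    by blast
  obtain \<chi> g where chi: "cubic_character R \<chi> g"
    and count: "\<forall>u\<in>U. of_nat (card {x \<in> U. x [^] (3 :: nat) = u}) = 1 + \<chi> u + \<chi> u ^ 2"
    using cubic_character_exists[OF w \<theta>] by blast
  interpret cubic_character R \<chi> g
    by (rule chi)
  have "of_int (int (card (diag4 a b c d))) = (of_int (int q ^ 3 + int q * (int q - 1) *
    (int (fibre (b \<otimes> c) (a \<otimes> d)) + int (fibre (c \<otimes> d) (a \<otimes> b)) + int (fibre (b \<otimes> d) (a \<otimes> c)) - 3)) :: complex)"
    using card_diag4_character[OF count abcd] by simp
  then show ?thesis
    by (simp only: of_int_eq_iff)
next
  case False
  then have triv: "\<forall>w\<in>U. w [^] (3 :: nat) = \<one> \<longrightarrow> w = \<one>"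
    by blast
  have nz: "b \<otimes> c \<in> U - {\<zero>}" "c \<otimes> d \<in> U - {\<zero>}" "b \<otimes> d \<in> U - {\<zero>}" "a \<otimes> d \<in> U" "a \<otimes> b \<in> U" "a \<otimes> c \<in> U"
    using abcd by (auto simp: integral_iff)
  note bij = card_diag4_bijective[OF abcd triv]
  show ?thesis
    using bij(1) bij(2)[OF nz(1,4)] bij(2)[OF nz(2,5)] bij(2)[OF nz(3,6)] by simp
qed

subsection \<open>Projective points\<close>

context finite_field
begin

abbreviation "scale l \<equiv> (\<lambda>(x, y, z, t). (l \<otimes> x, l \<otimes> y, l \<otimes> z, l \<otimes> t))"

lemma proportional_eq:
  "proportional R = {(v, w). v \<in> nonzero_quads R \<and> w \<in> nonzero_quads R \<and> (\<exists>l\<in>U - {\<zero>}. w = scale l v)}"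
  by (auto simp: proportional_def)

lemma scale_nonzero:
  assumes "l \<in> U - {\<zero>}" "v \<in> nonzero_quads R" shows "scale l v \<in> nonzero_quads R"
  using assms by (auto simp: nonzero_quads_def integral_iff)

lemma equiv_proportional: "equiv (nonzero_quads R) (proportional R)"
proof (rule equivI)
  show "proportional R \<subseteq> nonzero_quads R \<times> nonzero_quads R"
    by (auto simp: proportional_eq)
  show "refl_on (nonzero_quads R) (proportional R)"
  proof (rule refl_onI)
    fix v assume v: "v \<in> nonzero_quads R"
    then have "v = scale \<one> v"
      by (auto simp: nonzero_quads_def)
    then show "(v, v) \<in> proportional R"
      using v one_not_zero unfolding proportional_eq by blast
  qed
  show "sym (proportional R)"
  proof (rule symI)
    fix v w assume "(v, w) \<in> proportional R"
    then obtain l where l: "v \<in> nonzero_quads R" "w \<in> nonzero_quads R" "l \<in> U" "l \<noteq> \<zero>" "w = scale l v"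
      by (auto simp: proportional_eq)
    note i = nonzero_inv[OF l(3,4)]
    have "v = scale (inv l) w"
      using l i by (auto simp: nonzero_quads_def m_assoc[symmetric])
    then show "(w, v) \<in> proportional R"
      using l i unfolding proportional_eq by blast
  qed
  show "trans (proportional R)"
  proof (rule transI)
    fix u v w assume "(u, v) \<in> proportional R" "(v, w) \<in> proportional R"
    then obtain l m where l: "u \<in> nonzero_quads R" "w \<in> nonzero_quads R" "l \<in> U - {\<zero>}" "m \<in> U - {\<zero>}"
      "v = scale l u" "w = scale m v"
      unfolding proportional_eq by blast
    then have "w = scale (m \<otimes> l) u" "m \<otimes> l \<in> U - {\<zero>}"
      by (auto simp: nonzero_quads_def m_assoc integral_iff)
    then show "(u, w) \<in> proportional R"
      using l unfolding proportional_eq by blast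
  qed
qed

lemma class_eq:
  assumes "v \<in> nonzero_quads R"
  shows "proportional R `` {v} = (\<lambda>l. scale l v) ` (U - {\<zero>})"
  using assms scale_nonzero[OF _ assms] unfolding proportional_eq by blast

lemma card_class:
  assumes v: "v \<in> nonzero_quads R"
  shows "card (proportional R `` {v}) = q - 1"
proof -
  have cancel: "l = m" if "l \<in> U" "m \<in> U" "x \<in> U" "x \<noteq> \<zero>" "l \<otimes> x = m \<otimes> x" for l m x
    using that m_rcancel by blast
  have "inj_on (\<lambda>l. scale l v) (U - {\<zero>})"
    using v by (auto simp: inj_on_def nonzero_quads_def intro: cancel)
  then show ?thesis
    unfolding class_eq[OF v] using finite_carrier by (simp add: card_image card_Diff_singleton)
qed

text \<open>Each projective point consists of \<open>q - 1\<close> nonzero quadruples. The integer coefficients act through their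
  images in the field.\<close>

lemma card_diag_cubic_points:
  fixes a b c d :: int
  defines "A \<equiv> add_pow R a \<one>" and "B \<equiv> add_pow R b \<one>" and "C \<equiv> add_pow R c \<one>" and "D \<equiv> add_pow R d \<one>"
  shows "(q - 1) * card (diag_cubic_points a b c d R) = card (diag4 A B C D) - 1"
proof -
  let ?V = "diag_cubic_points a b c d R" and ?S = "diag4 A B C D - {(\<zero>, \<zero>, \<zero>, \<zero>)}"
  define eq where "eq = (\<lambda>(x, y, z, t). A \<otimes> x [^] (3 :: nat) \<oplus> B \<otimes> y [^] (3 :: nat) \<oplus>
      C \<otimes> z [^] (3 :: nat) \<oplus> D \<otimes> t [^] (3 :: nat) = \<zero>)"
  have ABCD: "A \<in> U" "B \<in> U" "C \<in> U" "D \<in> U"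
    by (auto simp: A_def B_def C_def D_def intro!: add.int_pow_closed)
  have pow: "add_pow R k (x [^] (3 :: nat)) = add_pow R k \<one> \<otimes> x [^] (3 :: nat)" if "x \<in> U" for k :: int and x
    using add_pow_ldistr_int[of \<one> "x [^] (3 :: nat)" k] that by simp
  have S_eq: "?S = {v \<in> nonzero_quads R. eq v}"
    by (auto simp: diag4_def nonzero_quads_def eq_def)
  have eq_scale: "eq (scale l v)" if v: "v \<in> nonzero_quads R" "eq v" and l: "l \<in> U" for l v
  proof -
    obtain x y z t where xyzt: "v = (x, y, z, t)" "x \<in> U" "y \<in> U" "z \<in> U" "t \<in> U"
      using v(1) by (auto simp: nonzero_quads_def)
    have "A \<otimes> (l \<otimes> x) [^] (3 :: nat) \<oplus> B \<otimes> (l \<otimes> y) [^] (3 :: nat) \<oplus> C \<otimes> (l \<otimes> z) [^] (3 :: nat) \<oplus>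
        D \<otimes> (l \<otimes> t) [^] (3 :: nat) = l [^] (3 :: nat) \<otimes> (A \<otimes> x [^] (3 :: nat) \<oplus> B \<otimes> y [^] (3 :: nat) \<oplus>
        C \<otimes> z [^] (3 :: nat) \<oplus> D \<otimes> t [^] (3 :: nat))"
      using xyzt l ABCD by (simp add: pow3_mult r_distr m_lcomm)
    then show ?thesis
      using v(2) l by (simp add: eq_def xyzt(1))
  qed
  have V_eq: "?V = {P \<in> proj3 R. \<forall>v\<in>P. eq v}"
  proof -
    have "(case v of (x, y, z, t) \<Rightarrow>
        add_pow R a (x [^] (3::nat)) \<oplus> add_pow R b (y [^] (3::nat)) \<oplus>
        add_pow R c (z [^] (3::nat)) \<oplus> add_pow R d (t [^] (3::nat)) = \<zero>) \<longleftrightarrow> eq v"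
      if P: "P \<in> proj3 R" "v \<in> P" for P v
    proof -
      have "v \<in> nonzero_quads R"
        using P in_quotient_imp_subset[OF equiv_proportional] unfolding proj3_def by blast
      then show ?thesis
        by (auto simp: nonzero_quads_def eq_def A_def B_def C_def D_def pow)
    qed
    then show ?thesis
      unfolding diag_cubic_points_def by blast
  qed
  have classes: "?V = (\<lambda>v. proportional R `` {v}) ` ?S"
  proof (intro equalityI subsetI)
    fix P assume P: "P \<in> ?V"
    then obtain v where v: "v \<in> nonzero_quads R" "P = proportional R `` {v}"
      unfolding V_eq proj3_def by (auto elim: quotientE)
    have "v \<in> P"
      unfolding v(2) using equiv_class_self[OF equiv_proportional v(1)] .
    then have "v \<in> ?S"
      using P v(1) unfolding V_eq S_eq by blast
    then show "P \<in> (\<lambda>v. proportional R `` {v}) ` ?S"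
      using v(2) by blast
  next
    fix P assume "P \<in> (\<lambda>v. proportional R `` {v}) ` ?S"
    then obtain v where v: "v \<in> nonzero_quads R" "eq v" "P = proportional R `` {v}"
      unfolding S_eq by blast
    have "P \<in> proj3 R"
      unfolding proj3_def v(3) by (rule quotientI[OF v(1)])
    moreover have "eq w" if "w \<in> P" for w
      using that eq_scale[OF v(1,2)] unfolding v(3) class_eq[OF v(1)] by blast
    ultimately show "P \<in> ?V"
      unfolding V_eq by blast
  qed
  have union: "\<Union> ?V = ?S"
  proof (intro equalityI subsetI)
    fix w assume "w \<in> \<Union> ?V"
    then obtain P where P: "P \<in> ?V" "w \<in> P"
      by blast
    then have "w \<in> nonzero_quads R"
      using in_quotient_imp_subset[OF equiv_proportional] unfolding V_eq proj3_def by blast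
    then show "w \<in> ?S"
      using P unfolding V_eq S_eq by blast
  next
    fix w assume w: "w \<in> ?S"
    then have "w \<in> proportional R `` {w}"
      using equiv_class_self[OF equiv_proportional] unfolding S_eq by blast
    then show "w \<in> \<Union> ?V"
      using w unfolding classes by blast
  qed
  have fin: "finite (diag4 A B C D)"
    by (rule finite_subset[of _ "U \<times> U \<times> U \<times> U"]) (auto simp: diag4_def finite_carrier)
  have "(q - 1) * card ?V = card (\<Union> ?V)"
  proof (rule card_partition)
    show "finite ?V"
      unfolding classes using fin by simp
    show "finite (\<Union> ?V)"
      unfolding union using fin by simp
    show "card P = q - 1" if "P \<in> ?V" for P
      using that card_class unfolding classes S_eq by blast
    show "P \<inter> P' = {}" if "P \<in> ?V" "P' \<in> ?V" "P \<noteq> P'" for P P'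
      using quotient_disj[OF equiv_proportional, of P P'] that unfolding V_eq proj3_def by blast
  qed
  also have "\<dots> = card (diag4 A B C D) - 1"
    unfolding union using ABCD fin by (subst card_Diff_singleton) (auto simp: diag4_def pow3)
  finally show ?thesis .
qed

end

subsection \<open>The prime field\<close>

lemma finite_field_residue_ring:
  assumes "Factorial_Ring.prime p" shows "finite_field (residue_ring (int p))"
proof -
  interpret residues_prime p "residue_ring (int p)"
    using assms by (simp add: residues_prime_def)
  show ?thesis
    by unfold_locales auto
qed

context
  fixes p :: nat
  assumes p: "Factorial_Ring.prime p"
begin

interpretation residues_prime p "residue_ring (int p)"
  using p by (simp add: residues_prime_def)

interpretation F: finite_field "residue_ring (int p)"
  by (rule finite_field_residue_ring[OF p])

lemma residue_add_pow:
  assumes "k > 0" shows "add_pow (residue_ring (int p)) (k :: int) \<one>\<^bsub>residue_ring (int p)\<^esub> = k mod int p"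
proof -
  have p1: "int p > 1"
    using prime_gt_1_nat[OF p] by simp
  have "add_pow (residue_ring (int p)) n \<one>\<^bsub>residue_ring (int p)\<^esub> = int n mod int p" for n :: nat
  proof (induction n)
    case 0
    then show ?case
      by (simp add: add.nat_pow_0 res_zero_eq)
  next
    case (Suc n)
    then show ?case
      using p1 by (simp add: add.nat_pow_Suc res_add_eq res_one_eq mod_add_right_eq mod_add_left_eq add.commute)
  qed
  from this[of "nat k"] show ?thesis
    using assms by (simp add: add_pow_int_ge)
qed

lemma residue_fibre:
  "F.fibre ((b mod int p) \<otimes>\<^bsub>residue_ring (int p)\<^esub> (c mod int p)) ((a mod int p) \<otimes>\<^bsub>residue_ring (int p)\<^esub> (d mod int p)) =
    card {y \<in> {0..<int p}. int p dvd (b * c) * y ^ 3 - a * d}"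
proof -
  have "(b * c mod int p) \<otimes>\<^bsub>residue_ring (int p)\<^esub> y [^]\<^bsub>residue_ring (int p)\<^esub> (3 :: nat) = (a * d) mod int p \<longleftrightarrow>
      int p dvd (b * c) * y ^ 3 - a * d" if y: "y \<in> {0..<int p}" for y
  proof -
    have "y [^]\<^bsub>residue_ring (int p)\<^esub> (3 :: nat) = y ^ 3 mod int p"
      using pow_cong[of y 3] y by simp
    then show ?thesis
      by (simp add: mult_cong mod_eq_dvd_iff)
  qed
  moreover have "carrier (residue_ring (int p)) = {0..<int p}"
    by (auto simp: res_carrier_eq)
  ultimately show ?thesis
    unfolding F.fibre_def mult_cong by (metis (no_types, lifting) Collect_cong)
qed

theorem card_diag_cubic_points_residue_ring:
  fixes a b c d :: int and \<theta> :: complex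
  assumes pos: "a > 0" "b > 0" "c > 0" "d > 0" and ndvd: "\<not> int p dvd a" "\<not> int p dvd b" "\<not> int p dvd c" "\<not> int p dvd d"
    and \<theta>: "\<theta> ^ 3 = 1" "\<theta> \<noteq> 1"
  shows "int (card (diag_cubic_points a b c d (residue_ring (int p)))) = int p ^ 2 + int p + 1 + int p *
    (int (card {y \<in> {0..<int p}. int p dvd (b * c) * y ^ 3 - a * d}) +
     int (card {y \<in> {0..<int p}. int p dvd (c * d) * y ^ 3 - a * b}) +
     int (card {y \<in> {0..<int p}. int p dvd (b * d) * y ^ 3 - a * c}) - 3)"
    (is "int ?V = _ + int p * ?\<nu>")
proof -
  have p1: "int p > 1"
    using prime_gt_1_nat[OF p] by simp
  have q: "card (carrier (residue_ring (int p))) = p"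
    by (simp add: res_carrier_eq)
  have nz: "k mod int p \<in> carrier (residue_ring (int p)) - {\<zero>\<^bsub>residue_ring (int p)\<^esub>}" if "\<not> int p dvd k" for k
    using that by (auto simp: res_zero_eq dvd_eq_mod_eq_0)
  let ?N = "card (F.diag4 (a mod int p) (b mod int p) (c mod int p) (d mod int p))"
  have "int ?N = int p ^ 3 + int p * (int p - 1) * ?\<nu>"
    using F.card_diag4_formula[OF nz nz nz nz \<theta>, OF ndvd] unfolding q residue_fibre .
  moreover have "(p - 1) * ?V = ?N - 1"
    using F.card_diag_cubic_points[of a b c d] pos by (simp add: residue_add_pow q)
  moreover have "?N > 0"
  proof -
    have "(\<zero>\<^bsub>residue_ring (int p)\<^esub>, \<zero>\<^bsub>residue_ring (int p)\<^esub>, \<zero>\<^bsub>residue_ring (int p)\<^esub>, \<zero>\<^bsub>residue_ring (int p)\<^esub>) \<in>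
        F.diag4 (a mod int p) (b mod int p) (c mod int p) (d mod int p)"
      by (simp add: F.diag4_def F.pow3)
    moreover have "finite (F.diag4 (a mod int p) (b mod int p) (c mod int p) (d mod int p))"
      by (rule finite_subset[of _ "carrier (residue_ring (int p)) \<times> carrier (residue_ring (int p)) \<times>
          carrier (residue_ring (int p)) \<times> carrier (residue_ring (int p))"])
        (auto simp: F.diag4_def)
    ultimately show ?thesis
      by (auto simp: card_gt_0_iff)
  qed
  ultimately have "(int p - 1) * int ?V = int p ^ 3 + int p * (int p - 1) * ?\<nu> - 1"
  proof -
    assume N: "int ?N = int p ^ 3 + int p * (int p - 1) * ?\<nu>" and V: "(p - 1) * ?V = ?N - 1" and "?N > 0"
    have "int ((p - 1) * ?V) = int ?N - 1"
      unfolding V using \<open>?N > 0\<close> by (simp add: of_nat_diff)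
    moreover have "int ((p - 1) * ?V) = (int p - 1) * int ?V"
      using p1 by (simp add: of_nat_diff)
    ultimately show ?thesis
      unfolding N by simp
  qed
  also have "\<dots> = (int p - 1) * (int p ^ 2 + int p + 1 + int p * ?\<nu>)"
    by (simp add: algebra_simps power2_eq_square power3_eq_cube)
  finally show ?thesis
    using p1 by simp
qed

end

section \<open>Comparison of the two counts\<close>

lemma (in padic) deg_one_count_cubic_split:
  assumes split: "cubic_split rat_ring Qp A"
  shows "deg_one_count A p = card (alg_homs rat_ring A Qp)"
proof -
  interpret T: algebra_field_pair rat_ring A Qp
    using split padic_field_algebra padic_field_field
    by (intro algebra_field_pair.intro algebra_pair.intro) (auto simp: cubic_split_def)
  show ?thesis
    unfolding deg_one_count_def
  proof (rule T.card_factors_of_degree_one)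
    fix \<phi> assume "\<phi> \<in> alg_homs rat_ring A Qp"
    then show "\<exists>e. T.isolates \<phi> e"
      using T.cubic_block_isolates Q.three_nonzero split unfolding cubic_split_def by blast
  qed
qed

lemma (in padic) cube_root_algebra_homs:
  fixes a b :: int
  assumes ab: "\<not> int p dvd 3 * a * b" and \<theta>: "\<theta> ^ 3 = 1" "\<theta> \<noteq> 1" and \<gamma>: "\<gamma> ^ 3 = of_int a / of_int b"
  shows "cubic_split rat_ring Qp (cube_root_algebra \<theta> (of_int a / of_int b) \<gamma>)"
    and "card (alg_homs rat_ring (cube_root_algebra \<theta> (of_int a / of_int b) \<gamma>) Qp) =
      card {y \<in> {0..<int p}. int p dvd b * y ^ 3 - a}"
proof -
  have nz: "(of_int a / of_int b :: rat) \<noteq> 0"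
    using ab by auto
  have g: "\<gamma> ^ 3 = of_rat (of_int a / of_int b)"
    using \<gamma> by (simp add: of_rat_divide)
  note h = Q.card_alg_homs_cube_root_algebra[OF \<theta> nz g card_cube_roots(1)[OF ab]]
  show "cubic_split rat_ring Qp (cube_root_algebra \<theta> (of_int a / of_int b) \<gamma>)"
    by (rule h(1))
  show "card (alg_homs rat_ring (cube_root_algebra \<theta> (of_int a / of_int b) \<gamma>) Qp) =
      card {y \<in> {0..<int p}. int p dvd b * y ^ 3 - a}"
    unfolding h(2) by (rule card_cube_roots(2)[OF ab])
qed

theorem proposition4p1:
  fixes a b c d :: int and \<theta> \<gamma> \<gamma>' \<gamma>'' :: complex and p :: nat
  assumes "a > 0" "b > 0" "c > 0" "d > 0" and "Gcd {a, b, c, d} = 1"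
    and "\<theta> ^ 3 = 1" and "\<forall>k \<in> {1, 2}. \<theta> ^ k \<noteq> 1"
    and "\<gamma> ^ 3 = of_int (a * d) / of_int (b * c)"
    and "\<gamma>' ^ 3 = of_int (a * b) / of_int (c * d)"
    and "\<gamma>'' ^ 3 = of_int (a * c) / of_int (b * d)"
    and "Factorial_Ring.prime p" and "\<not> int p dvd 3 * a * b * c * d"
  defines "E1 \<equiv> cube_root_algebra \<theta> (of_int (a * d) / of_int (b * c)) \<gamma>"
    and "E2 \<equiv> cube_root_algebra \<theta> (of_int (a * b) / of_int (c * d)) \<gamma>'"
    and "E3 \<equiv> cube_root_algebra \<theta> (of_int (a * c) / of_int (b * d)) \<gamma>''"
  defines "E \<equiv> alg_prod [E1, E2, E3]"
  shows "real (card (diag_cubic_points a b c d (residue_ring (int p)))) / real p ^ 2 =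
           1 + (real (deg_one_count E p) - 2) / real p + 1 / real p ^ 2"
proof -
  interpret padic p
    by unfold_locales fact
  have \<theta>: "\<theta> ^ 3 = 1" "\<theta> \<noteq> 1"
    using assms(6,7) by auto
  have ndvd: "\<not> int p dvd a" "\<not> int p dvd b" "\<not> int p dvd c" "\<not> int p dvd d"
    using assms(12) by auto
  have units: "\<not> int p dvd 3 * (a * d) * (b * c)" "\<not> int p dvd 3 * (a * b) * (c * d)"
    "\<not> int p dvd 3 * (a * c) * (b * d)"
    using assms(12) by (simp_all add: mult_ac)
  note E1 = cube_root_algebra_homs[OF units(1) \<theta> assms(8), folded E1_def]
  note E2 = cube_root_algebra_homs[OF units(2) \<theta> assms(9), folded E2_def]
  note E3 = cube_root_algebra_homs[OF units(3) \<theta> assms(10), folded E3_def]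
  have split: "cubic_split rat_ring Qp A" if "A \<in> set [E1, E2, E3]" for A
    using that E1(1) E2(1) E3(1) by auto
  note prod = cubic_split_alg_prod[OF padic_field_algebra padic_field_field, of "[E1, E2, E3]", OF split]
  have count: "deg_one_count E p = card {y \<in> {0..<int p}. int p dvd (b * c) * y ^ 3 - a * d} +
      card {y \<in> {0..<int p}. int p dvd (c * d) * y ^ 3 - a * b} +
      card {y \<in> {0..<int p}. int p dvd (b * d) * y ^ 3 - a * c}"
    unfolding E_def
    using deg_one_count_cubic_split[OF prod(1)] prod(2) E1(2) E2(2) E3(2) by simp
  have "int (card (diag_cubic_points a b c d (residue_ring (int p)))) =
      int p ^ 2 + int p + 1 + int p * (int (deg_one_count E p) - 3)"
    using card_diag_cubic_points_residue_ring[OF p_prime assms(1-4) ndvd \<theta>] unfolding count by simp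
  then have "of_int (int (card (diag_cubic_points a b c d (residue_ring (int p))))) =
      (of_int (int p ^ 2 + int p + 1 + int p * (int (deg_one_count E p) - 3)) :: real)"
    by (simp only:)
  then have points: "real (card (diag_cubic_points a b c d (residue_ring (int p)))) =
      real p ^ 2 + real p + 1 + real p * (real (deg_one_count E p) - 3)"
    by simp
  have "(r ^ 2 + r + 1 + r * (v - 3)) / r ^ 2 = 1 + (v - 2) / r + 1 / r ^ 2" if "r \<noteq> 0" for r v :: real
  proof -
    have "(r ^ 2 + r + 1 + r * (v - 3)) / r ^ 2 = (r ^ 2 + (v - 2) * r + 1) / r ^ 2"
      by (simp add: algebra_simps)
    also have "\<dots> = r ^ 2 / r ^ 2 + (v - 2) * r / (r * r) + 1 / r ^ 2"
      by (simp only: add_divide_distrib power2_eq_square)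
    also have "\<dots> = 1 + (v - 2) / r + 1 / r ^ 2"
      using that by simp
    finally show ?thesis .
  qed
  then show ?thesis
    unfolding points using p_gt_1 by simp
qed

end
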